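(* Let $G$ be a polycyclic group with a fixed polycycle structure. The language of an II-avoshift on $G$ is safely computable, uniformly in the SFT: there is an algorithm which, given a finite set of forbidden patterns defining an SFT $X$ on $G$ and a finite pattern $P$, either answers whether $P$ occurs in $X$ or never halts, never gives an incorrect answer, and always halts if $X$ is an II-avoshift. In particular, given two SFTs $X,Y$ on $G$ such that $X$ is an II-avoshift, the inclusion $X\subset Y$ can be safely decided: there is an algorithm which, given any two SFTs $X,Y$ on $G$, never gives an incorrect answer to the question whether $X\subset Y$, and always gives an answer if $X$ is an II-avoshift.
   Context: Let $A$ be a finite alphabet; $G$ acts on $A^G$ by $(gx)_h=x_{g^{-1}h}$; a subshift is a closed $G$-invariant $X\subset A^G$. $X|C=\{x|C:x\in X\}$. A pattern is $P\in A^D$, $D\subset G$ finite; it occurs in $x\in A^G$ if for some $g\in G$, $x_{gh}=P_h$ for all $h\in D$; it occurs in $X$ if it occurs in some point of $X$. An SFT is the set of $x\in A^G$ in which no pattern from a given finite set (forbidden patterns) occurs; SFTs are given to algorithms by forbidden patterns. A subshift $X$ is avo for $C\subset G\setminus\{e\}$ if there is a finite $B\subset C$ such that for all $x\in X|C$ and $a\in A$: $(x|B)\sqcup a^e\in X|(B\cup\{e\})\iff x\sqcup a^e\in X|(C\cup\{e\})$, where $a^e$ is the pattern with domain $\{e\}$ and value $a$. An II-avoshift is a subshift that is avo for every inductive interval. Polycycle structure and inductive intervals: $1=H_0<H_1<\cdots<H_n=G$ are subgroups, each normal in the next, $H_i/H_{i-1}$ cyclic of order $k_i\le\infty$ generated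 by $h_iH_{i-1}$. An interval $I\subset\mathbb Z$ grazes $0$ if it has one of the forms $(-\infty,-1],[-m,-1],\emptyset,[1,m],[1,\infty)$. In $\mathbb Z_k$ ($k<\infty$) intervals are images of intervals of $\mathbb Z$, and such an interval grazes $0$ if it is empty, or contains $1$ or $-1$ but not $0$. An inductive interval is a set $I\subset G$ determined by a tuple $(I_1,\dots,I_n)$, $I_i$ an interval grazing $0$ in $\mathbb Z_{k_i}$ (in $\mathbb Z$ if $k_i=\infty$): $e\notin I$, and for $g\neq e$, letting $i$ be least with $g\in H_i$ and $t$ the exponent with $g\in h_i^tH_{i-1}$, $g\in I$ iff $t\in I_i$. *)

theory Defs
  imports "HOL-Algebra.Generated_Groups" "HOL-Algebra.Multiplicative_Group"
    "HOL-Analysis.Function_Topology" "HOL-Library.Nat_Bijection"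
begin

section \<open>Partial recursive functions\<close>

datatype recf = Zero | Succ | Proj nat | Comp recf "recf list" | PrimRec recf recf | Mu recf

text \<open>\<open>rec_eval f xs y\<close>: on the arguments \<open>xs\<close> the computation of \<open>f\<close> halts with value \<open>y\<close>.
  Primitive recursion and minimization act on the first argument. Minimization is
  unbounded search, and it requires \<open>f\<close> to halt below the value found.\<close>

inductive rec_eval :: "recf \<Rightarrow> nat list \<Rightarrow> nat \<Rightarrow> bool" where
  zero: "rec_eval Zero xs 0"
| succ: "rec_eval Succ (x # xs) (Suc x)"
| proj: "i < length xs \<Longrightarrow> rec_eval (Proj i) xs (xs ! i)"
| comp: "list_all2 (\<lambda>g y. rec_eval g xs y) gs ys \<Longrightarrow> rec_eval f ys z
    \<Longrightarrow> rec_eval (Comp f gs) xs z"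
| prim_0: "rec_eval f xs y \<Longrightarrow> rec_eval (PrimRec f g) (0 # xs) y"
| prim_Suc: "rec_eval (PrimRec f g) (m # xs) r \<Longrightarrow> rec_eval g (m # r # xs) y
    \<Longrightarrow> rec_eval (PrimRec f g) (Suc m # xs) y"
| mu: "rec_eval f (m # xs) 0 \<Longrightarrow> \<forall>i<m. \<exists>v. rec_eval f (i # xs) (Suc v)
    \<Longrightarrow> rec_eval (Mu f) xs m"

text \<open>\<open>f\<close> never answers the question \<open>Q\<close> incorrectly on the arguments \<open>xs\<close> (1 is yes, 0 is no,
  and no other output is allowed), and it answers if the condition \<open>S\<close> holds.\<close>

definition safely_answers :: "recf \<Rightarrow> nat list \<Rightarrow> bool \<Rightarrow> bool \<Rightarrow> bool" where
  "safely_answers f xs Q S \<longleftrightarrow>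
     (\<forall>v. rec_eval f xs v \<longrightarrow> v = (if Q then 1 else 0)) \<and> (S \<longrightarrow> (\<exists>v. rec_eval f xs v))"


section \<open>Subshifts\<close>

definition shift :: "('g, 'm) monoid_scheme \<Rightarrow> 'g \<Rightarrow> ('g \<Rightarrow> 'b) \<Rightarrow> 'g \<Rightarrow> 'b" where
  "shift G g x = (\<lambda>h\<in>carrier G. x (inv\<^bsub>G\<^esub> g \<otimes>\<^bsub>G\<^esub> h))"

definition subshift :: "('g, 'm) monoid_scheme \<Rightarrow> 'b set \<Rightarrow> ('g \<Rightarrow> 'b) set \<Rightarrow> bool" where
  "subshift G A X \<longleftrightarrow>
     closedin (product_topology (\<lambda>_. discrete_topology A) (carrier G)) X \<and>
     (\<forall>g\<in>carrier G. \<forall>x\<in>X. shift G g x \<in> X)"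

definition restr :: "('g \<Rightarrow> 'b) set \<Rightarrow> 'g set \<Rightarrow> ('g \<Rightarrow> 'b) set" where
  "restr X C = (\<lambda>x. restrict x C) ` X"

text \<open>A pattern is a partial map; its domain is the finite set on which it lives.\<close>

definition is_pattern :: "('g, 'm) monoid_scheme \<Rightarrow> 'b set \<Rightarrow> ('g \<rightharpoonup> 'b) \<Rightarrow> bool" where
  "is_pattern G A P \<longleftrightarrow> finite (dom P) \<and> dom P \<subseteq> carrier G \<and> ran P \<subseteq> A"

definition occurs_in_point :: "('g, 'm) monoid_scheme \<Rightarrow> ('g \<rightharpoonup> 'b) \<Rightarrow> ('g \<Rightarrow> 'b) \<Rightarrow> bool" where
  "occurs_in_point G P x \<longleftrightarrow> (\<exists>g\<in>carrier G. \<forall>h\<in>dom P. Some (x (g \<otimes>\<^bsub>G\<^esub> h)) = P h)"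

definition occurs_in :: "('g, 'm) monoid_scheme \<Rightarrow> ('g \<rightharpoonup> 'b) \<Rightarrow> ('g \<Rightarrow> 'b) set \<Rightarrow> bool" where
  "occurs_in G P X \<longleftrightarrow> (\<exists>x\<in>X. occurs_in_point G P x)"

definition SFT :: "('g, 'm) monoid_scheme \<Rightarrow> 'b set \<Rightarrow> ('g \<rightharpoonup> 'b) set \<Rightarrow> ('g \<Rightarrow> 'b) set" where
  "SFT G A F = {x \<in> carrier G \<rightarrow>\<^sub>E A. \<forall>P\<in>F. \<not> occurs_in_point G P x}"

text \<open>Elements of \<open>restr X C\<close> are \<open>undefined\<close> outside \<open>C\<close>, and \<open>\<one> \<notin> C\<close>, so
  \<open>x(\<one> := a)\<close> is the extension of \<open>x\<close> by the letter \<open>a\<close> at the identity.\<close>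

definition avo :: "('g, 'm) monoid_scheme \<Rightarrow> 'b set \<Rightarrow> ('g \<Rightarrow> 'b) set \<Rightarrow> 'g set \<Rightarrow> bool" where
  "avo G A X C \<longleftrightarrow> C \<subseteq> carrier G - {\<one>\<^bsub>G\<^esub>} \<and>
     (\<exists>B. finite B \<and> B \<subseteq> C \<and>
       (\<forall>x\<in>restr X C. \<forall>a\<in>A.
          (restrict x B)(\<one>\<^bsub>G\<^esub> := a) \<in> restr X (B \<union> {\<one>\<^bsub>G\<^esub>}) \<longleftrightarrow>
          x(\<one>\<^bsub>G\<^esub> := a) \<in> restr X (C \<union> {\<one>\<^bsub>G\<^esub>})))"


section \<open>Polycycle structures and inductive intervals\<close>

locale polycycle = group G for G (structure) +
  fixes n :: nat and H :: "nat \<Rightarrow> 'a set" and h :: "nat \<Rightarrow> 'a"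
  assumes H_0: "H 0 = {\<one>}"
    and H_n: "H n = carrier G"
    and H_subgroup: "i \<le> n \<Longrightarrow> subgroup (H i) G"
    and H_strict: "i < n \<Longrightarrow> H i \<subset> H (Suc i)"
    and H_normal: "i < n \<Longrightarrow> H i \<lhd> G\<lparr>carrier := H (Suc i)\<rparr>"
    and h_in: "i < n \<Longrightarrow> h (Suc i) \<in> H (Suc i)"
    and h_generates: "i < n \<Longrightarrow>
      carrier (G\<lparr>carrier := H (Suc i)\<rparr> Mod H i) =
      generate (G\<lparr>carrier := H (Suc i)\<rparr> Mod H i) {h (Suc i) <# H i}"

text \<open>The order \<open>k\<^sub>i\<close> of the \<open>i\<close>-th factor. The library's \<open>ord\<close> is 0 for elements of infinite
  order, which agrees with \<open>\<int>\<^sub>0 = \<int>\<close> and \<open>t mod 0 = t\<close>.\<close>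

definition factor_order ::
    "('g, 'm) monoid_scheme \<Rightarrow> (nat \<Rightarrow> 'g set) \<Rightarrow> (nat \<Rightarrow> 'g) \<Rightarrow> nat \<Rightarrow> nat" where
  "factor_order G H h i =
     group.ord (G\<lparr>carrier := H i\<rparr> Mod H (i - 1)) (h i <#\<^bsub>G\<^esub> H (i - 1))"

definition int_interval :: "int set \<Rightarrow> bool" where
  "int_interval J \<longleftrightarrow> (\<forall>a\<in>J. \<forall>b\<in>J. {a..b} \<subseteq> J)"

text \<open>For \<open>k > 0\<close>, subsets of \<open>\<int>\<^sub>k\<close> are given by their representatives in \<open>{0..<k}\<close>.\<close>

definition grazes_0 :: "nat \<Rightarrow> int set \<Rightarrow> bool" where
  "grazes_0 k I \<longleftrightarrow>
     (if k = 0
      then I = {..-1} \<or> (\<exists>m\<ge>1. I = {-m..-1}) \<or> I = {} \<or> (\<exists>m\<ge>1. I = {1..m}) \<or> I = {1..}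
      else (\<exists>J. int_interval J \<and> I = (\<lambda>t. t mod int k) ` J) \<and>
           (I = {} \<or> (1 mod int k \<in> I \<or> (-1) mod int k \<in> I) \<and> 0 \<notin> I))"

definition inductive_interval_of ::
    "('g, 'm) monoid_scheme \<Rightarrow> (nat \<Rightarrow> 'g set) \<Rightarrow> (nat \<Rightarrow> 'g) \<Rightarrow> (nat \<Rightarrow> int set) \<Rightarrow> 'g set" where
  "inductive_interval_of G H h Is =
     {g \<in> carrier G. g \<noteq> \<one>\<^bsub>G\<^esub> \<and>
        (let i = (LEAST i. g \<in> H i) in
         \<exists>t::int. g \<in> (h i [^]\<^bsub>G\<^esub> t) <#\<^bsub>G\<^esub> H (i - 1) \<and> t mod int (factor_order G H h i) \<in> Is i)}"

definition inductive_interval ::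
    "('g, 'm) monoid_scheme \<Rightarrow> nat \<Rightarrow> (nat \<Rightarrow> 'g set) \<Rightarrow> (nat \<Rightarrow> 'g) \<Rightarrow> 'g set \<Rightarrow> bool" where
  "inductive_interval G n H h I \<longleftrightarrow>
     (\<exists>Is. (\<forall>i\<in>{1..n}. grazes_0 (factor_order G H h i) (Is i)) \<and>
           I = inductive_interval_of G H h Is)"

definition II_avoshift ::
    "('g, 'm) monoid_scheme \<Rightarrow> nat \<Rightarrow> (nat \<Rightarrow> 'g set) \<Rightarrow> (nat \<Rightarrow> 'g) \<Rightarrow> 'b set
      \<Rightarrow> ('g \<Rightarrow> 'b) set \<Rightarrow> bool" where
  "II_avoshift G n H h A X \<longleftrightarrow>
     subshift G A X \<and> (\<forall>I. inductive_interval G n H h I \<longrightarrow> avo G A X I)"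


section \<open>Patterns as inputs of algorithms\<close>

text \<open>Group elements are given by words in \<open>h\<^sub>1\<^sup>\<plusminus>\<^sup>1, \<dots>, h\<^sub>n\<^sup>\<plusminus>\<^sup>1\<close>: the integer \<open>j\<close> with
  \<open>1 \<le> \<bar>j\<bar> \<le> n\<close> stands for \<open>h\<^sub>j\<close> if \<open>j > 0\<close> and for the inverse of \<open>h\<^sub>-\<^sub>j\<close> if \<open>j < 0\<close>.\<close>

definition is_word :: "nat \<Rightarrow> int list \<Rightarrow> bool" where
  "is_word n w \<longleftrightarrow> (\<forall>j\<in>set w. j \<noteq> 0 \<and> \<bar>j\<bar> \<le> int n)"

definition word_val :: "('g, 'm) monoid_scheme \<Rightarrow> (nat \<Rightarrow> 'g) \<Rightarrow> int list \<Rightarrow> 'g" where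
  "word_val G h w = foldr (\<lambda>j g. (h (nat \<bar>j\<bar>) [^]\<^bsub>G\<^esub> sgn j) \<otimes>\<^bsub>G\<^esub> g) w \<one>\<^bsub>G\<^esub>"

text \<open>Letters are given by their position in an enumeration \<open>ls\<close> of the alphabet. A pattern is
  given by a list of pairs (word, letter) that enumerates its graph. Different words
  in the list may denote the same group element.\<close>

definition encode_entry :: "int list \<times> nat \<Rightarrow> nat" where
  "encode_entry = (\<lambda>(w, a). prod_encode (list_encode (map int_encode w), a))"

definition codes_pattern ::
    "('g, 'm) monoid_scheme \<Rightarrow> nat \<Rightarrow> (nat \<Rightarrow> 'g) \<Rightarrow> 'b list \<Rightarrow> nat \<Rightarrow> ('g \<rightharpoonup> 'b) \<Rightarrow> bool" where
  "codes_pattern G n h ls c P \<longleftrightarrow> is_pattern G (set ls) P \<and>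
     (\<exists>p. c = list_encode (map encode_entry p) \<and>
          (\<forall>(w, a)\<in>set p. is_word n w \<and> a < length ls) \<and>
          Map.graph P = (\<lambda>(w, a). (word_val G h w, ls ! a)) ` set p)"

definition codes_pattern_set ::
    "('g, 'm) monoid_scheme \<Rightarrow> nat \<Rightarrow> (nat \<Rightarrow> 'g) \<Rightarrow> 'b list \<Rightarrow> nat \<Rightarrow> ('g \<rightharpoonup> 'b) set \<Rightarrow> bool" where
  "codes_pattern_set G n h ls c F \<longleftrightarrow>
     (\<exists>cs Ps. c = list_encode cs \<and> list_all2 (codes_pattern G n h ls) cs Ps \<and> F = set Ps)"

end

(* Order the group by the lexicographic order of its coordinates, each coordinate enumerated as
   0, -1, 1, -2, 2, ... This is a well-order, and the set of predecessors of g is a translate g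
   C_g of an inductive interval C_g. A limit of sets C_g is again an inductive interval C, and C
   contains the nearby C_g. The avo condition for C, with its finite set B, therefore passes to
   these C_g, so by compactness a single finite set W decides, for all g, the admissible letters
   at g from the part of g C_g that lies in g W. It follows that in an II-avoshift X a partial
   configuration on g C_g extends to X as soon as it contains none of the patterns on subsets of
   W that do not occur in X.

   Hence X has a finite set Q of forbidden patterns such that configurations on predecessor sets
   that avoid Q never get stuck, and again by compactness this is witnessed by finitely many
   finite partial configurations. Conversely, whenever a finite set Q containing the given
   forbidden patterns has this checkable property, the group can be filled letter by letter,
   starting from a finite pattern that is closed under the dependencies, without ever creating a
   forbidden pattern; so a pattern found in this way does occur, whether or not X is an II-
   avoshift. Non-occurrence is semidecidable by compactness. Both searches run in parallel over
   codes of certificates. *)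
theory Submission
  imports Defs
begin

section \<open>Total recursive functions\<close>

text \<open>The enumeration 0, -1, 1, -2, ... meets two demands at once: it well-orders each
  infinite factor, so that filling always has a next cell, and the integers before any s form an
  interval adjacent to s, so that predecessor sets are translates of inductive intervals. Limits
  have to be approached from inside, because the avo condition for C with witness B passes to the
  sets between B and C, but in general not to larger ones. The given forbidden patterns do not
  suffice for filling: a partial configuration may contain none of them and still be a dead end. So
  Q is guessed as a part of the certificate. Whether its members occur in X is never asked: a
  filling that avoids Q avoids the given patterns, and this is all that correctness takes. The
  condition on Q concerns all g, but each predecessor set is seen only through a finite window.
  There, large coordinates of equal sign in an infinite factor look alike, so a finite box of
  coordinates represents all g. The group is fixed; the words that express conjugates of generators,
  and powers of generators that fall into lower subgroups, are constants of the algorithm.\<close>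

lemma rec_eval_det: "rec_eval f xs y \<Longrightarrow> rec_eval f xs z \<Longrightarrow> y = z"
proof (induction arbitrary: z rule: rec_eval.induct)
  case (comp xs gs ys f w)
  from comp.prems obtain ys' where ys': "list_all2 (\<lambda>g y. rec_eval g xs y) gs ys'" "rec_eval f ys' z"
    by (cases rule: rec_eval.cases) auto
  have "ys = ys'"
    using comp.IH(1) ys'(1)
    by (auto simp: list_all2_conv_all_nth intro!: nth_equalityI)
  with ys' comp.IH show ?case by blast
next
  case (prim_Suc f g m xs r y)
  from prim_Suc.prems show ?case
    by (cases rule: rec_eval.cases) (use prim_Suc.IH in auto)
next
  case (mu f m xs)
  from mu.prems show ?case
  proof (cases rule: rec_eval.cases)
    case mu
    show ?thesis
    proof (rule linorder_cases[of m z])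
      assume "m < z"
      with mu obtain v where "rec_eval f (m # xs) (Suc v)" by blast
      with \<open>\<And>z. rec_eval f (m # xs) z \<Longrightarrow> 0 = z\<close> show ?thesis by force
    next
      assume "z < m"
      with \<open>\<forall>i<m. \<exists>v. rec_eval f (i # xs) (Suc v) \<and> (\<forall>x. rec_eval f (i # xs) x \<longrightarrow> Suc v = x)\<close>
      obtain v where "\<And>x. rec_eval f (z # xs) x \<Longrightarrow> Suc v = x" by blast
      with mu show ?thesis by force
    qed
  qed
next
  case (zero xs)
  then show ?case by (cases rule: rec_eval.cases) auto
next
  case (succ x xs)
  then show ?case by (cases rule: rec_eval.cases) auto
next
  case (proj i xs)
  from proj.prems show ?case by (cases rule: rec_eval.cases) auto
next
  case (prim_0 f xs y g)
  from prim_0.prems show ?case by (cases rule: rec_eval.cases) (auto intro: prim_0.IH)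
qed

text \<open>Totality on lists of length \<open>k\<close> is built in. Partial computations are left
  to the final search.\<close>

definition recursive :: "nat \<Rightarrow> (nat list \<Rightarrow> nat) \<Rightarrow> bool" where
  "recursive k f \<longleftrightarrow> (\<exists>r. \<forall>xs. length xs = k \<longrightarrow> rec_eval r xs (f xs))"

lemma recursiveI: "(\<And>xs. length xs = k \<Longrightarrow> rec_eval r xs (f xs)) \<Longrightarrow> recursive k f"
  by (auto simp: recursive_def)

lemma recursive_cong: "recursive k f \<Longrightarrow> (\<And>xs. length xs = k \<Longrightarrow> f xs = g xs) \<Longrightarrow> recursive k g"
  by (auto simp: recursive_def)

lemma recursive_proj: "i < k \<Longrightarrow> recursive k (\<lambda>xs. xs ! i)"
  by (auto intro!: recursiveI[where r = "Proj i"] rec_eval.proj)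

lemma recursive_comp:
  assumes "recursive (length gs) f" "\<forall>g\<in>set gs. recursive k g"
  shows "recursive k (\<lambda>xs. f (map (\<lambda>g. g xs) gs))"
proof -
  from assms(1) obtain r where r: "\<And>xs. length xs = length gs \<Longrightarrow> rec_eval r xs (f xs)"
    by (auto simp: recursive_def)
  from assms(2) obtain R where R: "\<And>g xs. g \<in> set gs \<Longrightarrow> length xs = k \<Longrightarrow> rec_eval (R g) xs (g xs)"
    unfolding recursive_def by metis
  show ?thesis
    by (rule recursiveI[where r = "Comp r (map R gs)"], rule rec_eval.comp[where ys = "map (\<lambda>g. g _) gs"])
      (auto simp: list_all2_conv_all_nth intro!: R r)
qed

lemma recursive_comp1: "recursive 1 (\<lambda>xs. f (xs ! 0)) \<Longrightarrow> recursive k g \<Longrightarrow> recursive k (\<lambda>xs. f (g xs))"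
  using recursive_comp[of "[g]" "\<lambda>xs. f (xs ! 0)" k] by simp

lemma recursive_comp2:
  "recursive 2 (\<lambda>xs. f (xs ! 0) (xs ! 1)) \<Longrightarrow> recursive k g \<Longrightarrow> recursive k g'
    \<Longrightarrow> recursive k (\<lambda>xs. f (g xs) (g' xs))"
  using recursive_comp[of "[g, g']" "\<lambda>xs. f (xs ! 0) (xs ! 1)" k] by (simp add: numeral_2_eq_2)

lemma recursive_Suc: "recursive k g \<Longrightarrow> recursive k (\<lambda>xs. Suc (g xs))"
proof (rule recursive_comp1[where f = Suc])
  show "recursive 1 (\<lambda>xs. Suc (xs ! 0))"
    by (rule recursiveI[where r = Succ]) (auto simp: length_Suc_conv intro: rec_eval.succ)
qed

lemma recursive_const: "recursive k (\<lambda>_. c)"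
proof (induction c)
  case 0
  show ?case by (rule recursiveI[where r = Zero]) (rule rec_eval.zero)
qed (rule recursive_Suc)

lemma recursive_prim:
  assumes "recursive k f" "recursive (Suc (Suc k)) g"
  shows "recursive (Suc k) (\<lambda>xs. rec_nat (f (tl xs)) (\<lambda>m r. g (m # r # tl xs)) (hd xs))"
proof -
  from assms obtain r s where r: "\<And>xs. length xs = k \<Longrightarrow> rec_eval r xs (f xs)"
    and s: "\<And>xs. length xs = Suc (Suc k) \<Longrightarrow> rec_eval s xs (g xs)"
    by (auto simp: recursive_def)
  have *: "rec_eval (PrimRec r s) (m # xs) (rec_nat (f xs) (\<lambda>m r. g (m # r # xs)) m)"
    if "length xs = k" for m xs
    by (induction m) (auto intro!: rec_eval.prim_0 rec_eval.prim_Suc r s simp: that)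
  show ?thesis
    by (rule recursiveI[where r = "PrimRec r s"]) (auto simp: length_Suc_conv *)
qed

text \<open>\<open>PrimRec\<close> counts down its first argument and keeps the others as
  parameters. Here the counter is itself computed from the list, so the recursion is composed with
  \<open>n\<close> followed by all projections, which hand the list on unchanged.\<close>

lemma recursive_rec_nat:
  assumes "recursive k n" "recursive k f" "recursive (Suc (Suc k)) (\<lambda>xs. g (xs ! 0) (xs ! 1) (drop 2 xs))"
  shows "recursive k (\<lambda>xs. rec_nat (f xs) (\<lambda>m r. g m r xs) (n xs))"
proof -
  have 1: "recursive (Suc k) (\<lambda>xs. rec_nat (f (tl xs)) (\<lambda>m r. g m r (tl xs)) (hd xs))"
    using recursive_prim[OF assms(2,3)] by simp
  have 2: "recursive k (\<lambda>xs. (\<lambda>xs. rec_nat (f (tl xs)) (\<lambda>m r. g m r (tl xs)) (hd xs))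
      (map (\<lambda>g. g xs) (n # map (\<lambda>i xs. xs ! i) [0..<k])))"
    by (rule recursive_comp) (auto simp: 1 assms(1) recursive_proj)
  have *: "map (\<lambda>x. xs ! x) [0..<length xs] = xs" for xs :: "nat list"
    by (rule map_nth)
  show ?thesis
    by (rule recursive_cong[OF 2]) (auto simp: comp_def *)
qed

lemma recursive_add: "recursive k f \<Longrightarrow> recursive k g \<Longrightarrow> recursive k (\<lambda>xs. f xs + g xs)"
proof (rule recursive_comp2[where f = "(+)"])
  have "rec_nat b (\<lambda>m r. Suc r) a = a + b" for a b by (induction a) auto
  moreover have "recursive 2 (\<lambda>xs. rec_nat (xs ! 1) (\<lambda>m r. Suc r) (xs ! 0))"
    by (rule recursive_rec_nat) (auto intro!: recursive_proj recursive_Suc)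
  ultimately show "recursive 2 (\<lambda>xs. xs ! 0 + xs ! 1)" by simp
qed

lemma recursive_diff: "recursive k f \<Longrightarrow> recursive k g \<Longrightarrow> recursive k (\<lambda>xs. f xs - g xs)"
proof (rule recursive_comp2[where f = "(-)"])
  have pred: "recursive 1 (\<lambda>xs. xs ! 0 - 1)"
  proof -
    have "rec_nat 0 (\<lambda>m r. m) a = a - 1" for a by (cases a) auto
    moreover have "recursive 1 (\<lambda>xs. rec_nat 0 (\<lambda>m r. m) (xs ! 0))"
      by (rule recursive_rec_nat) (auto intro!: recursive_proj recursive_const)
    ultimately show ?thesis by simp
  qed
  have "rec_nat a (\<lambda>m r. r - 1) b = a - b" for a b :: nat by (induction b) auto
  moreover have "recursive 2 (\<lambda>xs. rec_nat (xs ! 0) (\<lambda>m r. r - 1) (xs ! 1))"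
    by (rule recursive_rec_nat)
      (auto intro!: recursive_proj recursive_comp1[where f = "\<lambda>x. x - 1", simplified] pred[simplified])
  ultimately show "recursive 2 (\<lambda>xs. xs ! 0 - xs ! 1)" by simp
qed

lemma recursive_triangle: "recursive k f \<Longrightarrow> recursive k (\<lambda>xs. triangle (f xs))"
proof (rule recursive_comp1[where f = triangle])
  have "rec_nat 0 (\<lambda>m r. r + Suc m) a = triangle a" for a by (induction a) auto
  moreover have "recursive 1 (\<lambda>xs. rec_nat 0 (\<lambda>m r. r + Suc m) (xs ! 0))"
    by (rule recursive_rec_nat) (auto intro!: recursive_proj recursive_const recursive_add recursive_Suc)
  ultimately show "recursive 1 (\<lambda>xs. triangle (xs ! 0))" by simp
qed

lemma recursive_prod_encode:
  "recursive k f \<Longrightarrow> recursive k g \<Longrightarrow> recursive k (\<lambda>xs. prod_encode (f xs, g xs))"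
  unfolding prod_encode_def by (auto intro!: recursive_add recursive_triangle)

lemma rec_eval_Mu:
  assumes "\<And>i. rec_eval f (i # xs) (p i)"
  shows "rec_eval (Mu f) xs m \<longleftrightarrow> p m = 0 \<and> (\<forall>i<m. p i \<noteq> 0)"
proof
  assume "rec_eval (Mu f) xs m"
  then show "p m = 0 \<and> (\<forall>i<m. p i \<noteq> 0)"
    by (cases rule: rec_eval.cases) (metis assms rec_eval_det Suc_neq_Zero)
next
  assume "p m = 0 \<and> (\<forall>i<m. p i \<noteq> 0)"
  then show "rec_eval (Mu f) xs m"
    by (intro rec_eval.mu) (metis assms, metis assms not0_implies_Suc)
qed

lemma recursive_Least:
  assumes "recursive (Suc k) f" "\<And>xs. length xs = k \<Longrightarrow> \<exists>m. f (m # xs) = 0"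
  shows "recursive k (\<lambda>xs. LEAST m. f (m # xs) = 0)"
proof -
  from assms obtain r where r: "\<And>xs. length xs = Suc k \<Longrightarrow> rec_eval r xs (f xs)"
    by (auto simp: recursive_def)
  have "rec_eval (Mu r) xs (LEAST m. f (m # xs) = 0)" if "length xs = k" for xs
    by (subst rec_eval_Mu[where p = "\<lambda>m. f (m # xs)"])
      (use assms(2)[OF that] that in \<open>auto intro: r LeastI_ex dest: not_less_Least\<close>)
  then show ?thesis by (rule recursiveI)
qed

lemma triangle_mono: "m \<le> n \<Longrightarrow> triangle m \<le> triangle n"
  by (induction n rule: dec_induct) auto

text \<open>The code x of (m, n) lies on the diagonal s = m + n, where triangle s \<le> x < triangle
  (s + 1). Minimization finds s, truncated subtraction turning the upper bound into an equation, and
  m is the offset x - triangle s.\<close>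

lemma recursive_prod_decode:
  assumes f: "recursive k f"
  shows "recursive k (\<lambda>xs. fst (prod_decode (f xs)))" "recursive k (\<lambda>xs. snd (prod_decode (f xs)))"
proof -
  let ?s = "\<lambda>x. LEAST s. Suc x - triangle (Suc s) = 0"
  have s: "recursive 1 (\<lambda>xs. ?s (xs ! 0))"
  proof -
    have "recursive (Suc 1) (\<lambda>xs. Suc (xs ! 1) - triangle (Suc (xs ! 0)))"
      by (intro recursive_diff recursive_Suc recursive_triangle recursive_proj) auto
    then have "recursive 1 (\<lambda>xs. LEAST m. Suc ((m # xs) ! 1) - triangle (Suc ((m # xs) ! 0)) = 0)"
    proof (rule recursive_Least)
      fix xs :: "nat list"
      have "Suc x \<le> triangle (Suc x)" for x by (induction x) auto
      then show "\<exists>m. Suc ((m # xs) ! 1) - triangle (Suc ((m # xs) ! 0)) = 0"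
        by (auto simp del: triangle_Suc)
    qed
    then show ?thesis by (simp del: triangle_Suc)
  qed
  have root: "?s (triangle (m + n) + m) = m + n" for m n
  proof (rule Least_equality)
    show "Suc (triangle (m + n) + m) - triangle (Suc (m + n)) = 0" by simp
    fix y assume *: "Suc (triangle (m + n) + m) - triangle (Suc y) = 0"
    show "m + n \<le> y"
    proof (rule ccontr)
      assume "\<not> m + n \<le> y"
      then have "Suc y \<le> m + n" by simp
      then have "triangle (Suc y) \<le> triangle (m + n)" by (rule triangle_mono)
      with * show False by simp
    qed
  qed
  have dec: "fst (prod_decode x) = x - triangle (?s x)"
    "snd (prod_decode x) = ?s x - (x - triangle (?s x))" for x
  proof -
    obtain m n where "x = prod_encode (m, n)" by (metis prod_decode_inverse surj_pair)
    then have x: "x = triangle (m + n) + m" "prod_decode x = (m, n)"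
      by (simp add: prod_encode_def, simp)
    show "fst (prod_decode x) = x - triangle (?s x)"
      "snd (prod_decode x) = ?s x - (x - triangle (?s x))"
      unfolding x(2) unfolding x(1) root by simp_all
  qed
  have "recursive 1 (\<lambda>xs. fst (prod_decode (xs ! 0)))" "recursive 1 (\<lambda>xs. snd (prod_decode (xs ! 0)))"
    unfolding dec by (intro recursive_diff recursive_triangle s recursive_proj; simp)+
  with f show "recursive k (\<lambda>xs. fst (prod_decode (f xs)))" "recursive k (\<lambda>xs. snd (prod_decode (f xs)))"
    by (auto intro: recursive_comp1)
qed

section \<open>Computable functions on encoded types\<close>

text \<open>Bijectivity, more than injectivity, makes every number the code of something: a search
  through all numbers is a search through all certificates, and no test for well-formed codes
  arises.\<close>

class enc =
  fixes enc :: "'a \<Rightarrow> nat"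
  assumes bij_enc: "bij enc"

instantiation nat :: enc
begin
definition "enc_nat = (id :: nat \<Rightarrow> nat)"
instance by standard (simp add: enc_nat_def)
end

instantiation int :: enc
begin
definition "enc_int = int_encode"
instance by standard (simp add: enc_int_def bij_int_encode)
end

instantiation prod :: (enc, enc) enc
begin
definition "enc_prod = prod_encode \<circ> map_prod enc enc"
instance
proof
  show "bij (enc :: 'a \<times> 'b \<Rightarrow> nat)"
    unfolding enc_prod_def
  proof (intro bij_comp bij_prod_encode bijI)
    show "inj (map_prod enc enc :: 'a \<times> 'b \<Rightarrow> nat \<times> nat)"
      by (intro prod.inj_map bij_is_inj bij_enc)
    show "surj (map_prod enc enc :: 'a \<times> 'b \<Rightarrow> nat \<times> nat)"
      by (intro map_prod_surj bij_is_surj bij_enc)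
  qed
qed
end

instantiation list :: (enc) enc
begin
definition "enc_list = list_encode \<circ> map enc"
instance
proof
  show "bij (enc :: 'a list \<Rightarrow> nat)"
    unfolding enc_list_def
  proof (intro bij_comp bij_list_encode bijI)
    show "inj (map enc :: 'a list \<Rightarrow> nat list)"
      by (intro inj_mapI bij_is_inj bij_enc)
    have "\<exists>x. n = enc (x :: 'a)" for n
      by (metis bij_enc bij_is_surj surjD)
    then show "surj (map enc :: 'a list \<Rightarrow> nat list)"
      unfolding surj_def by (simp add: ex_map_conv)
  qed
qed
end

definition denc :: "nat \<Rightarrow> 'a :: enc" where
  "denc = inv_into UNIV enc"

lemma denc_enc [simp]: "denc (enc x) = x"
  by (simp add: denc_def bij_enc bij_is_inj inv_f_f)

lemma enc_denc [simp]: "enc (denc n :: 'a :: enc) = n"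
  by (simp add: denc_def bij_enc bij_is_surj surj_f_inv_f)

lemma enc_eq_iff [simp]: "enc x = enc y \<longleftrightarrow> x = y"
  by (metis denc_enc)

lemma enc_nat [simp]: "enc (n :: nat) = n"
  by (simp add: enc_nat_def)

lemma denc_nat [simp]: "denc n = (n :: nat)"
  by (metis enc_denc enc_nat)

lemma enc_pair: "enc (x, y) = prod_encode (enc x, enc y)"
  by (simp add: enc_prod_def)

lemma denc_pair: "denc n = (denc (fst (prod_decode n)), denc (snd (prod_decode n)))"
  by (metis denc_enc enc_denc enc_pair prod.collapse prod_decode_inverse)

lemma enc_Nil: "enc [] = 0"
  by (simp add: enc_list_def)

lemma enc_Cons: "enc (x # xs) = Suc (prod_encode (enc x, enc xs))"
  by (simp add: enc_list_def)

definition computable :: "('a :: enc \<Rightarrow> 'b :: enc) \<Rightarrow> bool" where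
  "computable f \<longleftrightarrow> recursive 1 (\<lambda>xs. enc (f (denc (xs ! 0))))"

definition decidable :: "('a :: enc \<Rightarrow> bool) \<Rightarrow> bool" where
  "decidable P \<longleftrightarrow> computable (\<lambda>x. of_bool (P x) :: nat)"

named_theorems computable_intros

lemma computable_id [computable_intros]: "computable (\<lambda>x. x)"
  by (simp add: computable_def recursive_proj)

lemma computable_const [computable_intros]: "computable (\<lambda>_. c)"
  by (simp add: computable_def recursive_const)

lemma computable_comp: "computable g \<Longrightarrow> computable f \<Longrightarrow> computable (\<lambda>x. g (f x))"
  unfolding computable_def by (drule recursive_comp1, assumption) simp

lemma decidable_comp: "decidable P \<Longrightarrow> computable f \<Longrightarrow> decidable (\<lambda>x. P (f x))"
  unfolding decidable_def by (rule computable_comp)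

lemma computable_Pair [computable_intros]:
  "computable f \<Longrightarrow> computable g \<Longrightarrow> computable (\<lambda>x. (f x, g x))"
  unfolding computable_def enc_pair by (rule recursive_prod_encode)

lemma computable_comp2:
  "computable (\<lambda>x. g (fst x) (snd x)) \<Longrightarrow> computable f \<Longrightarrow> computable f' \<Longrightarrow> computable (\<lambda>x. g (f x) (f' x))"
  using computable_comp[of "\<lambda>x. g (fst x) (snd x)" "\<lambda>x. (f x, f' x)"] computable_Pair by auto

lemma decidable_comp2:
  "decidable (\<lambda>x. P (fst x) (snd x)) \<Longrightarrow> computable f \<Longrightarrow> computable f' \<Longrightarrow> decidable (\<lambda>x. P (f x) (f' x))"
  unfolding decidable_def by (rule computable_comp2)

lemma computable_fst [computable_intros]: "computable f \<Longrightarrow> computable (\<lambda>x. fst (f x))"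
proof (rule computable_comp[where g = fst])
  have "enc (fst (denc n :: 'b \<times> 'c)) = fst (prod_decode n)" for n
    by (simp add: denc_pair)
  then show "computable (fst :: 'b \<times> 'c \<Rightarrow> 'b)"
    unfolding computable_def by (simp add: recursive_prod_decode recursive_proj)
qed

lemma computable_snd [computable_intros]: "computable f \<Longrightarrow> computable (\<lambda>x. snd (f x))"
proof (rule computable_comp[where g = snd])
  have "enc (snd (denc n :: 'b \<times> 'c)) = snd (prod_decode n)" for n
    by (simp add: denc_pair)
  then show "computable (snd :: 'b \<times> 'c \<Rightarrow> 'c)"
    unfolding computable_def by (simp add: recursive_prod_decode recursive_proj)
qed

lemma decidable_case_prod [computable_intros]:
  "decidable (\<lambda>x. P x (fst (f x)) (snd (f x))) \<Longrightarrow> decidable (\<lambda>x. case f x of (a, b) \<Rightarrow> P x a b)"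
  by (simp add: case_prod_beta)

lemma computable_Suc [computable_intros]: "computable f \<Longrightarrow> computable (\<lambda>x. Suc (f x))"
  unfolding computable_def by (simp add: recursive_Suc)

lemma computable_add [computable_intros]:
  "computable f \<Longrightarrow> computable g \<Longrightarrow> computable (\<lambda>x. f x + g x :: nat)"
  unfolding computable_def by (simp add: recursive_add)

lemma computable_diff [computable_intros]:
  "computable f \<Longrightarrow> computable g \<Longrightarrow> computable (\<lambda>x. f x - g x :: nat)"
  unfolding computable_def by (simp add: recursive_diff)

lemma computable_enc [computable_intros]: "computable f \<Longrightarrow> computable (\<lambda>x. enc (f x))"
  unfolding computable_def by simp

section \<open>Bounded iteration, conditionals, lists and integers\<close>

lemma recursive_computable:
  "computable f \<Longrightarrow> recursive k g \<Longrightarrow> recursive k (\<lambda>xs. enc (f (denc (g xs))))"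
  unfolding computable_def by (rule recursive_comp1)

text \<open>The loop from which conditionals, folds and halving are derived. Since
  \<open>computable\<close> speaks of functions of one argument, the parameter x travels beside the
  state in a pair.\<close>

lemma computable_funpow [computable_intros]:
  fixes F :: "'a :: enc \<Rightarrow> 'b :: enc \<Rightarrow> 'b"
  assumes "computable N" "computable Z" "computable (\<lambda>y. F (fst y) (snd y))"
  shows "computable (\<lambda>x. (F x ^^ N x) (Z x))"
proof -
  have eq: "enc ((F x ^^ m) z) = rec_nat (enc z) (\<lambda>_ r. enc (F x (denc r))) m" for x m z
    by (induction m) (simp_all, metis denc_enc)
  have "recursive 1 (\<lambda>xs. rec_nat (enc (Z (denc (xs ! 0)))) (\<lambda>_ r. enc (F (denc (xs ! 0)) (denc r)))
      (enc (N (denc (xs ! 0)))))"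
  proof (rule recursive_rec_nat)
    have "recursive (Suc (Suc 1)) (\<lambda>xs. prod_encode (xs ! 2, xs ! 1))"
      by (intro recursive_prod_encode recursive_proj) auto
    from recursive_computable[OF assms(3) this]
    show "recursive (Suc (Suc 1)) (\<lambda>xs. enc (F (denc (drop 2 xs ! 0)) (denc (xs ! 1))))"
      by (rule recursive_cong) (simp add: denc_pair)
  qed (use assms in \<open>auto simp: computable_def\<close>)
  then show ?thesis by (simp add: computable_def eq)
qed

lemma computable_if [computable_intros]:
  assumes "decidable P" "computable f" "computable g"
  shows "computable (\<lambda>x. if P x then f x else g x)"
proof -
  \<comment> \<open>A conditional is an iteration of the constant \<open>f x\<close>, carried out
    once or not at all, that starts from \<open>g x\<close>.\<close>
  have eq: "(if P x then f x else g x) = ((\<lambda>_. f x) ^^ of_bool (P x)) (g x)" for x by simp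
  show ?thesis unfolding eq
    by (intro computable_funpow assms[unfolded decidable_def] computable_comp[OF assms(2)] computable_intros)
qed

lemma decidable_const [computable_intros]: "decidable (\<lambda>_. b)"
  unfolding decidable_def by (rule computable_const)

lemma decidable_not [computable_intros]: "decidable P \<Longrightarrow> decidable (\<lambda>x. \<not> P x)"
proof -
  have eq: "of_bool (\<not> b) = 1 - (of_bool b :: nat)" for b by simp
  show "decidable P \<Longrightarrow> decidable (\<lambda>x. \<not> P x)"
    unfolding decidable_def eq by (intro computable_intros)
qed

lemma decidable_if [computable_intros]:
  assumes "decidable P" "decidable Q" "decidable R"
  shows "decidable (\<lambda>x. if P x then Q x else R x)"
  unfolding decidable_def if_distrib[of of_bool]
  by (intro computable_if assms[unfolded decidable_def] assms(1))

lemma decidable_conj [computable_intros]: "decidable P \<Longrightarrow> decidable Q \<Longrightarrow> decidable (\<lambda>x. P x \<and> Q x)"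
proof -
  have eq: "(P x \<and> Q x) = (if P x then Q x else False)" for x by simp
  show "decidable P \<Longrightarrow> decidable Q \<Longrightarrow> decidable (\<lambda>x. P x \<and> Q x)"
    unfolding eq by (intro computable_intros)
qed

lemma decidable_disj [computable_intros]: "decidable P \<Longrightarrow> decidable Q \<Longrightarrow> decidable (\<lambda>x. P x \<or> Q x)"
proof -
  have eq: "(P x \<or> Q x) = (if P x then True else Q x)" for x by simp
  show "decidable P \<Longrightarrow> decidable Q \<Longrightarrow> decidable (\<lambda>x. P x \<or> Q x)"
    unfolding eq by (intro computable_intros)
qed

lemma decidable_imp [computable_intros]: "decidable P \<Longrightarrow> decidable Q \<Longrightarrow> decidable (\<lambda>x. P x \<longrightarrow> Q x)"
proof -
  have eq: "(P x \<longrightarrow> Q x) = (if P x then Q x else True)" for x by simp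
  show "decidable P \<Longrightarrow> decidable Q \<Longrightarrow> decidable (\<lambda>x. P x \<longrightarrow> Q x)"
    unfolding eq by (intro computable_intros)
qed

lemma decidable_less [computable_intros]:
  "computable f \<Longrightarrow> computable g \<Longrightarrow> decidable (\<lambda>x. f x < (g x :: nat))"
proof -
  have eq: "of_bool (a < b) = 1 - (1 - (b - a))" for a b :: nat by simp
  show "computable f \<Longrightarrow> computable g \<Longrightarrow> decidable (\<lambda>x. f x < g x)"
    unfolding decidable_def eq by (intro computable_intros)
qed

lemma decidable_eq [computable_intros]:
  "computable f \<Longrightarrow> computable g \<Longrightarrow> decidable (\<lambda>x. f x = g x)"
proof -
  have eq: "a = b \<longleftrightarrow> \<not> enc a < enc b \<and> \<not> enc b < enc a" for a b :: 'b
    by (metis enc_eq_iff linorder_less_linear less_irrefl)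
  show "computable f \<Longrightarrow> computable g \<Longrightarrow> decidable (\<lambda>x. f x = g x)"
    unfolding eq by (intro computable_intros)
qed

text \<open>A finite table with a default value. In this way data of the fixed group that are chosen
  without any algorithm become constants of the computation.\<close>

lemma computable_finite_support:
  assumes "finite {x. f x \<noteq> c}"
  shows "computable f"
proof -
  have "finite S \<Longrightarrow> {x. f x \<noteq> c} \<subseteq> S \<Longrightarrow> computable f" for S f
  proof (induction S arbitrary: f rule: finite_induct)
    case empty
    then have "f = (\<lambda>_. c)" by auto
    then show ?case by (simp add: computable_const)
  next
    case (insert a S)
    have "computable (f(a := c))" by (rule insert.IH) (use insert.prems in auto)
    then have "computable (\<lambda>x. if x = a then f a else (f(a := c)) x)"
      by (intro computable_if decidable_eq computable_id computable_const)
    also have "(\<lambda>x. if x = a then f a else (f(a := c)) x) = f" by auto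
    finally show ?case .
  qed
  with assms show ?thesis by blast
qed

lemma computable_Cons [computable_intros]:
  "computable f \<Longrightarrow> computable g \<Longrightarrow> computable (\<lambda>x. f x # g x)"
  unfolding computable_def enc_Cons by (intro recursive_Suc recursive_prod_encode)

lemma computable_case_list [computable_intros]:
  assumes "computable L" "computable f" "computable (\<lambda>y. g (fst y) (fst (snd y)) (snd (snd y)))"
  shows "computable (\<lambda>x. case L x of [] \<Rightarrow> f x | y # ys \<Rightarrow> g x y ys)"
proof -
  have dec: "computable (\<lambda>n. denc n :: 'b \<times> 'b list)"
    by (simp add: computable_def recursive_proj)
  \<comment> \<open>The code of a nonempty list is the code of the pair of head and tail plus one,
    so subtracting 1 exposes both.\<close>
  have eq: "(case l of [] \<Rightarrow> f x | y # ys \<Rightarrow> g x y ys) =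
    (if enc l = 0 then f x else (\<lambda>y. g (fst y) (fst (snd y)) (snd (snd y))) (x, denc (enc l -
        1)))" for l :: "'b list" and x
    by (cases l) (auto simp: enc_Nil enc_Cons simp flip: enc_pair)
  show ?thesis unfolding eq
    by (intro computable_if computable_comp[OF assms(3)] computable_comp[OF dec] assms computable_intros)
qed

lemma length_le_enc: "length xs \<le> enc xs"
  by (induction xs) (auto simp: enc_Cons intro: order_trans[OF _ le_prod_encode_2])

text \<open>One element is consumed per round. The code of the list bounds its length and serves as
  the number of rounds; surplus rounds meet the empty list and change nothing.\<close>

lemma computable_foldl:
  assumes "computable Z" "computable L" "computable (\<lambda>y. F (fst y) (fst (snd y)) (snd (snd y)))"
  shows "computable (\<lambda>x. foldl (F x) (Z x) (L x))"
proof -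
  let ?step = "\<lambda>x s. case snd s of [] \<Rightarrow> s | y # ys \<Rightarrow> (F x (fst s) y, ys)"
  have iter: "length xs \<le> m \<Longrightarrow> (?step x ^^ m) (z, xs) = (foldl (F x) z xs, [])" for x z xs m
  proof (induction m arbitrary: z xs)
    case (Suc m)
    show ?case
    proof (cases xs)
      case Nil
      then show ?thesis using Suc.IH[of "[]" z] by (simp del: funpow.simps add: funpow_Suc_right)
    next
      case (Cons y ys)
      then show ?thesis using Suc by (simp del: funpow.simps add: funpow_Suc_right)
    qed
  qed simp
  have eq: "foldl (F x) (Z x) (L x) = fst ((?step x ^^ enc (L x)) (Z x, L x))" for x
    by (simp add: iter length_le_enc)
  show ?thesis unfolding eq
    by (intro computable_comp[OF assms(3), of "\<lambda>y. (_ y, _ y, _ y)", unfolded fst_conv snd_conv]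
        computable_intros assms)
qed

lemma computable_rev [computable_intros]:
  assumes "computable L"
  shows "computable (\<lambda>x. rev (L x))"
proof -
  have eq: "rev xs = foldl (\<lambda>s x. x # s) [] xs" for xs :: "'b list"
    by (simp add: foldl_conv_fold rev_conv_fold)
  show ?thesis unfolding eq by (intro computable_foldl computable_intros assms)
qed

lemma computable_foldr [computable_intros]:
  assumes "computable Z" "computable L" "computable (\<lambda>y. F (fst y) (fst (snd y)) (snd (snd y)))"
  shows "computable (\<lambda>x. foldr (F x) (L x) (Z x))"
  unfolding foldr_conv_foldl
  by (intro computable_foldl computable_intros assms computable_comp[OF assms(3), of
      "\<lambda>y. (_ y, _ y, _ y)", unfolded fst_conv snd_conv])

lemma computable_append [computable_intros]:
  assumes "computable L" "computable L'"
  shows "computable (\<lambda>x. L x @ L' x)"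
proof -
  have eq: "xs @ ys = foldr (\<lambda>x s. x # s) xs ys" for xs ys :: "'b list"
    by (induction xs) auto
  show ?thesis unfolding eq by (intro computable_intros assms)
qed

lemma computable_map [computable_intros]:
  assumes "computable L" "computable (\<lambda>y. F (fst y) (snd y))"
  shows "computable (\<lambda>x. map (F x) (L x))"
proof -
  have eq: "map f xs = foldr (\<lambda>x s. f x # s) xs []" for f :: "'b \<Rightarrow> 'c" and xs
    by (induction xs) auto
  show ?thesis unfolding eq
    by (intro computable_intros assms computable_comp[OF assms(2), of
        "\<lambda>y. (_ y, _ y)", unfolded fst_conv snd_conv])
qed

lemma computable_concat [computable_intros]:
  assumes "computable L"
  shows "computable (\<lambda>x. concat (L x))"
  unfolding concat_conv_foldr by (intro computable_intros assms)

lemma computable_filter [computable_intros]: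
  assumes "computable L" "decidable (\<lambda>y. P (fst y) (snd y))"
  shows "computable (\<lambda>x. filter (P x) (L x))"
proof -
  have eq: "filter P xs = foldr (\<lambda>x s. if P x then x # s else s) xs []" for P and xs :: "'b list"
    by (induction xs) auto
  show ?thesis unfolding eq
    by (intro computable_intros assms decidable_comp[OF assms(2), of
        "\<lambda>y. (_ y, _ y)", unfolded fst_conv snd_conv])
qed

lemma decidable_ball [computable_intros]:
  assumes "computable L" "decidable (\<lambda>y. P (fst y) (snd y))"
  shows "decidable (\<lambda>x. \<forall>y\<in>set (L x). P x y)"
proof -
  have eq: "of_bool (\<forall>y\<in>set xs. P y) = foldr (\<lambda>y s. if P y then s else 0) xs (1 :: nat)" for P
      and xs :: "'b list"
    by (induction xs) auto
  show ?thesis unfolding decidable_def eq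
    by (intro computable_intros assms decidable_comp[OF assms(2), of
        "\<lambda>y. (_ y, _ y)", unfolded fst_conv snd_conv])
qed

lemma decidable_bex [computable_intros]:
  assumes "computable L" "decidable (\<lambda>y. P (fst y) (snd y))"
  shows "decidable (\<lambda>x. \<exists>y\<in>set (L x). P x y)"
proof -
  have eq: "(\<exists>y\<in>set xs. P y) \<longleftrightarrow> \<not> (\<forall>y\<in>set xs. \<not> P y)" for P and xs :: "'b list"
    by auto
  show ?thesis unfolding eq by (intro computable_intros assms)
qed

lemma computable_replicate [computable_intros]:
  assumes "computable N" "computable f"
  shows "computable (\<lambda>x. replicate (N x) (f x))"
proof -
  have eq: "replicate m y = ((#) y ^^ m) []" for m and y :: 'b
    by (induction m) auto
  show ?thesis unfolding eq by (intro computable_intros assms computable_comp[OF assms(2)])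
qed

lemma computable_upt [computable_intros]:
  assumes "computable N"
  shows "computable (\<lambda>x. [0..<N x])"
proof -
  have "((\<lambda>s. (Suc (fst s), snd s @ [fst s])) ^^ m) (0, []) = (m, [0..<m])" for m :: nat
    by (induction m) auto
  then have eq: "[0..<m] = snd (((\<lambda>s. (Suc (fst s), snd s @ [fst s])) ^^ m) (0, []))" for m
    by simp
  show ?thesis unfolding eq by (intro computable_intros assms)
qed

text \<open>Counting up with a pair of parity and quotient: the quotient grows whenever the parity
  returns from 1 to 0.\<close>

lemma computable_half:
  assumes "computable f"
  shows "computable (\<lambda>x. f x mod 2 :: nat)" "computable (\<lambda>x. f x div 2 :: nat)"
proof -
  have "((\<lambda>s. (1 - fst s, snd s + fst s)) ^^ m) (0, 0) = (m mod 2, m div 2)" for m :: nat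
  proof (induction m)
    case (Suc m)
    then show ?case by (cases
        "even m") (auto simp: odd_iff_mod_2_eq_one even_iff_mod_2_eq_zero mod_Suc div_Suc)
  qed simp
  then have eq: "m mod 2 = fst (((\<lambda>s. (1 - fst s, snd s + fst s)) ^^ m) (0, 0))"
     "m div 2 = snd (((\<lambda>s. (1 - fst s, snd s + fst s)) ^^ m) (0, 0))" for m :: nat
    by simp_all
  show "computable (\<lambda>x. f x mod 2 :: nat)" "computable (\<lambda>x. f x div 2 :: nat)"
    unfolding eq by (intro computable_intros assms)+
qed

lemma computable_int_cases:
  assumes "computable f"
  shows "decidable (\<lambda>x. 0 \<le> (f x :: int))" "computable (\<lambda>x. nat (f x))" "computable (\<lambda>x. nat (- f x - 1))"
proof -
  \<comment> \<open>\<open>int_encode\<close> sends i \<ge> 0 to 2 i and i < 0 to 2 (- i - 1) + 1: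
    parity shows the sign, and halving gives the rest.\<close>
  have eq: "0 \<le> i \<longleftrightarrow> enc i mod 2 = 0" "nat i = (if 0 \<le> i then enc i div 2 else 0)"
    "nat (- i - 1) = (if 0 \<le> i then 0 else enc i div 2)" for i :: int
    by (auto simp: enc_int_def int_encode_def sum_encode_def)
  show 1: "decidable (\<lambda>x. 0 \<le> f x)"
    unfolding eq(1) by (intro computable_intros computable_half assms)
  show "computable (\<lambda>x. nat (f x))"
    unfolding eq(2) by (intro computable_intros computable_half assms 1)
  show "computable (\<lambda>x. nat (- f x - 1))"
    unfolding eq(3) by (intro computable_intros computable_half assms 1)
qed

lemma computable_int [computable_intros]: "computable f \<Longrightarrow> computable (\<lambda>x. int (f x))"
proof -
  have "enc (int m) = m + m" for m
    by (simp add: enc_int_def int_encode_def sum_encode_def)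
  then show "computable f \<Longrightarrow> computable (\<lambda>x. int (f x))"
    unfolding computable_def by (simp add: recursive_add)
qed

lemma computable_neg_int: "computable f \<Longrightarrow> computable (\<lambda>x. - int (f x) - 1)"
proof -
  have "enc (- int m - 1) = Suc (m + m)" for m
    by (simp add: enc_int_def int_encode_def sum_encode_def)
  then show "computable f \<Longrightarrow> computable (\<lambda>x. - int (f x) - 1)"
    unfolding computable_def by (simp add: recursive_add recursive_Suc)
qed

lemma computable_int_arith [computable_intros]:
  assumes "computable f"
  shows "computable (\<lambda>x. f x + 1 :: int)" "computable (\<lambda>x. f x - 1 :: int)"
    "computable (\<lambda>x. - f x :: int)" "computable (\<lambda>x. nat (- f x))"
proof -
  have eq: "i + 1 = (if 0 \<le> i then int (Suc (nat i)) else if nat (- i - 1) = 0 then 0 else - int (nat (- i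
      - 1) - 1) - 1)"
    "i - 1 = (if 0 \<le> i then if nat i = 0 then - int 0 - 1 else int (nat i - 1) else - int (Suc (nat (- i -
        1))) - 1)"
    "- i = (if 0 \<le> i then if nat i = 0 then 0 else - int (nat i - 1) - 1 else int (Suc (nat (- i - 1))))"
    "nat (- i) = (if 0 \<le> i then 0 else Suc (nat (- i - 1)))" for i :: int
    by (auto simp: nat_diff_distrib)
  note intros = computable_if computable_int_cases computable_int computable_neg_int computable_Suc
      computable_diff
    decidable_eq computable_const assms
  show "computable (\<lambda>x. f x + 1 :: int)" by (rule ssubst[OF ext[OF eq(1)], of computable]) (intro intros)
  show "computable (\<lambda>x. f x - 1 :: int)" by (rule ssubst[OF ext[OF eq(2)], of computable]) (intro intros)
  show "computable (\<lambda>x. - f x :: int)" by (rule ssubst[OF ext[OF eq(3)], of computable]) (intro intros)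
  show "computable (\<lambda>x. nat (- f x))" by (rule ssubst[OF ext[OF eq(4)], of computable]) (intro intros)
qed

lemmas [computable_intros] = computable_int_cases(1,2)

text \<open>Unbounded search through the codes of witnesses for both answers at once. Soundness of
  the witnesses excludes wrong values, while \<open>S\<close> is used only to guarantee that the
  search ends; \<open>f\<close> is chosen before the question and the condition.\<close>

lemma safe_search:
  fixes Y N :: "'a :: enc \<Rightarrow> 'b :: enc \<Rightarrow> 'c :: enc \<Rightarrow> bool"
  assumes "decidable (\<lambda>x. Y (fst (fst x)) (snd (fst x)) (snd x))"
    and "decidable (\<lambda>x. N (fst (fst x)) (snd (fst x)) (snd x))"
  shows "\<exists>f. \<forall>a b Q S. (\<forall>c. Y a b c \<longrightarrow> Q) \<and> (\<forall>c. N a b c \<longrightarrow> \<not> Q) \<and>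
    (S \<longrightarrow> (\<exists>c. Y a b c \<or> N a b c)) \<longrightarrow> safely_answers f [enc a, enc b] Q S"
proof -
  let ?Y = "\<lambda>x. Y (fst (fst x)) (snd (fst x)) (snd x)" and ?N = "\<lambda>x. N (fst (fst x)) (snd (fst x)) (snd x)"
  let ?found = "\<lambda>p. of_bool (\<not> (?Y p \<or> ?N p)) :: nat"
  let ?arg = "\<lambda>xs. prod_encode (prod_encode (xs ! 1, xs ! 2), xs ! 0)"
  have arg: "recursive 3 ?arg"
    by (intro recursive_prod_encode recursive_proj) auto
  have "computable ?found" "computable (\<lambda>p. of_bool (?Y p) :: nat)"
    using assms by (fold decidable_def) (intro computable_intros)+
  from this[THEN recursive_computable, OF arg]
  obtain r s where r: "\<And>xs. length xs = 3 \<Longrightarrow> rec_eval r xs (?found (denc (?arg xs)))"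
    and s: "\<And>xs. length xs = 3 \<Longrightarrow> rec_eval s xs (of_bool (?Y (denc (?arg xs))))"
    by (auto simp: recursive_def simp del: of_bool_not_iff)
  have den: "denc (?arg [m, enc a, enc b]) = ((a, b), denc m)" for m a b
    by (simp add: denc_pair)
  \<comment> \<open>\<open>r\<close> returns 0 at a witness of either kind, which is what
    \<open>Mu\<close> waits for; \<open>s\<close> then tells which kind was found.\<close>
  let ?f = "Comp s [Mu r, Proj 0, Proj 1]"
  have "safely_answers ?f [enc a, enc b] Q S"
    if QY: "\<And>c. Y a b c \<Longrightarrow> Q" and QN: "\<And>c. N a b c \<Longrightarrow> \<not> Q"
      and ex: "S \<Longrightarrow> \<exists>c. Y a b c \<or> N a b c" for a b Q S
  proof -
    let ?xs = "[enc a, enc b]"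
    have r': "rec_eval r (m # ?xs) (?found ((a, b), denc m))" for m
      using r[of "m # ?xs"] unfolding den by simp
    have s': "rec_eval s (m # ?xs) (of_bool (Y a b (denc m)))" for m
      using s[of "m # ?xs"] unfolding den by simp
    note Mu = rec_eval_Mu[where f = r and xs = ?xs and p = "\<lambda>m. ?found ((a, b), denc m)", OF r']
    have "v = (if Q then 1 else 0)" if "rec_eval ?f ?xs v" for v
      using that
    proof (cases rule: rec_eval.cases)
      case (comp ys)
      then obtain m y z
          where ys: "ys = [m, y, z]" "rec_eval (Mu r) ?xs m" "rec_eval (Proj 0) ?xs y"
          "rec_eval (Proj 1) ?xs z"
        by (auto simp: list_all2_Cons1)
      from ys(3,4) have "y = enc a" "z = enc b"
        by (auto elim: rec_eval.cases)
      with comp ys have "v = of_bool (Y a b (denc m))"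
        by (auto dest: rec_eval_det[OF s'])
      moreover from ys(2) have "Y a b (denc m) \<or> N a b (denc m)"
        by (auto simp: Mu)
      ultimately show ?thesis using QY QN by auto
    qed
    moreover have "\<exists>v. rec_eval ?f ?xs v" if S
    proof -
      let ?P = "\<lambda>m. Y a b (denc m) \<or> N a b (denc m)"
      from ex[OF that] have "\<exists>m. ?P m" by (metis denc_enc)
      then obtain m where m: "?P m" "\<forall>i<m. \<not> ?P i"
        using exists_least_iff[of ?P] by blast
      have "rec_eval (Mu r) ?xs m"
        unfolding Mu using m by simp
      moreover have "rec_eval (Proj 0) ?xs (enc a)" "rec_eval (Proj 1) ?xs (enc b)"
        using rec_eval.proj[of 0 ?xs] rec_eval.proj[of 1 ?xs] by auto
      ultimately have "rec_eval ?f ?xs (of_bool (Y a b (denc m)))"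
        by (intro rec_eval.comp[OF _ s'[of m]]) simp
      then show ?thesis ..
    qed
    ultimately show ?thesis by (auto simp: safely_answers_def)
  qed
  then show ?thesis by (intro exI[of _ ?f]) blast
qed

section \<open>Coordinates in a polycyclic group\<close>

text \<open>The predecessors of \<open>s\<close> in the order \<open>0, -1, 1, -2, 2, \<dots>\<close> of \<open>\<int>\<close>, or
  \<open>0, \<dots>, k - 1\<close> of \<open>\<int>\<^sub>k\<close>, seen from \<open>s\<close>.\<close>

definition segment :: "nat \<Rightarrow> int \<Rightarrow> int set" where
  "segment k s = {t. t mod int k = t \<and> int_encode ((s + t) mod int k) < int_encode s}"

lemma int_encode_eq: "int_encode i = (if 0 \<le> i then nat (2 * i) else nat (- 2 * i - 1))"
  by (auto simp: int_encode_def sum_encode_def)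

text \<open>Here the alternating enumeration pays off: before s \<ge> 0 come exactly -s, ..., s - 1,
  and before s < 0 exactly s + 1, ..., -s - 1. Seen from s, either set is an interval that ends at
  -1 or starts at 1, or is empty.\<close>

lemma segment_0: "segment 0 s = (if 0 \<le> s then {-2 * s..-1} else {1..-2 * s - 1})"
  by (auto simp: segment_def int_encode_eq split: if_splits)

lemma mod_int_shift:
  fixes t k :: int
  assumes "- k \<le> t" "t < 0"
  shows "t mod k = t + k"
proof -
  have "t mod k = (t + k) mod k" by simp
  also have "\<dots> = t + k" using assms by (intro mod_pos_pos_trivial) auto
  finally show ?thesis .
qed

lemma mod_int_eq_iff: "k > 0 \<Longrightarrow> s mod k = s \<longleftrightarrow> 0 \<le> s \<and> s < (k :: int)"
  by (metis mod_pos_pos_trivial pos_mod_bound pos_mod_sign)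

text \<open>Seen from s, the predecessors 0, ..., s - 1 are -s, ..., -1, represented by the last s
  residues.\<close>

lemma segment_pos:
  assumes "k > 0" "s mod int k = s"
  shows "segment k s = {int k - s..int k - 1}"
proof -
  have s: "0 \<le> s" "s < int k"
    using assms mod_int_eq_iff[of "int k" s] by auto
  have enc: "int_encode a < int_encode b \<longleftrightarrow> a < b" if "0 \<le> a" "0 \<le> b" for a b
    using that by (auto simp: int_encode_eq)
  have "t \<in> segment k s \<longleftrightarrow> 0 \<le> t \<and> t < int k \<and> (s + t) mod int k < s" for t
  proof -
    have "t mod int k = t \<longleftrightarrow> 0 \<le> t \<and> t < int k"
      using assms(1) by (simp add: mod_int_eq_iff)
    then show ?thesis using s assms(1) by (auto simp: segment_def enc)
  qed
  moreover have "(s + t) mod int k = (if s + t < int k then s + t else s + t - int k)"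
    if "0 \<le> t" "t < int k" for t
  proof (cases "s + t < int k")
    case True
    then show ?thesis using that s by (simp add: mod_pos_pos_trivial)
  next
    case False
    have "(s + t) mod int k = (s + t - int k) mod int k" by simp
    also have "\<dots> = s + t - int k" using that s False by (intro mod_pos_pos_trivial) auto
    finally show ?thesis using False by simp
  qed
  ultimately show ?thesis using s by (auto split: if_splits)
qed

lemma grazes_segment:
  assumes "s mod int k = s"
  shows "grazes_0 k (segment k s)"
proof (cases "k = 0")
  case True
  have "\<exists>m\<ge>1. {-2 * s..-1} = {-m..-1}" if "0 < s"
    using that by (intro exI[of _ "2 * s"]) auto
  moreover have "\<exists>m\<ge>1. {1..-2 * s - 1} = {1..m}" if "s < 0"
    using that by (intro exI[of _ "-2 * s - 1"]) auto
  ultimately show ?thesis using True by (auto simp: grazes_0_def segment_0)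
next
  case False
  then have k: "int k > 0" by simp
  have s: "0 \<le> s" "s < int k"
    using assms k mod_int_eq_iff[of "int k" s] by auto
  have seg: "segment k s = {int k - s..int k - 1}"
    using False by (simp add: segment_pos[OF _ assms])
  have "segment k s = (\<lambda>t. t mod int k) ` {-s..-1}"
  proof -
    have "t mod int k = t + int k" if "t \<in> {-s..-1}" for t
      using that s by (intro mod_int_shift) auto
    then have "(\<lambda>t. t mod int k) ` {-s..-1} = (\<lambda>t. t + int k) ` {-s..-1}"
      by (rule image_cong[OF refl])
    then show ?thesis by (simp add: add.commute seg)
  qed
  moreover have "int_interval {-s..-1}" by (auto simp: int_interval_def)
  moreover have "(-1) mod int k = int k - 1"
    using k mod_int_shift[of "int k" "-1"] by simp
  then have "segment k s = {} \<or> (-1) mod int k \<in> segment k s \<and> 0 \<notin> segment k s"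
    using s unfolding seg by auto
  ultimately show ?thesis
    using False unfolding grazes_0_def by auto
qed

text \<open>If one value recurs infinitely often, its segment is the limit. Otherwise each value
  occurs finitely often, which forces k = 0, and on an infinite set of indices of one sign the
  segments exhaust a half-line. In both cases they stay inside the limit, as the avo condition
  requires.\<close>

lemma segment_limit:
  assumes "infinite M" "\<And>m. s m mod int k = s m"
  shows "\<exists>N I. N \<subseteq> M \<and> infinite N \<and> grazes_0 k I \<and> (\<forall>m\<in>N. segment k (s m) \<subseteq> I) \<and>
    (\<forall>t\<in>I. finite {m \<in> N. t \<notin> segment k (s m)})"
proof (cases "\<exists>c. infinite {m \<in> M. s m = c}")
  case True
  then obtain c where "infinite {m \<in> M. s m = c}" by blast
  moreover from this obtain m where "s m = c" using not_finite_existsD by blast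
  ultimately show ?thesis
    using grazes_segment[OF assms(2)[of m]]
    by (intro exI[of _ "{m \<in> M. s m = c}"] exI[of _
        "segment k c"]) (auto intro: rev_finite_subset[OF finite.emptyI])
next
  case False
  then have fin: "finite {m \<in> M. s m \<in> S}" if "finite S" for S
  proof -
    have "{m \<in> M. s m \<in> S} = (\<Union>c\<in>S. {m \<in> M. s m = c})" by auto
    with False that show ?thesis by auto
  qed
  have "k = 0"
  proof (rule ccontr)
    assume "k \<noteq> 0"
    then have "s m \<in> {0..<int k}" for m
      using assms(2)[of m] mod_int_eq_iff[of "int k" "s m"] \<open>k \<noteq> 0\<close> by simp
    then show False using fin[of "{0..<int k}"] assms(1) by simp
  qed
  have "infinite {m \<in> M. 0 \<le> s m} \<or> infinite {m \<in> M. s m < 0}"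
  proof (rule ccontr)
    assume "\<not> ?thesis"
    then have "finite ({m \<in> M. 0 \<le> s m} \<union> {m \<in> M. s m < 0})" by simp
    moreover have "{m \<in> M. 0 \<le> s m} \<union> {m \<in> M. s m < 0} = M" by auto
    ultimately show False using assms(1) by simp
  qed
  then show ?thesis
  proof
    assume inf: "infinite {m \<in> M. 0 \<le> s m}"
    have "finite {m \<in> M. 0 \<le> s m \<and> t \<notin> segment k (s m)}" if "t \<le> -1" for t
      by (rule finite_subset[OF _ fin[of "{0..-t}"]]) (use that \<open>k = 0\<close> in \<open>auto simp: segment_0\<close>)
    with inf show ?thesis
      by (intro exI[of _ "{m \<in> M. 0 \<le> s m}"] exI[of _ "{..-1}"]) (auto simp: \<open>k = 0\<close> segment_0 grazes_0_def)
  next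
    assume inf: "infinite {m \<in> M. s m < 0}"
    have "finite {m \<in> M. s m < 0 \<and> t \<notin> segment k (s m)}" if "1 \<le> t" for t
      by (rule finite_subset[OF _ fin[of "{-t..0}"]]) (use that \<open>k = 0\<close> in \<open>auto simp: segment_0\<close>)
    with inf show ?thesis
      by (intro exI[of _ "{m \<in> M. s m < 0}"] exI[of _ "{1..}"]) (auto simp: \<open>k = 0\<close> segment_0 grazes_0_def)
  qed
qed

text \<open>Within the window of all t with absolute value less than m - 1, the segment of any s of
  absolute value at least m consists of all negative or of all positive t, just like that of m - 1
  or 1 - m. For a finite factor, k < m leaves every residue as it is.\<close>

lemma segment_cover:
  assumes "s mod int k = s" "int k < int m"
  shows "\<exists>s'. s' mod int k = s' \<and> \<bar>s'\<bar> < int m \<and> (\<forall>t. \<bar>t\<bar> + 1 < int m \<longrightarrow>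
    (int_encode ((s' + t) mod int k) < int_encode s' \<longleftrightarrow> int_encode ((s + t) mod int k) < int_encode s))"
proof (cases "k = 0")
  case False
  then have "0 \<le> s" "s < int k"
    using assms(1) mod_int_eq_iff[of "int k" s] by auto
  with assms show ?thesis by (intro exI[of _ s]) auto
next
  case True
  consider "\<bar>s\<bar> < int m" | "s \<ge> int m" | "s \<le> - int m" by linarith
  then show ?thesis
  proof cases
    case 1
    then show ?thesis using True by (intro exI[of _ s]) auto
  next
    case 2
    then show ?thesis using True assms by (intro exI[of _ "int m - 1"]) (auto simp: int_encode_eq)
  next
    case 3
    then show ?thesis using True assms by (intro exI[of _ "1 - int m"]) (auto simp: int_encode_eq)
  qed
qed

section \<open>Normal forms along the subgroup chain\<close>

context polycycle
begin

abbreviation period :: "nat \<Rightarrow> int" where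
  "period i \<equiv> int (factor_order G H h i)"

lemma inv_cancel:
  assumes "x \<in> carrier G" "y \<in> carrier G"
  shows "x \<otimes> (inv x \<otimes> y) = y" "inv x \<otimes> (x \<otimes> y) = y"
  using assms by (simp_all flip: m_assoc)

lemma H_subset_carrier: "i \<le> n \<Longrightarrow> H i \<subseteq> carrier G"
  using H_subgroup subgroup.subset by blast

lemma H_Suc: "i < n \<Longrightarrow> H i \<subseteq> H (Suc i)"
  using H_strict by blast

lemma H_mono: "i \<le> j \<Longrightarrow> j \<le> n \<Longrightarrow> H i \<subseteq> H j"
proof (induction j rule: dec_induct)
  case (step m)
  then show ?case using H_Suc[of m] by auto
qed simp

lemma H_closed:
  assumes "i \<le> n"
  shows "\<one> \<in> H i" "x \<in> H i \<Longrightarrow> y \<in> H i \<Longrightarrow> x \<otimes> y \<in> H i" "x \<in> H i \<Longrightarrow> inv x \<in> H i" "x \<in> H i \<Longrightarrow> x [^] (t :: int) \<in> H i"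
    "x \<in> H i \<Longrightarrow> x \<in> carrier G"
  using H_subgroup[OF assms] subgroup.one_closed subgroup.m_closed subgroup.m_inv_closed
      subgroup_int_pow_closed subgroup.mem_carrier
  by metis+

lemma h_carrier: "i < n \<Longrightarrow> h (Suc i) \<in> carrier G"
  using h_in H_subset_carrier[of "Suc i"] by auto

text \<open>The coset computations below rest on these three facts: powers of h meet every coset,
  divisibility describes the powers in the lower subgroup, and the lower subgroup is normal. An
  infinite factor has period 0, and divisibility by 0 means t = 0.\<close>

lemma level:
  assumes i: "i < n"
  shows exponent_exists: "g \<in> H (Suc i) \<Longrightarrow> \<exists>t :: int. inv (h (Suc i) [^] t) \<otimes> g \<in> H i"
    and power_in_H: "h (Suc i) [^] (t :: int) \<in> H i \<longleftrightarrow> period (Suc i) dvd t"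
    and conj_in_H: "g \<in> H (Suc i) \<Longrightarrow> u \<in> H i \<Longrightarrow> inv g \<otimes> u \<otimes> g \<in> H i"
proof -
  let ?K = "G\<lparr>carrier := H (Suc i)\<rparr>" and ?x = "h (Suc i)"
  have sub: "subgroup (H (Suc i)) G" using H_subgroup i by simp
  have K: "group ?K" by (rule subgroup.subgroup_is_group[OF sub]) (rule is_group)
  interpret K: group ?K by (rule K)
  interpret N: normal "H i" ?K by (rule H_normal[OF i])
  interpret Q: group "?K Mod H i" by (rule N.factorgroup_is_group)
  have x: "?x \<in> H (Suc i)" by (rule h_in[OF i])
  let ?X = "?x <# H i"
  \<comment> \<open>The polycycle structure speaks of left cosets, the quotient group of right
    cosets; normality identifies them.\<close>
  have X: "?X = H i #>\<^bsub>?K\<^esub> ?x"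
    using N.coset_eq x by (simp add: l_coset_def r_coset_def)
  have hom: "(\<lambda>a. H i #>\<^bsub>?K\<^esub> a) \<in> hom ?K (?K Mod H i)" by (rule N.r_coset_hom_Mod)
  interpret hom: group_hom ?K "?K Mod H i" "\<lambda>a. H i #>\<^bsub>?K\<^esub> a"
    by unfold_locales (rule hom)
  have pow: "?X [^]\<^bsub>?K Mod H i\<^esub> (t :: int) = H i #>\<^bsub>?K\<^esub> (?x [^] t)" for t
    using hom.hom_int_pow[of ?x t] x int_pow_consistent[OF sub x] X by simp
  have Xc: "?X \<in> carrier (?K Mod H i)"
    using hom.hom_closed[of ?x] x X by simp
  have subN: "subgroup (H i) ?K" by (rule N.subgroup_axioms)
  show "\<exists>t :: int. inv (?x [^] t) \<otimes> g \<in> H i" if g: "g \<in> H (Suc i)"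
  proof -
    have "H i #>\<^bsub>?K\<^esub> g \<in> carrier (?K Mod H i)" using hom.hom_closed[of g] g by simp
    then obtain t :: int where t: "H i #>\<^bsub>?K\<^esub> g = H i #>\<^bsub>?K\<^esub> (?x [^] t)"
      unfolding h_generates[OF i] Q.generate_pow[OF Xc] pow by auto
    have xt: "?x [^] t \<in> H (Suc i)" using H_closed(4)[of "Suc i"] i x by simp
    have "g \<in> H i #>\<^bsub>?K\<^esub> g" by (rule K.rcos_self[OF _ subN]) (use g in simp)
    then have "g \<in> (?x [^] t) <#\<^bsub>?K\<^esub> H i" using t N.coset_eq xt by simp
    then obtain u where "u \<in> H i" "g = ?x [^] t \<otimes> u" by (auto simp: l_coset_def)
    then have "inv (?x [^] t) \<otimes> g = u"
      using H_closed(5)[of i u] i xt H_closed(5)[of "Suc i"] by (simp add: inv_solve_left')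
    with \<open>u \<in> H i\<close> show ?thesis by blast
  qed
  show "?x [^] t \<in> H i \<longleftrightarrow> period (Suc i) dvd t" for t :: int
  proof -
    have xt: "?x [^] t \<in> H (Suc i)" using H_closed(4)[of "Suc i"] i x by simp
    have "period (Suc i) dvd t \<longleftrightarrow> ?X [^]\<^bsub>?K Mod H i\<^esub> t = H i"
      using Q.int_pow_eq_id[OF Xc, of t] by (simp add: factor_order_def)
    also have "\<dots> \<longleftrightarrow> ?x [^] t \<in> H i"
      unfolding pow using K.coset_join1[OF _ _ subN, of "?x [^] t"] K.coset_join2[OF _ subN, of
          "?x [^] t"] xt N.subset
      by auto
    finally show ?thesis by simp
  qed
  show "inv g \<otimes> u \<otimes> g \<in> H i" if "g \<in> H (Suc i)" "u \<in> H i" for g u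
    using N.inv_op_closed1[of g u] that m_inv_consistent[OF sub] by simp
qed

text \<open>The condition \<open>t mod period (Suc i) = t\<close> picks the residue in 0, ..., k - 1
  for a finite factor and is vacuous for period 0, so the exponent is unique in both cases.\<close>

definition exponent :: "nat \<Rightarrow> 'a \<Rightarrow> int" where
  "exponent i g = (SOME t. t mod period (Suc i) = t \<and> inv (h (Suc i) [^] t) \<otimes> g \<in> H i)"

definition remainder :: "nat \<Rightarrow> 'a \<Rightarrow> 'a" where
  "remainder i g = inv (h (Suc i) [^] exponent i g) \<otimes> g"

lemma exponent_shift:
  assumes i: "i < n" and g: "g \<in> carrier G"
    and s: "inv (h (Suc i) [^] (s :: int)) \<otimes> g \<in> H i"
  shows "inv (h (Suc i) [^] (t :: int)) \<otimes> g \<in> H i \<longleftrightarrow> s mod period (Suc i) = t mod period (Suc i)"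
proof -
  let ?x = "h (Suc i)"
  have x: "?x \<in> carrier G" by (rule h_carrier[OF i])
  have pow: "?x [^] (s - t) = inv (?x [^] t) \<otimes> ?x [^] s"
    using int_pow_mult[OF x, of "- t" s] x by (simp add: int_pow_neg)
  have eq: "inv (?x [^] t) \<otimes> g = ?x [^] (s - t) \<otimes> (inv (?x [^] s) \<otimes> g)"
    using x g by (simp add: pow m_assoc inv_cancel)
  have "inv (?x [^] t) \<otimes> g \<in> H i \<longleftrightarrow> ?x [^] (s - t) \<in> H i"
  proof
    assume "?x [^] (s - t) \<in> H i"
    then show "inv (?x [^] t) \<otimes> g \<in> H i" unfolding eq using s H_closed(2)[of i] i by simp
  next
    assume "inv (?x [^] t) \<otimes> g \<in> H i"
    then have "(inv (?x [^] t) \<otimes> g) \<otimes> inv (inv (?x [^] s) \<otimes> g) \<in> H i"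
      using s H_closed[of i] i by simp
    then show "?x [^] (s - t) \<in> H i"
      using x g by (simp add: pow inv_mult_group m_assoc inv_cancel)
  qed
  then show ?thesis using power_in_H[OF i, of "s - t"] by (simp add: mod_eq_dvd_iff)
qed

lemma exponent_props:
  assumes i: "i < n" and g: "g \<in> H (Suc i)"
  shows exponent_mod: "exponent i g mod period (Suc i) = exponent i g"
    and remainder_in: "remainder i g \<in> H i"
    and exponent_remainder: "g = h (Suc i) [^] exponent i g \<otimes> remainder i g"
proof -
  have gc: "g \<in> carrier G" using H_closed(5)[of "Suc i"] i g by simp
  obtain s where s: "inv (h (Suc i) [^] (s :: int)) \<otimes> g \<in> H i" using exponent_exists[OF i g] by blast
  have "\<exists>t. t mod period (Suc i) = t \<and> inv (h (Suc i) [^] t) \<otimes> g \<in> H i"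
    by (intro exI[of _ "s mod period (Suc i)"]) (simp add: exponent_shift[OF i gc s])
  from someI_ex[OF this]
  show "exponent i g mod period (Suc i) = exponent i g" "remainder i g \<in> H i"
    by (simp_all add: exponent_def remainder_def)
  show "g = h (Suc i) [^] exponent i g \<otimes> remainder i g"
    using gc h_carrier[OF i] by (simp add: remainder_def inv_cancel)
qed

lemma exponent_eq:
  assumes i: "i < n" and g: "g \<in> H (Suc i)" and t: "inv (h (Suc i) [^] (t :: int)) \<otimes> g \<in> H i"
  shows "exponent i g = t mod period (Suc i)"
  using exponent_shift[OF i _ t, of "exponent i g"] exponent_props[OF i g] H_closed(5)[of "Suc i"] i g
  by (simp add: remainder_def)

lemma exponent_decomp:
  assumes i: "i < n" and u: "u \<in> H i" and t: "t mod period (Suc i) = t"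
  shows "exponent i (h (Suc i) [^] t \<otimes> u) = t" "remainder i (h (Suc i) [^] t \<otimes> u) = u"
proof -
  have c: "h (Suc i) [^] t \<in> carrier G" "u \<in> carrier G" using h_carrier[OF i] H_closed(5)[of i u] i u by auto
  then have eq: "inv (h (Suc i) [^] t) \<otimes> (h (Suc i) [^] t \<otimes> u) = u" by (simp add: inv_cancel)
  have "h (Suc i) [^] t \<otimes> u \<in> H (Suc i)"
    using H_closed(2,4)[of "Suc i"] i h_in[OF i] u H_Suc[OF i] by auto
  from exponent_eq[OF i this, of t] show *: "exponent i (h (Suc i) [^] t \<otimes> u) = t" using eq u t by simp
  show "remainder i (h (Suc i) [^] t \<otimes> u) = u" using eq by (simp add: remainder_def *)
qed

text \<open>Exponents add up modulo the period because normality lets the remainder of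
  \<open>g\<close> move past the power of h in \<open>u\<close>.\<close>

lemma exponent_mult:
  assumes i: "i < n" and g: "g \<in> H (Suc i)" and u: "u \<in> H (Suc i)"
      and t: "inv (h (Suc i) [^] (t :: int)) \<otimes> u \<in> H i"
  shows "exponent i (g \<otimes> u) = (exponent i g + t) mod period (Suc i)"
proof (rule exponent_eq[OF i])
  let ?x = "h (Suc i)" and ?e = "exponent i g"
  show "g \<otimes> u \<in> H (Suc i)" using H_closed(2)[of "Suc i"] i g u by simp
  have c: "?x \<in> carrier G" "g \<in> carrier G" "u \<in> carrier G"
      using h_carrier[OF i] H_closed(5)[of "Suc i"] i g u by auto
  have "inv (?x [^] (?e + t)) \<otimes> (g \<otimes> u) = (inv (?x [^] t) \<otimes> (inv (?x [^] ?e) \<otimes> g) \<otimes> ?x [^] t) \<otimes> (inv (?x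
      [^] t) \<otimes> u)"
    using c by (simp add: int_pow_mult inv_mult_group m_assoc inv_cancel)
  also have "\<dots> \<in> H i"
    using t conj_in_H[OF i _ remainder_in[OF i g], of "?x [^] t"] H_closed[of
        "Suc i"] H_closed(2)[of i] i h_in[OF i]
    by (simp add: remainder_def)
  finally show "inv (?x [^] (?e + t)) \<otimes> (g \<otimes> u) \<in> H i" .
qed

lemma exponent_mult_in:
  assumes i: "i < n" and g: "g \<in> H (Suc i)" and u: "u \<in> H i"
  shows "exponent i (g \<otimes> u) = exponent i g" "remainder i (g \<otimes> u) = remainder i g \<otimes> u"
proof -
  have c: "h (Suc i) \<in> carrier G" "g \<in> carrier G" "u \<in> carrier G"
      using h_carrier[OF i] H_closed(5)[of "Suc i"] H_closed(5)[of i] i g u by auto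
  have u': "u \<in> H (Suc i)" using u H_Suc[OF i] by blast
  have "inv (h (Suc i) [^] (0 :: int)) \<otimes> u \<in> H i" using u c by simp
  from exponent_mult[OF i g u' this] show *: "exponent i (g \<otimes> u) = exponent i g"
      using exponent_mod[OF i g] by simp
  show "remainder i (g \<otimes> u) = remainder i g \<otimes> u" using c by (simp add: remainder_def * m_assoc)
qed

text \<open>The lexicographic order of the coordinates, with \<open>\<int>\<close> enumerated by
  \<^const>\<open>int_encode\<close>; it is a well-order of type at most \<open>\<omega>\<^sup>n\<close>.\<close>

primrec prec :: "nat \<Rightarrow> ('a \<times> 'a) set" where
  "prec 0 = {}"
| "prec (Suc i) = inv_image (less_than <*lex*> prec i) (\<lambda>g. (int_encode (exponent i g), remainder i g))"

primrec coord :: "nat \<Rightarrow> 'a \<Rightarrow> nat \<Rightarrow> int" where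
  "coord 0 g = (\<lambda>_. 0)"
| "coord (Suc i) g = (coord i (remainder i g))(Suc i := exponent i g)"

lemma wf_prec: "wf (prec i)"
  by (induction i) auto

lemma trans_prec: "trans (prec i)"
  by (induction i) (auto intro: trans_inv_image trans_lex_prod simp del: in_inv_image)

lemma total_prec: "i \<le> n \<Longrightarrow> total_on (H i) (prec i)"
proof (induction i)
  case 0
  then show ?case by (simp add: H_0)
next
  case (Suc i)
  show ?case
  proof (rule total_onI)
    fix x y assume xy: "x \<in> H (Suc i)" "y \<in> H (Suc i)" "x \<noteq> y"
    have i: "i < n" using Suc by simp
    show "(x, y) \<in> prec (Suc i) \<or> (y, x) \<in> prec (Suc i)"
    proof (cases "exponent i x = exponent i y")
      case True
      then have "remainder i x \<noteq> remainder i y"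
        using exponent_remainder[OF i] xy by metis
      moreover have "total_on (H i) (prec i)" using Suc by simp
      ultimately show ?thesis
        using True remainder_in[OF i] xy by (auto simp: total_on_def)
    next
      case False
      then have "int_encode (exponent i x) \<noteq> int_encode (exponent i y)" by (simp add: inj_int_encode inj_eq)
      then show ?thesis by auto
    qed
  qed
qed

lemma coord_mod: "i \<le> n \<Longrightarrow> g \<in> H i \<Longrightarrow> 1 \<le> j \<Longrightarrow> j \<le> i \<Longrightarrow> coord i g j mod period j = coord i g j"
proof (induction i arbitrary: g)
  case (Suc i)
  then show ?case using exponent_mod[of i g] remainder_in[of i g]
    by (cases "j = Suc i") auto
qed simp

section \<open>Predecessor sets as inductive intervals and their limits\<close>

definition rank :: "'a \<Rightarrow> nat" where
  "rank g = (LEAST i. g \<in> H i)"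

lemma rank:
  assumes "i \<le> n" "g \<in> H i" "g \<noteq> \<one>"
  shows "1 \<le> rank g" "rank g \<le> i" "g \<in> H (rank g)"
proof -
  show "rank g \<le> i" "g \<in> H (rank g)" unfolding rank_def using assms by (auto intro: Least_le LeastI)
  then show "1 \<le> rank g" using H_0 assms by (metis One_nat_def Suc_leI bot_nat_0.not_eq_extremum singletonD)
qed

lemma rank_Suc: "g \<in> H (Suc i) \<Longrightarrow> g \<notin> H i \<Longrightarrow> i < n \<Longrightarrow> rank g = Suc i"
  unfolding rank_def
  by (rule Least_equality) (meson H_mono Suc_leI less_imp_le_nat not_less_eq_eq subsetD)+

lemma in_l_coset_iff:
  assumes "l < n" "u \<in> carrier G"
  shows "u \<in> (h (Suc l) [^] (t :: int)) <# H l \<longleftrightarrow> inv (h (Suc l) [^] t) \<otimes> u \<in> H l"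
proof -
  have c: "h (Suc l) [^] t \<in> carrier G" using h_carrier assms by simp
  have "u = h (Suc l) [^] t \<otimes> v \<longleftrightarrow> inv (h (Suc l) [^] t) \<otimes> u = v" if "v \<in> H l" for v
    using inv_solve_left[of v "h (Suc l) [^] t" u] c assms H_closed(5)[of l v] that by auto
  then show ?thesis unfolding l_coset_def by auto
qed

text \<open>As long as \<open>g\<close> lies in the lower subgroup, its exponent is 0 and its
  remainder is \<open>g\<close> itself; the recursion therefore reaches the level of the rank with
  \<open>g\<close> unchanged.\<close>

lemma coord_rank: "i \<le> n \<Longrightarrow> g \<in> H i \<Longrightarrow> g \<noteq> \<one> \<Longrightarrow> g \<in> (h (rank g) [^] coord i g (rank g)) <# H (rank g - 1)"
proof (induction i)
  case 0
  then show ?case by (simp add: H_0)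
next
  case (Suc i)
  then have i: "i < n" by simp
  show ?case
  proof (cases "g \<in> H i")
    case True
    have "exponent i (\<one> \<otimes> g) = exponent i \<one>" "remainder i (\<one> \<otimes> g) = remainder i \<one> \<otimes> g"
      using exponent_mult_in[OF i _ True] H_closed(1)[of "Suc i"] i by auto
    moreover have "exponent i \<one> = 0" "remainder i \<one> = \<one>"
      using exponent_decomp[OF i, of \<one> 0] H_closed(1)[of i] i by auto
    moreover have "rank g \<le> i" using rank True Suc by simp
    ultimately show ?thesis using Suc True H_closed(5)[of i] i by auto
  next
    case False
    then have "rank g = Suc i" using rank_Suc Suc i by simp
    moreover have "g \<in> (h (Suc i) [^] exponent i g) <# H i"
      using in_l_coset_iff[OF i] remainder_in[OF i] Suc H_closed(5)[of "Suc i"] by (simp add: remainder_def)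
    ultimately show ?thesis by simp
  qed
qed

text \<open>Let r be the rank of \<open>u\<close>. Passing from \<open>g\<close> to
  \<open>g \<otimes> u\<close> keeps the coordinates above r and adds \<open>t\<close> to the one at
  r, which really changes because \<open>u\<close> lies outside \<open>H (r - 1)\<close>. So the
  comparison is decided at r, whatever happens below.\<close>

lemma prec_mult_iff:
  assumes "i \<le> n" "g \<in> H i" "u \<in> H i" "u \<noteq> \<one>" "u \<in> (h (rank u) [^] (t :: int)) <# H (rank u - 1)"
  shows "(g \<otimes> u, g) \<in> prec i \<longleftrightarrow>
    int_encode ((coord i g (rank u) + t) mod period (rank u)) < int_encode (coord i g (rank u))"
  using assms
proof (induction i arbitrary: g)
  case 0
  then show ?case by (simp add: H_0)
next
  case (Suc i)
  then have i: "i < n" by simp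
  show ?case
  proof (cases "u \<in> H i")
    case True
    have "rank u \<le> i" using rank True Suc by simp
    with Suc True i show ?thesis
      by (simp add: exponent_mult_in[OF i _ True] remainder_in)
  next
    case False
    then have r: "rank u = Suc i" using rank_Suc Suc i by simp
    have uc: "u \<in> carrier G" using Suc H_closed(5) by blast
    have t: "inv (h (Suc i) [^] t) \<otimes> u \<in> H i"
      using Suc.prems(5) r in_l_coset_iff[OF i uc] by simp
    have e: "exponent i (g \<otimes> u) = (exponent i g + t) mod period (Suc i)"
      by (rule exponent_mult[OF i _ _ t]) (use Suc in auto)
    have "exponent i (g \<otimes> u) \<noteq> exponent i g"
    proof
      assume "exponent i (g \<otimes> u) = exponent i g"
      then have "(exponent i g + t) mod period (Suc i) = exponent i g mod period (Suc i)"
        using e exponent_mod[OF i] Suc by simp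
      then have "period (Suc i) dvd t" by (simp add: mod_eq_dvd_iff)
      then have "h (Suc i) [^] t \<in> H i" using power_in_H[OF i] by simp
      then have "h (Suc i) [^] t \<otimes> (inv (h (Suc i) [^] t) \<otimes> u) \<in> H i" using t H_closed(2)[of i] i by simp
      then show False using False uc h_carrier[OF i] by (simp add: inv_cancel)
    qed
    then have "int_encode (exponent i (g \<otimes> u)) \<noteq> int_encode (exponent i g)"
      by (simp add: inj_int_encode inj_eq)
    then show ?thesis using r e by simp
  qed
qed

definition past :: "'a \<Rightarrow> 'a set" where
  "past g = {u \<in> carrier G. (g \<otimes> u, g) \<in> prec n}"

lemma one_notin_past: "g \<in> carrier G \<Longrightarrow> \<one> \<notin> past g"
  using wf_irrefl[OF wf_prec] by (auto simp: past_def)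

text \<open>This exhibits \<open>past g\<close> as the inductive interval whose tuple consists of
  the segments at the coordinates of \<open>g\<close>.\<close>

lemma in_past_iff:
  assumes "g \<in> carrier G" "u \<in> carrier G" "u \<noteq> \<one>" "u \<in> (h (rank u) [^] (t :: int)) <# H (rank u - 1)"
  shows "u \<in> past g \<longleftrightarrow> t mod period (rank u) \<in> segment (factor_order G H h (rank u)) (coord n g (rank u))"
  using prec_mult_iff[of n g u t] assms H_n by (simp add: past_def segment_def mod_add_right_eq)

text \<open>The indices are thinned out once for each factor, and the limits of the segments form
  the tuple of \<open>C\<close>. Thinning keeps what was achieved for the earlier factors.\<close>

lemma past_limit:
  assumes g: "\<And>m. g m \<in> carrier G"
  shows "\<exists>C M. inductive_interval G n H h C \<and> infinite (M :: nat set) \<and>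
    (\<forall>m\<in>M. past (g m) \<subseteq> C) \<and> (\<forall>u\<in>C. finite {m \<in> M. u \<notin> past (g m)})"
proof -
  let ?seg = "\<lambda>m i. segment (factor_order G H h i) (coord n (g m) i)"
  have "\<exists>M Is. infinite M \<and> (\<forall>i\<in>{1..j}. grazes_0 (factor_order G H h i) (Is i) \<and> (\<forall>m\<in>M. ?seg m i \<subseteq> Is i) \<and>
      (\<forall>t\<in>Is i. finite {m \<in> M. t \<notin> ?seg m i}))" if "j \<le> n" for j
    using that
  proof (induction j)
    case 0
    show ?case by (auto intro: infinite_UNIV_nat)
  next
    case (Suc j)
    then obtain M Is where M: "infinite M"
        and IH: "\<forall>i\<in>{1..j}. grazes_0 (factor_order G H h i) (Is i) \<and> (\<forall>m\<in>M. ?seg m i \<subseteq> Is i) \<and>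
      (\<forall>t\<in>Is i. finite {m \<in> M. t \<notin> ?seg m i})" by auto
    have "coord n (g m) (Suc j) mod period (Suc j) = coord n (g m) (Suc j)" for m
      using coord_mod[of n "g m" "Suc j"] Suc.prems g H_n by simp
    from segment_limit[where s = "\<lambda>m. coord n (g m) (Suc j)", OF M this] obtain N I
        where N: "N \<subseteq> M" "infinite N" "grazes_0 (factor_order G H h (Suc j)) I"
       "\<forall>m\<in>N. ?seg m (Suc j) \<subseteq> I" "\<forall>t\<in>I. finite {m \<in> N. t \<notin> ?seg m (Suc j)}"
      by (elim exE conjE) (rule that)
    show ?case
    proof (intro exI[of _ N] exI[of _ "Is(Suc j := I)"] conjI ballI)
      fix i t assume i: "i \<in> {1..Suc j}" and t: "t \<in> (Is(Suc j := I)) i"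
      show "finite {m \<in> N. t \<notin> ?seg m i}"
      proof (cases "i = Suc j")
        case False
        with i t IH have "finite {m \<in> M. t \<notin> ?seg m i}" by auto
        then show ?thesis by (rule rev_finite_subset) (use N in auto)
      qed (use N t in auto)
    next
      fix i assume i: "i \<in> {1..Suc j}"
      show "grazes_0 (factor_order G H h i) ((Is(Suc j := I)) i)"
        using i IH N(3) by (cases "i = Suc j") auto
      fix m assume "m \<in> N"
      then show "?seg m i \<subseteq> (Is(Suc j := I)) i"
        using i IH N(1,4) by (cases "i = Suc j") (simp, force)
    qed (fact N(2))
  qed
  from this[OF order.refl] obtain M Is where M: "infinite M"
    and Is0: "\<forall>i\<in>{1..n}. grazes_0 (factor_order G H h i) (Is i) \<and> (\<forall>m\<in>M. ?seg m i \<subseteq> Is i) \<and>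
      (\<forall>t\<in>Is i. finite {m \<in> M. t \<notin> ?seg m i})"
    by (elim exE conjE) (rule that)
  have Is: "\<And>i. i \<in> {1..n} \<Longrightarrow> grazes_0 (factor_order G H h i) (Is i)"
      "\<And>i m. i \<in> {1..n} \<Longrightarrow> m \<in> M \<Longrightarrow> ?seg m i \<subseteq> Is i"
      "\<And>i t. i \<in> {1..n} \<Longrightarrow> t \<in> Is i \<Longrightarrow> finite {m \<in> M. t \<notin> ?seg m i}"
    using Is0 by blast+
  let ?C = "inductive_interval_of G H h Is"
  have C: "u \<in> ?C \<longleftrightarrow> u \<in> carrier G \<and> u \<noteq> \<one> \<and> (\<exists>t :: int. u \<in> (h (rank u) [^] t) <# H (rank u - 1) \<and>
      t mod period (rank u) \<in> Is (rank u))" for u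
    by (auto simp: inductive_interval_of_def Let_def rank_def)
  have r: "rank u \<in> {1..n}" if "u \<in> carrier G" "u \<noteq> \<one>" for u
    using rank[of n u] that H_n by simp
  show ?thesis
  proof (intro exI[of _ ?C] exI[of _ M] conjI ballI M)
    show "inductive_interval G n H h ?C" unfolding inductive_interval_def using Is(1) by blast
    show "past (g m) \<subseteq> ?C" if "m \<in> M" for m
    proof
      fix u assume u: "u \<in> past (g m)"
      then have uc: "u \<in> carrier G" "u \<noteq> \<one>" using one_notin_past[OF g] by (auto simp: past_def)
      have t: "u \<in> (h (rank u) [^] coord n u (rank u)) <# H (rank u - 1)" using coord_rank[of n u] uc H_n
          by simp
      then show "u \<in> ?C" unfolding C using uc u in_past_iff[OF g uc t] Is(2)[OF r[OF uc] that] by blast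
    qed
    show "finite {m \<in> M. u \<notin> past (g m)}" if "u \<in> ?C" for u
    proof -
      from that[unfolded C] obtain t :: int
          where t: "u \<in> carrier G" "u \<noteq> \<one>" "u \<in> (h (rank u) [^] t) <# H (rank u - 1)"
        "t mod period (rank u) \<in> Is (rank u)" by blast
      then show ?thesis using Is(3)[OF r[OF t(1,2)] t(4)] in_past_iff[OF g t(1-3)] by simp
    qed
  qed
qed

end

section \<open>Computing with words\<close>

type_synonym word = "int list"

definition inv_word :: "word \<Rightarrow> word" where
  "inv_word w = map uminus (rev w)"

context polycycle
begin

text \<open>Letters that do not denote one of \<open>h\<^sub>1\<^sup>\<plusminus>\<^sup>1, \<dots>, h\<^sub>i\<^sup>\<plusminus>\<^sup>1\<close> are ignored, which makes every list a word.\<close>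

definition letter :: "nat \<Rightarrow> int \<Rightarrow> 'a" where
  "letter i j = (if j \<noteq> 0 \<and> \<bar>j\<bar> \<le> int i then h (nat \<bar>j\<bar>) [^] sgn j else \<one>)"

definition eval_word :: "nat \<Rightarrow> word \<Rightarrow> 'a" where
  "eval_word i w = foldr (\<lambda>j g. letter i j \<otimes> g) w \<one>"

lemma letter_in: "i \<le> n \<Longrightarrow> letter i j \<in> H i"
proof (cases "j \<noteq> 0 \<and> \<bar>j\<bar> \<le> int i")
  case True
  assume i: "i \<le> n"
  from True obtain l where l: "nat \<bar>j\<bar> = Suc l" by (cases "nat \<bar>j\<bar>") auto
  with True have "Suc l \<le> i" by linarith
  then have "h (nat \<bar>j\<bar>) \<in> H i" unfolding l using h_in[of l] H_mono[of "Suc l" i] i by auto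
  then show ?thesis using H_closed(4)[OF i] by (simp add: letter_def H_closed(1)[OF i])
qed (auto simp: letter_def H_closed(1))

lemma letter_carrier: "i \<le> n \<Longrightarrow> letter i j \<in> carrier G"
  using letter_in H_closed(5) by blast

lemma eval_Nil [simp]: "eval_word i [] = \<one>"
  by (simp add: eval_word_def)

lemma eval_Cons [simp]: "eval_word i (j # w) = letter i j \<otimes> eval_word i w"
  by (simp add: eval_word_def)

lemma eval_in: "i \<le> n \<Longrightarrow> eval_word i w \<in> H i"
  by (induction w) (auto simp: H_closed letter_in)

lemma eval_carrier: "i \<le> n \<Longrightarrow> eval_word i w \<in> carrier G"
  using eval_in H_closed(5) by blast

lemma eval_append: "i \<le> n \<Longrightarrow> eval_word i (v @ w) = eval_word i v \<otimes> eval_word i w"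
  by (induction v) (auto simp: letter_carrier eval_carrier m_assoc)

lemma letter_uminus: "i \<le> n \<Longrightarrow> letter i (- j) = inv (letter i j)"
proof -
  assume i: "i \<le> n"
  have "h (nat \<bar>j\<bar>) \<in> carrier G" if "j \<noteq> 0" "\<bar>j\<bar> \<le> int i"
    using that h_carrier[of "nat \<bar>j\<bar> - 1"] i by (cases "nat \<bar>j\<bar>") auto
  then show ?thesis by (auto simp: letter_def sgn_minus int_pow_neg)
qed

lemma eval_inv: "i \<le> n \<Longrightarrow> eval_word i (inv_word w) = inv (eval_word i w)"
  by (induction w) (auto simp: inv_word_def letter_carrier eval_carrier eval_append inv_mult_group
      letter_uminus)

lemma eval_word_val: "is_word n w \<Longrightarrow> eval_word n w = word_val G h w"
  by (induction w) (auto simp: is_word_def word_val_def letter_def)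

lemma eval_mono:
  assumes "i \<le> j" "\<And>l. l \<in> set w \<Longrightarrow> \<bar>l\<bar> \<le> int i"
  shows "eval_word j w = eval_word i w"
  using assms(2) by (induction w) (use assms(1) in \<open>force simp: letter_def\<close>)+

lemma eval_power: "i < n \<Longrightarrow> eval_word (Suc i) (replicate m (int (Suc i))) = h (Suc i) [^] int m"
  "i < n \<Longrightarrow> eval_word (Suc i) (replicate m (- int (Suc i))) = h (Suc i) [^] - int m"
proof -
  assume i: "i < n"
  have c: "h (Suc i) \<in> carrier G" by (rule h_carrier[OF i])
  have l: "letter (Suc i) (int (Suc i)) = h (Suc i)" "letter (Suc i) (- int (Suc i)) = inv (h (Suc i))"
    using c by (simp_all add: letter_def int_pow_neg nat_add_distrib)
  show "eval_word (Suc i) (replicate m (int (Suc i))) = h (Suc i) [^] int m"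
    using c l(1) int_pow_mult[of "h (Suc i)" 1 "int _"] by (induction m) auto
  show "eval_word (Suc i) (replicate m (- int (Suc i))) = h (Suc i) [^] - int m"
  proof (induction m)
    case (Suc m)
    have "- int (Suc m) = - 1 + - int m" by simp
    then show ?case using c l(2) Suc int_pow_mult[OF c, of "-1" "- int m"] int_pow_neg[OF c, of 1] by simp
  qed simp
qed

lemma eval_surj: "i \<le> n \<Longrightarrow> g \<in> H i \<Longrightarrow> \<exists>w. eval_word i w = g"
proof (induction i arbitrary: g)
  case 0
  then show ?case by (auto simp: H_0 intro: exI[of _ "[]"])
next
  case (Suc i)
  then have i: "i < n" by simp
  obtain w where w: "eval_word i w = remainder i g" using Suc remainder_in[OF i] by fastforce
  \<comment> \<open>Letters above i are ignored at level i but might count at level i + 1, so they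
    are removed first.\<close>
  let ?w = "filter (\<lambda>j. \<bar>j\<bar> \<le> int i) w"
  have f: "eval_word i ?w = eval_word i w"
    by (induction w) (auto simp: letter_def eval_carrier i less_imp_le)
  then have 1: "eval_word (Suc i) ?w = remainder i g" using eval_mono[of i "Suc i" ?w] w by simp
  have "\<exists>v. eval_word (Suc i) v = h (Suc i) [^] exponent i g"
    by (cases "exponent i g" rule: int_cases2) (use eval_power[OF i] in metis)+
  then obtain v where "eval_word (Suc i) v = h (Suc i) [^] exponent i g" ..
  then have "eval_word (Suc i) (v @ ?w) = g"
    using eval_append[of "Suc i"] 1 exponent_remainder[OF i Suc.prems(2)] i by simp
  then show ?case ..
qed

section \<open>Collection of a word into its normal form\<close>

definition subst_word :: "(int \<Rightarrow> word) \<Rightarrow> word \<Rightarrow> word" where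
  "subst_word S w = concat (map S w)"

text \<open>The words are chosen rather than computed. For fixed \<open>i\<close> and
  \<open>g\<close> only finitely many letters have a nonempty value, so this is a finite
  table.\<close>

definition conj_letter :: "nat \<Rightarrow> 'a \<Rightarrow> int \<Rightarrow> word" where
  "conj_letter i g j = (if j \<noteq> 0 \<and> \<bar>j\<bar> \<le> int i then SOME w. eval_word i w = inv g \<otimes> letter i j \<otimes> g else [])"

lemma eval_conj_letter:
  assumes "i < n" "g \<in> H (Suc i)"
  shows "eval_word i (subst_word (conj_letter i g) w) = inv g \<otimes> eval_word i w \<otimes> g"
proof -
  have i: "i \<le> n" using assms by simp
  have g: "g \<in> carrier G" using assms H_closed(5)[of "Suc i"] by simp
  have *: "eval_word i (conj_letter i g j) = inv g \<otimes> letter i j \<otimes> g" for j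
  proof (cases "j \<noteq> 0 \<and> \<bar>j\<bar> \<le> int i")
    case True
    have "\<exists>w. eval_word i w = inv g \<otimes> letter i j \<otimes> g"
      by (rule eval_surj[OF i conj_in_H[OF assms letter_in[OF i]]])
    from someI_ex[OF this] show ?thesis using True by (simp add: conj_letter_def)
  next
    case False
    then show ?thesis using g by (auto simp: conj_letter_def letter_def)
  qed
  show ?thesis
    by (induction w)
      (use g i in \<open>auto simp: subst_word_def eval_append * m_assoc letter_carrier eval_carrier inv_cancel\<close>)
qed

text \<open>Conjugation by h^t is iterated from the tables for h and its inverse, because t is
  unbounded in an infinite factor.\<close>

definition conj_word :: "nat \<Rightarrow> int \<Rightarrow> word \<Rightarrow> word" where
  "conj_word i t w = (if 0 \<le> t then (subst_word (conj_letter i (h (Suc i))) ^^ nat t) w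
    else (subst_word (conj_letter i (inv (h (Suc i)))) ^^ nat (- t)) w)"

lemma eval_conj_word:
  assumes i: "i < n"
  shows "eval_word i (conj_word i t w) = inv (h (Suc i) [^] t) \<otimes> eval_word i w \<otimes> h (Suc i) [^] t"
proof -
  have c: "h (Suc i) \<in> carrier G" "eval_word i w \<in> carrier G" using h_carrier eval_carrier i by auto
  have iter: "eval_word i ((subst_word (conj_letter i g) ^^ m) w) = inv (g [^] int m) \<otimes> eval_word i w \<otimes> g
      [^] int m"
    if g: "g \<in> H (Suc i)" for g m
  proof (induction m)
    case (Suc m)
    have gc: "g \<in> carrier G" using g i H_closed(5)[of "Suc i"] by simp
    have "g [^] int (Suc m) = g [^] int m \<otimes> g" using int_pow_mult[OF gc, of "int m" 1] gc
        by (simp add: add.commute)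
    then show ?case using Suc eval_conj_letter[OF i g] c gc by (simp add: inv_mult_group m_assoc)
  qed (use c in simp)
  show ?thesis
  proof (cases "0 \<le> t")
    case True
    then show ?thesis using iter[OF h_in[OF i], of "nat t"] by (simp add: conj_word_def)
  next
    case False
    have "inv (h (Suc i)) [^] int (nat (- t)) = h (Suc i) [^] t"
      using False c(1) by (simp add: int_pow_inv flip: int_pow_neg)
    then show ?thesis
      using False iter[OF H_closed(3)[of "Suc i"], OF _ h_in[OF i], of "nat (- t)"] i
          by (simp add: conj_word_def)
  qed
qed

text \<open>The least positive power of h in the lower subgroup, written in lower generators; for an
  infinite factor the period is 0 and the word denotes the identity.\<close>

definition period_word :: "nat \<Rightarrow> word" where
  "period_word i = (SOME w. eval_word i w = h (Suc i) [^] period (Suc i))"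

lemma eval_period_word: "i < n \<Longrightarrow> eval_word i (period_word i) = h (Suc i) [^] period (Suc i)"
  unfolding period_word_def by (rule someI_ex, rule eval_surj) (auto simp: power_in_H)

text \<open>The state (t, u) stands for h^t u, with u read at level i. The word is read from its
  right end, each letter being multiplied on from the left. A lower letter j moves past the power by
  j h^t = h^t (h^-t j h^t). When t would leave 0, ..., k - 1, it wraps around and the period word or
  its inverse compensates.\<close>

definition collect_step :: "nat \<Rightarrow> int \<Rightarrow> int \<times> word \<Rightarrow> int \<times> word" where
  "collect_step i j s =
    (if j = int (Suc i) then
       if period (Suc i) \<noteq> 0 \<and>
           fst s + 1 = period (Suc i) then (0, period_word i @ snd s) else (fst s + 1, snd s)
     else if j = - int (Suc i) then
       if period (Suc i) \<noteq> 0 \<and> fst s = 0 then (period (Suc i) - 1, inv_word (period_word i) @ snd s)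
       else (fst s - 1, snd s)
     else (fst s, conj_word i (fst s) [j] @ snd s))"

definition collect :: "nat \<Rightarrow> word \<Rightarrow> int \<times> word" where
  "collect i w = foldr (collect_step i) w (0, [])"

lemma collect_correct:
  assumes i: "i < n"
  shows "fst (collect i w) mod period (Suc i) = fst (collect i w)"
    "eval_word (Suc i) w = h (Suc i) [^] fst (collect i w) \<otimes> eval_word i (snd (collect i w))"
proof (atomize (full), induction w)
  case Nil
  show ?case by (simp add: collect_def)
next
  case (Cons j w)
  let ?x = "h (Suc i)" and ?k = "period (Suc i)"
  obtain t u where tu: "collect i w = (t, u)" by fastforce
  have IH: "t mod ?k = t" "eval_word (Suc i) w = ?x [^] t \<otimes> eval_word i u" using Cons tu by auto
  have c: "?x \<in> carrier G" "eval_word i u \<in> carrier G" "\<And>v. eval_word i v \<in> carrier G"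
    using h_carrier eval_carrier i by auto
  have col: "collect i (j # w) = collect_step i j (t, u)" by (simp add: collect_def flip: tu)
  have t: "?k \<noteq> 0 \<Longrightarrow> 0 \<le> t \<and> t < ?k" using IH(1) mod_int_eq_iff[of ?k t] by simp
  consider "j = int (Suc i)" | "j = - int (Suc i)" | "j \<noteq> int (Suc i)" "j \<noteq> - int (Suc i)" by blast
  then show ?case
  proof cases
    case 1
    have l: "letter (Suc i) j = ?x [^] (1 :: int)" using c 1 by (simp add: letter_def nat_add_distrib)
    have e: "eval_word (Suc i) (j # w) = ?x [^] (t + 1) \<otimes> eval_word i u"
      using l IH(2) c int_pow_mult[OF c(1), of 1 t] by (simp add: m_assoc add.commute)
    show ?thesis
    proof (cases "?k \<noteq> 0 \<and> t + 1 = ?k")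
      case True
      then have "eval_word (Suc i) (j # w) = eval_word i (period_word i @ u)"
        using e eval_period_word[OF i] eval_append[of i] i by simp
      then show ?thesis using 1 True c unfolding col by (simp add: collect_step_def)
    next
      case False
      then have "(t + 1) mod ?k = t + 1"
        using t mod_int_eq_iff[of ?k "t + 1"] by (cases "?k = 0") auto
      then show ?thesis using False 1 e unfolding col by (auto simp: collect_step_def)
    qed
  next
    case 2
    then have "j \<noteq> int (Suc i)" by simp
    have l: "letter (Suc i) j = ?x [^] (-1 :: int)" using c 2 by (simp add: letter_def nat_add_distrib)
    have e: "eval_word (Suc i) (j # w) = ?x [^] (t - 1) \<otimes> eval_word i u"
      using l IH(2) c int_pow_mult[OF c(1), of "-1" t] by (simp add: m_assoc)
    show ?thesis
    proof (cases "?k \<noteq> 0 \<and> t = 0")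
      case True
      have "eval_word (Suc i) (j # w) = ?x [^] (?k - 1 + - ?k) \<otimes> eval_word i u"
        using e True by simp
      also have "\<dots> = ?x [^] (?k - 1) \<otimes> eval_word i (inv_word (period_word i) @ u)"
        using eval_period_word[OF i] eval_append[of i] eval_inv[of i] i c
        by (simp only: int_pow_mult[OF c(1)] int_pow_neg[OF c(1)]) (simp add: m_assoc int_pow_closed)
      finally have "eval_word (Suc i) (j # w) = ?x [^] (?k - 1) \<otimes> eval_word i (inv_word (period_word i) @
          u)" .
      moreover have "(?k - 1) mod ?k = ?k - 1" using True mod_int_eq_iff[of ?k "?k - 1"] by simp
      ultimately show ?thesis
        using 2 True \<open>j \<noteq> int (Suc i)\<close> unfolding col by (simp add: collect_step_def)
    next
      case False
      then have "(t - 1) mod ?k = t - 1"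
        using t mod_int_eq_iff[of ?k "t - 1"] by (cases "?k = 0") auto
      then show ?thesis using False 2 e \<open>j \<noteq> int (Suc i)\<close> unfolding col by (auto simp: collect_step_def)
    qed
  next
    case 3
    then have "(j \<noteq> 0 \<and> \<bar>j\<bar> \<le> int (Suc i)) = (j \<noteq> 0 \<and> \<bar>j\<bar> \<le> int i)" by auto
    then have l: "letter (Suc i) j = eval_word i [j]" using letter_carrier[of i j] i by (simp add: letter_def)
    have "eval_word (Suc i) (j # w) = ?x [^] t \<otimes> eval_word i (conj_word i t [j] @ u)"
      using l IH(2) c eval_append[of i] eval_conj_word[OF i, of t "[j]"] i
      by (simp add: m_assoc inv_cancel letter_carrier)
    then show ?thesis using 3 IH(1) unfolding col by (simp add: collect_step_def)
  qed
qed

lemma exponent_collect: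
  assumes i: "i < n"
  shows "exponent i (eval_word (Suc i) w) = fst (collect i w)"
    "remainder i (eval_word (Suc i) w) = eval_word i (snd (collect i w))"
  unfolding collect_correct(2)[OF i]
  using exponent_decomp[OF i eval_in collect_correct(1)[OF i]] i by auto

primrec prec_word :: "nat \<Rightarrow> word \<Rightarrow> word \<Rightarrow> bool" where
  "prec_word 0 v w = False"
| "prec_word (Suc i) v w \<longleftrightarrow> enc (fst (collect i v)) < enc (fst (collect i w)) \<or>
    fst (collect i v) = fst (collect i w) \<and> prec_word i (snd (collect i v)) (snd (collect i w))"

primrec coord_word :: "nat \<Rightarrow> word \<Rightarrow> int list" where
  "coord_word 0 w = []"
| "coord_word (Suc i) w = fst (collect i w) # coord_word i (snd (collect i w))"

lemma prec_word_iff: "i \<le> n \<Longrightarrow> prec_word i v w \<longleftrightarrow> (eval_word i v, eval_word i w) \<in> prec i"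
  by (induction i arbitrary: v w)
    (auto simp: exponent_collect Suc_le_eq enc_int_def inj_int_encode inj_eq)

lemma coord_word_iff: "i \<le> n \<Longrightarrow> 1 \<le> j \<Longrightarrow> j \<le> i \<Longrightarrow> coord i (eval_word i w) j \<in> set (coord_word i w)"
  by (induction i arbitrary: w) (auto simp: exponent_collect Suc_le_eq le_Suc_eq)

text \<open>The word problem solved through the order: since \<open>prec n\<close> is total on the
  group and irreflexive, two words are equal in value exactly if neither precedes the other.\<close>

definition same_word :: "word \<Rightarrow> word \<Rightarrow> bool" where
  "same_word v w \<longleftrightarrow> \<not> prec_word n v w \<and> \<not> prec_word n w v"

lemma same_word_iff: "same_word v w \<longleftrightarrow> eval_word n v = eval_word n w"
  using total_prec[of n] eval_in[of n] wf_not_refl[OF wf_prec]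
  by (auto simp: same_word_def prec_word_iff total_on_def)

section \<open>Finitely many predecessor sets up to a window\<close>

primrec cover :: "nat \<Rightarrow> nat \<Rightarrow> word list" where
  "cover m 0 = [[]]"
| "cover m (Suc i) = concat (map (\<lambda>v. map ((@) v) (cover m i))
    (map (\<lambda>j. replicate j (int (Suc i))) [0..<m] @ map (\<lambda>j. replicate j (- int (Suc i))) [0..<m]))"

lemma cover_letters: "w \<in> set (cover m i) \<Longrightarrow> l \<in> set w \<Longrightarrow> \<bar>l\<bar> \<le> int i"
  by (induction i arbitrary: w) (fastforce)+

lemma cover_coord:
  assumes "i \<le> n" "\<And>j. 1 \<le> j \<Longrightarrow> j \<le> i \<Longrightarrow> s j mod period j = s j \<and> \<bar>s j\<bar> < int m"
  shows "\<exists>w\<in>set (cover m i). \<forall>j. 1 \<le> j \<and> j \<le> i \<longrightarrow> coord i (eval_word i w) j = s j"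
  using assms
proof (induction i)
  case (Suc i)
  then have i: "i < n" by simp
  obtain u where u: "u \<in> set (cover m i)" "\<And>j. 1 \<le> j \<Longrightarrow> j \<le> i \<Longrightarrow> coord i (eval_word i u) j = s j"
    using Suc by auto
  let ?x = "h (Suc i)" and ?k = "period (Suc i)"
  have s: "\<bar>s (Suc i)\<bar> < int m" "s (Suc i) mod ?k = s (Suc i)" using Suc.prems(2)[of "Suc i"] by simp_all
  obtain v where v:
      "v \<in> (\<lambda>j. replicate j (int (Suc i))) ` {0..<m} \<union> (\<lambda>j. replicate j (- int (Suc i))) ` {0..<m}"
    "eval_word (Suc i) v = ?x [^] s (Suc i)"
  proof (cases "0 \<le> s (Suc i)")
    case True
    show thesis
      by (rule that[of "replicate (nat (s (Suc i))) (int (Suc i))"])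
        (use s True eval_power(1)[OF i, of "nat (s (Suc i))"] in \<open>auto simp del: of_nat_Suc\<close>)
  next
    case False
    show thesis
      by (rule that[of "replicate (nat (- s (Suc i))) (- int (Suc i))"])
        (use s False eval_power(2)[OF i, of "nat (- s (Suc i))"] in \<open>auto simp del: of_nat_Suc\<close>)
  qed
  have e: "eval_word (Suc i) (v @ u) = ?x [^] s (Suc i) \<otimes> eval_word i u"
    using eval_append[of "Suc i"] i v eval_mono[of i "Suc i" u] cover_letters[OF u(1)] by simp
  have "exponent i (eval_word (Suc i) (v @ u)) = s (Suc i)"
      "remainder i (eval_word (Suc i) (v @ u)) = eval_word i u"
    unfolding e using exponent_decomp[OF i eval_in s(2)] i by auto
  moreover have "v @ u \<in> set (cover m (Suc i))" using u(1) v(1) by auto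
  ultimately show ?case using u(2)
    by (intro bexI[of _ "v @ u"]) (auto simp: le_Suc_eq)
qed auto

text \<open>Each coordinate of \<open>g\<close> is replaced, through \<open>segment_cover\<close>,
  by one below \<open>m\<close> that has the same predecessors among the coordinates of
  \<open>K\<close>. A condition on \<open>past g\<close> that reads only elements of
  \<open>K\<close> is thereby reduced to finitely many g.\<close>

lemma cover_past:
  assumes g: "g \<in> carrier G"
    and m: "\<And>j. 1 \<le> j \<Longrightarrow> j \<le> n \<Longrightarrow> period j < int m"
    and K: "\<And>w t. w \<in> set K \<Longrightarrow> t \<in> set (coord_word n w) \<Longrightarrow> \<bar>t\<bar> + 1 < int m"
  shows "\<exists>v\<in>set (cover m n). \<forall>w\<in>set K. eval_word n w \<in> past (eval_word n v) \<longleftrightarrow> eval_word n w \<in> past g"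
proof -
  have gH: "g \<in> H n" using g H_n by simp
  have "\<exists>s'. s' mod period j = s' \<and> \<bar>s'\<bar> < int m \<and> (\<forall>t. \<bar>t\<bar> + 1 < int m \<longrightarrow>
      (int_encode ((s' + t) mod period j) < int_encode s' \<longleftrightarrow>
        int_encode ((coord n g j + t) mod period j) < int_encode (coord n g j)))" if "1 \<le> j" "j \<le> n" for j
    by (rule segment_cover) (use coord_mod[OF _ gH that] m[OF that] in auto)
  then obtain s where s: "\<And>j. 1 \<le> j \<Longrightarrow> j \<le> n \<Longrightarrow> s j mod period j = s j \<and> \<bar>s j\<bar> < int m"
    "\<And>j t. 1 \<le> j \<Longrightarrow> j \<le> n \<Longrightarrow> \<bar>t\<bar> + 1 < int m \<Longrightarrow> int_encode ((s j + t) mod period j) < int_encode (s j) \<longleftrightarrow>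
        int_encode ((coord n g j + t) mod period j) < int_encode (coord n g j)" by metis
  obtain v where v: "v \<in> set (cover m n)" "\<And>j. 1 \<le> j \<Longrightarrow> j \<le> n \<Longrightarrow> coord n (eval_word n v) j = s j"
    using cover_coord[of n s m] s(1) by blast
  show ?thesis
  proof (intro bexI[OF _ v(1)] ballI)
    fix w assume w: "w \<in> set K"
    let ?u = "eval_word n w" and ?v = "eval_word n v"
    have c: "?u \<in> carrier G" "?v \<in> carrier G" using eval_carrier by auto
    show "?u \<in> past ?v \<longleftrightarrow> ?u \<in> past g"
    proof (cases "?u = \<one>")
      case True
      then show ?thesis using one_notin_past c g by simp
    next
      case False
      have r: "1 \<le> rank ?u" "rank ?u \<le> n" using rank[of n ?u] False c H_n by auto
      let ?t = "coord n ?u (rank ?u)"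
      have "\<bar>?t\<bar> + 1 < int m" using K[OF w coord_word_iff[OF order.refl r]] .
      moreover have "?u \<in> (h (rank ?u) [^] ?t) <# H (rank ?u - 1)" using coord_rank[of n ?u] False c H_n
          by simp
      from prec_mult_iff[of n _ ?u, OF order.refl _ _ False this]
      have "?u \<in> past x \<longleftrightarrow>
          int_encode ((coord n x (rank ?u) + ?t) mod period (rank ?u)) < int_encode (coord n x (rank ?u))"
        if "x \<in> carrier G" for x
        using that c H_n by (simp add: past_def)
      ultimately show ?thesis using s(2)[OF r] v(2)[OF r] c g by simp
    qed
  qed
qed

end

subsection \<open>Computability\<close>

lemma computable_inv_word [computable_intros]: "computable f \<Longrightarrow> computable (\<lambda>x. inv_word (f x))"
  unfolding inv_word_def by (intro computable_intros)

context polycycle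
begin

lemma computable_conj_letter: "computable (conj_letter i g)"
proof (rule computable_finite_support)
  have "{j. conj_letter i g j \<noteq> []} \<subseteq> {- int i..int i}"
    by (auto simp: conj_letter_def split: if_splits)
  then show "finite {j. conj_letter i g j \<noteq> []}" by (rule finite_subset) simp
qed

lemma computable_subst_word: "computable S \<Longrightarrow> computable f \<Longrightarrow> computable (\<lambda>x. subst_word S (f x))"
  unfolding subst_word_def
  by (intro computable_concat computable_map) (simp_all add: computable_comp[of S] computable_intros)

lemma computable_conj_word: "computable f \<Longrightarrow> computable g \<Longrightarrow> computable (\<lambda>x. conj_word i (f x) (g x))"
  unfolding conj_word_def
  by (intro computable_intros computable_subst_word computable_conj_letter)

lemma computable_collect: "computable f \<Longrightarrow> computable (\<lambda>x. collect i (f x))"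
  unfolding collect_def collect_step_def
  by (intro computable_intros computable_conj_word)

lemma decidable_prec_word: "computable f \<Longrightarrow> computable g \<Longrightarrow> decidable (\<lambda>x. prec_word i (f x) (g x))"
proof (induction i arbitrary: f g)
  case (Suc i)
  show ?case unfolding prec_word.simps by (intro computable_intros computable_collect Suc)
qed (simp add: decidable_const)

lemma computable_coord_word: "computable f \<Longrightarrow> computable (\<lambda>x. coord_word i (f x))"
proof (induction i arbitrary: f)
  case (Suc i)
  show ?case unfolding coord_word.simps by (intro computable_intros computable_collect Suc)
qed (simp add: computable_const)

lemma decidable_same_word: "computable f \<Longrightarrow> computable g \<Longrightarrow> decidable (\<lambda>x. same_word (f x) (g x))"
  unfolding same_word_def by (intro computable_intros decidable_prec_word)

lemma computable_cover: "computable f \<Longrightarrow> computable (\<lambda>x. cover (f x) i)"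
proof (rule computable_comp[where g = "\<lambda>m. cover m i"])
  show "computable (\<lambda>m. cover m i)"
  proof (induction i)
    case (Suc i)
    show ?case unfolding cover.simps
      by (intro computable_intros Suc computable_comp[OF Suc])
  qed (simp add: computable_const)
qed

end

section \<open>Compactness\<close>

text \<open>Tychonoff for a finite discrete alphabet: a constraint that depends on finitely many
  coordinates defines a closed set, since the points that share those coordinates with a violating
  point form an open set of violating points.\<close>

lemma compact_constraints:
  assumes A: "finite A" and D: "\<And>c. c \<in> U \<Longrightarrow> finite (D c)"
    and dep: "\<And>c x y. c \<in> U \<Longrightarrow> x \<in> I \<rightarrow>\<^sub>E A \<Longrightarrow> y \<in> I \<rightarrow>\<^sub>E A \<Longrightarrow> (\<And>k. k \<in> D c \<Longrightarrow> k \<in> I \<Longrightarrow> x k = y k) \<Longrightarrow> R c x \<Longrightarrow> R c y"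
    and fin: "\<And>V. finite V \<Longrightarrow> V \<subseteq> U \<Longrightarrow> \<exists>x\<in>I \<rightarrow>\<^sub>E A. \<forall>c\<in>V. R c x"
  shows "\<exists>x\<in>I \<rightarrow>\<^sub>E A. \<forall>c\<in>U. R c x"
proof -
  let ?T = "product_topology (\<lambda>_. discrete_topology A) I"
  let ?Z = "\<lambda>c. {x \<in> I \<rightarrow>\<^sub>E A. R c x}"
  have top: "topspace ?T = I \<rightarrow>\<^sub>E A" by simp
  have "compact_space ?T"
    using A by (simp add: compact_space_product_topology compact_space_discrete_topology)
  note compact = this
  have closed: "closedin ?T (?Z c)" if c: "c \<in> U" for c
  proof -
    have "openin ?T ((I \<rightarrow>\<^sub>E A) - ?Z c)"
    proof (subst openin_subopen, intro ballI)
      fix x assume x: "x \<in> (I \<rightarrow>\<^sub>E A) - ?Z c"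
      let ?B = "PiE I (\<lambda>k. if k \<in> D c then {x k} else A)"
      have "openin ?T ?B"
        unfolding openin_PiE_gen
      proof (intro disjI2 conjI ballI)
        show "finite {i \<in> I. (if i \<in> D c then {x i} else A) \<noteq> topspace (discrete_topology A)}"
          by (rule finite_subset[OF _ D[OF c]]) auto
        show "openin (discrete_topology A) (if i \<in> D c then {x i} else A)" if "i \<in> I" for i
          using x that by (auto simp: openin_discrete_topology PiE_iff)
      qed
      moreover have "?B \<subseteq> (I \<rightarrow>\<^sub>E A) - ?Z c"
      proof
        fix y assume y: "y \<in> ?B"
        have xy: "x k = y k" if "k \<in> D c" "k \<in> I" for k using PiE_mem[OF y that(2)] that by simp
        have yA: "y \<in> I \<rightarrow>\<^sub>E A"
        proof (rule PiE_I)
          show "y k \<in> A" if "k \<in> I" for k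
            using PiE_mem[OF y that] xy[OF _ that] PiE_mem[of x I "\<lambda>_. A" k] x that by (cases "k \<in> D c") auto
          show "y k = undefined" if "k \<notin> I" for k using PiE_arb[OF y that] .
        qed
        then show "y \<in> (I \<rightarrow>\<^sub>E A) - ?Z c"
          using dep[OF c yA, of x] xy x yA by auto
      qed
      moreover have "x \<in> ?B" using x by (auto simp: PiE_iff)
      ultimately show "\<exists>T. openin ?T T \<and> x \<in> T \<and> T \<subseteq> (I \<rightarrow>\<^sub>E A) - ?Z c" by blast
    qed
    then show ?thesis unfolding closedin_def top by auto
  qed
  have closed': "closedin ?T (I \<rightarrow>\<^sub>E A)" using closedin_topspace[of ?T] by simp
  \<comment> \<open>The whole space is put into the family so that the intersection consists of
    configurations even if there are no constraints.\<close>
  have fip: "\<Inter>\<F> \<noteq> {}" if F: "finite \<F>" "\<F> \<subseteq> insert (I \<rightarrow>\<^sub>E A) (?Z ` U)" for \<F>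
  proof -
    have "\<F> - {I \<rightarrow>\<^sub>E A} \<subseteq> ?Z ` U" using F by auto
    then have "\<exists>V\<subseteq>U. finite V \<and> \<F> - {I \<rightarrow>\<^sub>E A} = ?Z ` V"
      by (intro finite_subset_image) (use F(1) in simp)
    then obtain V where V: "V \<subseteq> U" "finite V" "\<F> - {I \<rightarrow>\<^sub>E A} = ?Z ` V" by (elim exE conjE) (rule that)
    obtain x where x: "x \<in> I \<rightarrow>\<^sub>E A" "\<forall>c\<in>V. R c x" using fin[OF V(2,1)] by (elim bexE) (rule that)
    have "x \<in> Z" if "Z \<in> \<F>" for Z
    proof (cases "Z = I \<rightarrow>\<^sub>E A")
      case False
      then have "Z \<in> ?Z ` V" using that unfolding V(3)[symmetric] by simp
      then show ?thesis using x by auto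
    qed (use x in simp)
    then show ?thesis by blast
  qed
  have "\<Inter>(insert (I \<rightarrow>\<^sub>E A) (?Z ` U)) \<noteq> {}"
  proof (rule compact_space_fip[THEN iffD1, OF compact, THEN spec, THEN mp], intro conjI ballI allI impI)
    show "closedin ?T Z" if "Z \<in> insert (I \<rightarrow>\<^sub>E A) (?Z ` U)" for Z
      using that closed closed' by (elim insertE imageE) simp_all
  qed (elim conjE, rule fip)
  then obtain x where "x \<in> \<Inter>(insert (I \<rightarrow>\<^sub>E A) (?Z ` U))" by (meson ex_in_conv)
  then show ?thesis by (intro bexI[of _ x]) simp_all
qed

lemma wf_max_exists:
  assumes "wf r" "trans r" "total_on S r" "finite K" "K \<noteq> {}" "K \<subseteq> S"
  shows "\<exists>m\<in>K. \<forall>k\<in>K. k = m \<or> (k, m) \<in> r"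
  using assms(4-)
proof (induction K rule: finite_ne_induct)
  case (insert a K)
  then obtain m where m: "m \<in> K" "\<And>k. k \<in> K \<Longrightarrow> k = m \<or> (k, m) \<in> r" by auto
  with insert.prems assms(3) have "a = m \<or> (a, m) \<in> r \<or> (m, a) \<in> r"
    by (auto simp: total_on_def)
  then show ?case using m assms(2) by (metis insert_iff transE)
qed simp

section \<open>Local rules and the avo condition on predecessor sets\<close>

context polycycle
begin

definition before :: "'a \<Rightarrow> 'a set" where
  "before g = {k \<in> carrier G. (k, g) \<in> prec n}"

definition matches :: "('a \<rightharpoonup> 'c) \<Rightarrow> 'a \<Rightarrow> 'a set \<Rightarrow> ('a \<Rightarrow> 'c) \<Rightarrow> bool" where
  "matches q u S x \<longleftrightarrow> (\<forall>k\<in>dom q. u \<otimes> k \<in> S \<and> Some (x (u \<otimes> k)) = q k)"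

definition valid :: "('a \<rightharpoonup> 'c) set \<Rightarrow> 'a set \<Rightarrow> ('a \<Rightarrow> 'c) \<Rightarrow> bool" where
  "valid Q S x \<longleftrightarrow> (\<forall>q\<in>Q. \<forall>u\<in>carrier G. \<not> matches q u S x)"

text \<open>Translation by \<open>inv k\<close> puts the cell k of q on the identity, so exactly the
  occurrences that use the new cell are tested.\<close>

definition fresh :: "('a \<rightharpoonup> 'c) set \<Rightarrow> 'a set \<Rightarrow> ('a \<Rightarrow> 'c) \<Rightarrow> 'c \<Rightarrow> bool" where
  "fresh Q S x a \<longleftrightarrow> (\<forall>q\<in>Q. \<forall>k\<in>dom q. \<not> matches q (inv k) (insert \<one> S) (x(\<one> := a)))"

text \<open>Occurrences are excluded only at positions in \<open>E\<close>. For finite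
  \<open>E\<close> and \<open>Q\<close> the condition reads finitely many cells, and it weakens as
  \<open>E\<close> grows, which suits the compactness arguments.\<close>

definition admits_fresh :: "('a \<rightharpoonup> 'c) set \<Rightarrow> 'c set \<Rightarrow> 'a set \<Rightarrow> 'a set \<Rightarrow> bool" where
  "admits_fresh Q A E S \<longleftrightarrow> (\<forall>x\<in>carrier G \<rightarrow>\<^sub>E A.
     (\<forall>u\<in>E. \<forall>q\<in>Q. \<not> matches q u S x) \<longrightarrow> (\<exists>a\<in>A. fresh Q S x a))"

text \<open>The nontrivial direction of the avo equivalence, stated with points of X in place of
  restrictions.\<close>

definition determines :: "'c set \<Rightarrow> ('a \<Rightarrow> 'c) set \<Rightarrow> 'a set \<Rightarrow> 'a set \<Rightarrow> bool" where
  "determines A X B C \<longleftrightarrow> (\<forall>x\<in>X. \<forall>a\<in>A. (\<exists>y\<in>X. (\<forall>k\<in>B. y k = x k) \<and> y \<one> = a) \<longrightarrow>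
     (\<exists>y\<in>X. (\<forall>k\<in>C. y k = x k) \<and> y \<one> = a))"

text \<open>The premise gets stronger as B grows and the conclusion weaker as C shrinks. This
  carries a witness for a limit C over to the pasts inside C that contain it.\<close>

lemma determines_mono:
  assumes det: "determines A X B C" and sub: "B \<subseteq> B'" "C' \<subseteq> C"
  shows "determines A X B' C'"
  unfolding determines_def
proof (intro ballI impI)
  fix x a assume "x \<in> X" "a \<in> A" and "\<exists>y\<in>X. (\<forall>k\<in>B'. y k = x k) \<and> y \<one> = a"
  then obtain y where "y \<in> X" "\<forall>k\<in>B'. y k = x k" "y \<one> = a" by (elim bexE conjE) (rule that)
  with sub(1) have "\<exists>y\<in>X. (\<forall>k\<in>B. y k = x k) \<and> y \<one> = a" by (intro bexI[of _ y]) auto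
  with det[unfolded determines_def] \<open>x \<in> X\<close> \<open>a \<in> A\<close>
  have "\<exists>y\<in>X. (\<forall>k\<in>C. y k = x k) \<and> y \<one> = a" by simp
  then obtain y where "y \<in> X" "\<forall>k\<in>C. y k = x k" "y \<one> = a" by (elim bexE conjE) (rule that)
  with sub(2) show "\<exists>y\<in>X. (\<forall>k\<in>C'. y k = x k) \<and> y \<one> = a" by (intro bexI[of _ y]) auto
qed

lemma matches_mono: "matches q u S x \<Longrightarrow> S \<subseteq> T \<Longrightarrow> matches q u T x"
  unfolding matches_def by blast

lemma valid_mono: "valid Q T x \<Longrightarrow> S \<subseteq> T \<Longrightarrow> valid Q S x"
  unfolding valid_def using matches_mono by blast

lemma past_before: "g \<in> carrier G \<Longrightarrow> k \<in> carrier G \<Longrightarrow> inv g \<otimes> k \<in> past g \<longleftrightarrow> k \<in> before g"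
  by (simp add: past_def before_def inv_cancel)

lemma before_past: "g \<in> carrier G \<Longrightarrow> k \<in> carrier G \<Longrightarrow> g \<otimes> k \<in> before g \<longleftrightarrow> k \<in> past g"
  by (simp add: past_def before_def)

lemma past_carrier: "past g \<subseteq> carrier G"
  by (auto simp: past_def)

lemma avo_determines:
  assumes "avo G A X C"
  shows "\<exists>B. finite B \<and> B \<subseteq> C \<and> determines A X B C"
proof -
  from assms obtain B where B: "finite B" "B \<subseteq> C" and C: "C \<subseteq> carrier G - {\<one>}"
    and av: "\<And>x a. x \<in> restr X C \<Longrightarrow> a \<in> A \<Longrightarrow> (restrict x B)(\<one> := a) \<in> restr X (B \<union> {\<one>}) \<longleftrightarrow>
        x(\<one> := a) \<in> restr X (C \<union> {\<one>})"
    unfolding avo_def by metis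
  have eq: "(restrict x S)(\<one> := a) \<in> restr X (S \<union> {\<one>}) \<longleftrightarrow> (\<exists>y\<in>X. (\<forall>k\<in>S. y k = x k) \<and> y \<one> = a)" if "\<one> \<notin> S"
      for x S a
  proof
    assume "(restrict x S)(\<one> := a) \<in> restr X (S \<union> {\<one>})"
    then obtain y where y: "y \<in> X" "(restrict x S)(\<one> := a) = restrict y (S \<union> {\<one>})" by (auto simp: restr_def)
    have "y k = x k" if "k \<in> S" for k using fun_cong[OF y(2), of k] that \<open>\<one> \<notin> S\<close> by (auto split: if_splits)
    moreover have "y \<one> = a" using fun_cong[OF y(2), of \<one>] by simp
    ultimately show "\<exists>y\<in>X. (\<forall>k\<in>S. y k = x k) \<and> y \<one> = a" using y(1) by blast
  next
    assume "\<exists>y\<in>X. (\<forall>k\<in>S. y k = x k) \<and> y \<one> = a"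
    then obtain y where "y \<in> X" "\<forall>k\<in>S. y k = x k" "y \<one> = a" by blast
    then have "restrict y (S \<union> {\<one>}) = (restrict x S)(\<one> := a)" by (auto simp: fun_eq_iff)
    from image_eqI[where f = "\<lambda>x. restrict x (S \<union> {\<one>})", OF this[symmetric] \<open>y \<in> X\<close>]
    show "(restrict x S)(\<one> := a) \<in> restr X (S \<union> {\<one>})" unfolding restr_def .
  qed
  have one: "\<one> \<notin> C" "\<one> \<notin> B" using B C by auto
  have rr: "restrict (restrict x C) B = restrict x B" for x :: "'a \<Rightarrow> 'c" using B by (auto simp: fun_eq_iff)
  have "determines A X B C"
    unfolding determines_def eq[OF one(1), symmetric] eq[OF one(2), symmetric]
    using av[of "restrict _ C"] rr by (simp add: restr_def)
  with B show ?thesis by blast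
qed

text \<open>The values of the words coded below m are finite sets that increase to the whole group.
  They turn the failure of a uniform finite set into a sequence of counterexamples.\<close>

lemma exhausting_words:
  assumes "finite K" "K \<subseteq> carrier G"
  shows "\<exists>m0. \<forall>m\<ge>m0. K \<subseteq> (\<lambda>i. eval_word n (denc i)) ` {..<m}"
  using assms
proof (induction K rule: finite_induct)
  case (insert g K)
  then obtain m0 where "\<forall>m\<ge>m0. K \<subseteq> (\<lambda>i. eval_word n (denc i)) ` {..<m}" by auto
  moreover obtain w where "eval_word n w = g" using eval_surj[of n g] insert.prems H_n by auto
  then have "\<forall>m\<ge>Suc (enc w). g \<in> (\<lambda>i. eval_word n (denc i)) ` {..<m}"
    by (auto intro!: image_eqI[of _ _ "enc w"])
  ultimately show ?case by (intro exI[of _ "max m0 (Suc (enc w))"]) auto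
qed simp

text \<open>A property of the pasts that holds locally around every inductive interval, in the
  topology in which pasts converge to inductive intervals from below, holds uniformly.\<close>

lemma past_uniform:
  assumes loc: "\<And>C. inductive_interval G n H h C \<Longrightarrow>
      (\<And>K. finite K \<Longrightarrow> K \<subseteq> C \<Longrightarrow> \<exists>g\<in>carrier G. past g \<subseteq> C \<and> K \<subseteq> past g) \<Longrightarrow>
      \<exists>K E. finite K \<and> K \<subseteq> C \<and> finite E \<and> E \<subseteq> carrier G \<and>
        (\<forall>g\<in>carrier G. \<forall>E'. past g \<subseteq> C \<and> K \<subseteq> past g \<and> E \<subseteq> E' \<longrightarrow> R g E')"
  shows "\<exists>E. finite E \<and> E \<subseteq> carrier G \<and> (\<forall>g\<in>carrier G. R g E)"
proof (rule ccontr)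
  assume no: "\<not> ?thesis"
  let ?E = "\<lambda>m. (\<lambda>i. eval_word n (denc i)) ` {..<m :: nat}"
  have "\<exists>g\<in>carrier G. \<not> R g (?E m)" for m
    using no eval_carrier[of n]
        by (metis (no_types, lifting) finite_imageI finite_lessThan image_subsetI order.refl)
  then obtain g where g: "\<And>m. g m \<in> carrier G" "\<And>m. \<not> R (g m) (?E m)" by metis
  from past_limit[of g, OF g(1)] obtain C M where C: "inductive_interval G n H h C" "infinite M"
    "\<forall>m\<in>M. past (g m) \<subseteq> C" "\<forall>u\<in>C. finite {m \<in> M. u \<notin> past (g m)}"
    by (elim exE conjE) (rule that)
  \<comment> \<open>Each element of \<open>K\<close> is missed at finitely many indices only, so at
    arbitrarily late indices the past lies between \<open>K\<close> and \<open>C\<close>.\<close>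
  have pick: "\<exists>m\<in>M. m0 \<le> m \<and> past (g m) \<subseteq> C \<and> K \<subseteq> past (g m)" if "finite K" "K \<subseteq> C" for K m0
  proof -
    have "finite ({..<m0} \<union> (\<Union>u\<in>K. {m \<in> M. u \<notin> past (g m)}))"
      using that C(4) by auto
    from Diff_infinite_finite[OF this C(2)]
    have "M - ({..<m0} \<union> (\<Union>u\<in>K. {m \<in> M. u \<notin> past (g m)})) \<noteq> {}"
      by (metis finite.emptyI)
    then obtain m where "m \<in> M" "m \<notin> {..<m0}" "m \<notin> (\<Union>u\<in>K. {m \<in> M. u \<notin> past (g m)})" by blast
    then show ?thesis using C(3) by (intro bexI[of _ m]) auto
  qed
  have "\<exists>K E. finite K \<and> K \<subseteq> C \<and> finite E \<and> E \<subseteq> carrier G \<and>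
        (\<forall>g\<in>carrier G. \<forall>E'. past g \<subseteq> C \<and> K \<subseteq> past g \<and> E \<subseteq> E' \<longrightarrow> R g E')"
  proof (rule loc[OF C(1)])
    fix K assume "finite K" "K \<subseteq> C"
    from pick[OF this, of 0] obtain m where "past (g m) \<subseteq> C" "K \<subseteq> past (g m)" by blast
    then show "\<exists>g\<in>carrier G. past g \<subseteq> C \<and> K \<subseteq> past g" using g(1) by (intro bexI[of _ "g m"]) auto
  qed
  then obtain K E where KE: "finite K" "K \<subseteq> C" "finite E" "E \<subseteq> carrier G"
    and R: "\<forall>g\<in>carrier G. \<forall>E'. past g \<subseteq> C \<and> K \<subseteq> past g \<and> E \<subseteq> E' \<longrightarrow> R g E'"
    by (elim exE conjE) (rule that)
  obtain m0 where m0: "\<forall>m\<ge>m0. E \<subseteq> ?E m" using exhausting_words[OF KE(3,4)] by blast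
  obtain m where m: "m0 \<le> m" "past (g m) \<subseteq> C" "K \<subseteq> past (g m)" using pick[OF KE(1,2), of m0] by blast
  have "R (g m) (?E m)"
    by (rule R[rule_format, OF g(1)]) (intro conjI m(2,3) m0[rule_format, OF m(1)])
  with g(2) show False by simp
qed

text \<open>At a limit C the avo witness B plays both parts: it is the finite set that a nearby past
  has to contain, and the window that decides the letter.\<close>

lemma uniform_determines:
  assumes "\<And>C. inductive_interval G n H h C \<Longrightarrow> avo G A X C"
  shows "\<exists>W. finite W \<and> W \<subseteq> carrier G \<and> (\<forall>g\<in>carrier G. determines A X (W \<inter> past g) (past g))"
proof (rule past_uniform)
  fix C assume "inductive_interval G n H h C"
  from avo_determines[OF assms[OF this]] obtain B where B: "finite B" "B \<subseteq> C" "determines A X B C" by blast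
  moreover have "C \<subseteq> carrier G" using assms[OF \<open>inductive_interval G n H h C\<close>] by (auto simp: avo_def)
  moreover have "determines A X (E' \<inter> past g) (past g)" if "past g \<subseteq> C" "B \<subseteq> past g" "B \<subseteq> E'" for g E'
    by (rule determines_mono[OF B(3)]) (use that in auto)
  ultimately show "\<exists>K E. finite K \<and> K \<subseteq> C \<and> finite E \<and> E \<subseteq> carrier G \<and>
        (\<forall>g\<in>carrier G. \<forall>E'. past g \<subseteq> C \<and> K \<subseteq> past g \<and> E \<subseteq> E' \<longrightarrow> determines A X (E' \<inter> past g) (past g))"
    by (intro exI[of _ B]) auto
qed

end

section \<open>Extension of partial configurations to points of the SFT\<close>

locale sft = polycycle +
  fixes A :: "'c set" and F :: "('a \<rightharpoonup> 'c) set"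
  assumes finite_A: "finite A" and F_pattern: "P \<in> F \<Longrightarrow> is_pattern G A P"
begin

definition X :: "('a \<Rightarrow> 'c) set" where
  "X = SFT G A F"

lemma X_iff: "x \<in> X \<longleftrightarrow> x \<in> carrier G \<rightarrow>\<^sub>E A \<and> valid F (carrier G) x"
proof -
  have "(\<exists>u\<in>carrier G. \<forall>k\<in>dom P. Some (x (u \<otimes> k)) = P k) \<longleftrightarrow> (\<exists>u\<in>carrier G. matches P u (carrier G) x)"
      if "P \<in> F" for P
    using F_pattern[OF that] unfolding matches_def is_pattern_def by (meson m_closed subsetD)
  then show ?thesis
    unfolding X_def SFT_def occurs_in_point_def valid_def mem_Collect_eq by blast
qed

lemma X_PiE: "x \<in> X \<Longrightarrow> x \<in> carrier G \<rightarrow>\<^sub>E A"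
  by (simp add: X_iff)

lemma X_in_A: "x \<in> X \<Longrightarrow> g \<in> carrier G \<Longrightarrow> x g \<in> A"
  using X_PiE by (auto simp: PiE_iff)

lemma shift_apply: "k \<in> carrier G \<Longrightarrow> shift G g x k = x (inv g \<otimes> k)"
  by (simp add: shift_def)

lemma matches_shift:
  assumes "g \<in> carrier G" "u \<in> carrier G" "dom q \<subseteq> carrier G"
    and S: "\<And>k. k \<in> carrier G \<Longrightarrow> k \<in> S \<Longrightarrow> inv g \<otimes> k \<in> T"
    and "matches q u S (shift G g x)"
  shows "matches q (inv g \<otimes> u) T x"
  unfolding matches_def
proof
  fix k assume k: "k \<in> dom q"
  then have "k \<in> carrier G" using assms by auto
  moreover have "shift G g x (u \<otimes> k) = x (inv g \<otimes> (u \<otimes> k))"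
    using \<open>k \<in> carrier G\<close> assms(2) by (simp add: shift_apply)
  ultimately show "inv g \<otimes> u \<otimes> k \<in> T \<and> Some (x (inv g \<otimes> u \<otimes> k)) = q k"
    using assms(5)[unfolded matches_def, rule_format, OF k] S[of "u \<otimes> k"] assms(1,2) by (simp add: m_assoc)
qed

lemma shift_PiE: "x \<in> carrier G \<rightarrow>\<^sub>E A \<Longrightarrow> g \<in> carrier G \<Longrightarrow> shift G g x \<in> carrier G \<rightarrow>\<^sub>E A"
  by (auto simp: shift_def)

lemma X_shift:
  assumes "x \<in> X" "g \<in> carrier G"
  shows "shift G g x \<in> X"
proof -
  have "\<not> matches q u (carrier G) (shift G g x)" if "q \<in> F" "u \<in> carrier G" for q u
    using matches_shift[of g u q "carrier G" "carrier G" x] assms that F_pattern[OF that(1)]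
    by (auto simp: X_iff valid_def is_pattern_def)
  then show ?thesis using assms by (simp add: X_iff shift_PiE valid_def)
qed

definition extends :: "'a set \<Rightarrow> ('a \<Rightarrow> 'c) \<Rightarrow> bool" where
  "extends S x \<longleftrightarrow> (\<exists>y\<in>X. \<forall>k\<in>S. y k = x k)"

text \<open>Avoiding \<open>Q\<close> on \<open>S\<close> is split into one constraint per pattern
  and position; a finite subfamily then involves only a finite set \<open>E\<close> of positions.
  Taking \<open>S\<close> to be the whole group and \<open>Q\<close> to be \<open>F\<close> yields
  points of \<open>X\<close>.\<close>

lemma X_constraints:
  assumes D: "\<And>c. c \<in> U \<Longrightarrow> finite (D c)"
    and dep: "\<And>c x y. c \<in> U \<Longrightarrow> x \<in> carrier G \<rightarrow>\<^sub>E A \<Longrightarrow> y \<in> carrier G \<rightarrow>\<^sub>E A \<Longrightarrow>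
      (\<And>k. k \<in> D c \<Longrightarrow> k \<in> carrier G \<Longrightarrow> x k = y k) \<Longrightarrow> R c x \<Longrightarrow> R c y"
    and fin: "\<And>V E. finite V \<Longrightarrow> V \<subseteq> U \<Longrightarrow> finite E \<Longrightarrow> E \<subseteq> carrier G \<Longrightarrow>
      \<exists>x\<in>carrier G \<rightarrow>\<^sub>E A. (\<forall>u\<in>E. \<forall>q\<in>Q. \<not> matches q u S x) \<and> (\<forall>c\<in>V. R c x)"
    and Q: "\<And>q. q \<in> Q \<Longrightarrow> finite (dom q)"
    and S: "S \<subseteq> carrier G"
  shows "\<exists>x\<in>carrier G \<rightarrow>\<^sub>E A. valid Q S x \<and> (\<forall>c\<in>U. R c x)"
proof -
  let ?U = "Inl ` (Q \<times> carrier G) \<union> Inr ` U"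
  let ?D = "\<lambda>c. case c of Inl (q, u) \<Rightarrow> (\<lambda>k. u \<otimes> k) ` dom q | Inr c \<Rightarrow> D c"
  let ?R = "\<lambda>c x. case c of Inl (q, u) \<Rightarrow> \<not> matches q u S x | Inr c \<Rightarrow> R c x"
  have "\<exists>x\<in>carrier G \<rightarrow>\<^sub>E A. \<forall>c\<in>?U. ?R c x"
  proof (rule compact_constraints[where D = ?D])
    fix c x y assume *: "c \<in> ?U" "x \<in> carrier G \<rightarrow>\<^sub>E A" "y \<in> carrier G \<rightarrow>\<^sub>E A"
        "\<And>k. k \<in> ?D c \<Longrightarrow> k \<in> carrier G \<Longrightarrow> x k = y k" "?R c x"
    show "?R c y"
    proof (cases c)
      case (Inl p)
      then obtain q u where "c = Inl (q, u)" by (cases p) auto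
      moreover from this have "x (u \<otimes> k) = y (u \<otimes> k)" if "k \<in> dom q" "u \<otimes> k \<in> S" for k
        using *(4)[of "u \<otimes> k"] that S by (simp add: subsetD)
      ultimately show ?thesis using * by (auto simp: matches_def)
    next
      case (Inr d)
      with * dep[of d x y] show ?thesis by auto
    qed
  next
    fix V assume V: "finite V" "V \<subseteq> ?U"
    let ?E = "snd ` (Inl -` V)"
    have "finite (Inl -` V)" "finite (Inr -` V)" using V by (auto intro: finite_vimageI)
    moreover have sub: "?E \<subseteq> carrier G" "Inr -` V \<subseteq> U" using V(2) by auto
    ultimately have "\<exists>x\<in>carrier G \<rightarrow>\<^sub>E A. (\<forall>u\<in>?E. \<forall>q\<in>Q. \<not> matches q u S x) \<and> (\<forall>c\<in>Inr -` V. R c x)"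
      by (intro fin finite_imageI)
    then obtain x where x: "x \<in> carrier G \<rightarrow>\<^sub>E A" "\<forall>u\<in>?E. \<forall>q\<in>Q. \<not> matches q u S x" "\<forall>c\<in>Inr -` V. R c x"
      by (elim bexE conjE) (rule that)
    have "?R c x" if "c \<in> V" for c
    proof (cases c)
      case (Inl p)
      then obtain q u where c: "c = Inl (q, u)" by (cases p) auto
      then have "u \<in> ?E" "q \<in> Q" using that V by force+
      then show ?thesis using x(2)[rule_format, of u q] c by simp
    next
      case (Inr d)
      then show ?thesis using x(3) that by auto
    qed
    with x(1) show "\<exists>x\<in>carrier G \<rightarrow>\<^sub>E A. \<forall>c\<in>V. ?R c x" by blast
  qed (use D Q finite_A in auto)
  then obtain x where x: "x \<in> carrier G \<rightarrow>\<^sub>E A" "\<forall>c\<in>?U. ?R c x" by blast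
  show ?thesis
  proof (intro bexI[OF _ x(1)] conjI ballI)
    show "valid Q S x"
      unfolding valid_def using x(2)[rule_format, OF UnI1, OF imageI, of "(_, _)"] by auto
    show "R c x" if "c \<in> U" for c
      using x(2)[rule_format, of "Inr c"] that by auto
  qed
qed

lemma extends_finite:
  assumes S: "S \<subseteq> carrier G" and x: "x \<in> carrier G \<rightarrow>\<^sub>E A"
    and fin: "\<And>K. finite K \<Longrightarrow> K \<subseteq> S \<Longrightarrow> extends K x"
  shows "extends S x"
proof -
  have "\<exists>y\<in>carrier G \<rightarrow>\<^sub>E A. valid F (carrier G) y \<and> (\<forall>k\<in>S. y k = x k)"
  proof (rule X_constraints[where D = "\<lambda>k. {k}"])
    fix V E assume "finite V" "V \<subseteq> S" and E: "E \<subseteq> carrier G"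
    then obtain y where y: "y \<in> X" "\<forall>k\<in>V. y k = x k" using fin[of V] by (auto simp: extends_def)
    then show "\<exists>y\<in>carrier G \<rightarrow>\<^sub>E A. (\<forall>u\<in>E. \<forall>q\<in>F. \<not> matches q u (carrier G) y) \<and> (\<forall>k\<in>V. y k = x k)"
      using E by (intro bexI[of _ y]) (auto simp: X_iff valid_def)
  qed (use S F_pattern in \<open>auto simp: is_pattern_def\<close>)
  then show ?thesis by (auto simp: extends_def X_iff)
qed

lemma not_occurs_matches:
  assumes "\<not> occurs_in G q X" "x \<in> X" "u \<in> carrier G"
  shows "\<not> matches q u S x"
  using assms unfolding occurs_in_def occurs_in_point_def matches_def by blast

definition non_language :: "'a set \<Rightarrow> ('a \<rightharpoonup> 'c) set" where
  "non_language W = {q. dom q \<subseteq> W \<and> ran q \<subseteq> A \<and> \<not> occurs_in G q X}"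

text \<open>What \<open>x\<close> shows on the part of g W inside \<open>S\<close> is a pattern on a
  subset of \<open>W\<close>. As it is not in the non-language, it occurs in \<open>X\<close>, and a
  shift moves that occurrence to the identity.\<close>

lemma valid_window:
  assumes W: "W \<subseteq> carrier G" and x: "x \<in> carrier G \<rightarrow>\<^sub>E A" and S: "S \<subseteq> carrier G"
    and v: "valid (non_language W) S x" and g: "g \<in> carrier G"
  shows "\<exists>y\<in>X. \<forall>k\<in>W. g \<otimes> k \<in> S \<longrightarrow> y k = x (g \<otimes> k)"
proof -
  define q where "q = (\<lambda>k. if k \<in> W \<and> g \<otimes> k \<in> S then Some (x (g \<otimes> k)) else None)"
  have dom: "dom q = {k \<in> W. g \<otimes> k \<in> S}" by (auto simp: q_def dom_def)
  have "matches q g S x" unfolding matches_def dom by (simp add: q_def)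
  then have "q \<notin> non_language W" using v g by (auto simp: valid_def)
  moreover have "ran q \<subseteq> A" using x S by (auto simp: q_def ran_def PiE_iff)
  ultimately have "occurs_in G q X" using dom by (auto simp: non_language_def)
  then obtain z u where z: "z \<in> X" "u \<in> carrier G" "\<forall>k\<in>dom q. Some (z (u \<otimes> k)) = q k"
    by (auto simp: occurs_in_def occurs_in_point_def)
  show ?thesis
  proof (intro bexI[of _ "shift G (inv u) z"] ballI impI)
    show "shift G (inv u) z \<in> X" using z X_shift by simp
    fix k assume k: "k \<in> W" "g \<otimes> k \<in> S"
    then have "Some (z (u \<otimes> k)) = Some (x (g \<otimes> k))" using z(3) dom by (auto simp: q_def)
    then show "shift G (inv u) z k = x (g \<otimes> k)" using k W z(2) by (auto simp: shift_apply)
  qed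
qed

lemma before_Max:
  assumes "finite K" "K \<noteq> {}" "K \<subseteq> carrier G"
  shows "\<exists>g\<in>K. K \<subseteq> insert g (before g)"
  using wf_max_exists[OF wf_prec trans_prec total_prec[of n], of K] assms H_n
  by (auto simp: before_def)

lemma before_trans: "g' \<in> before g \<Longrightarrow> before g' \<subseteq> before g"
  using trans_prec by (auto simp: before_def elim: transE)

lemma extends_before:
  assumes W: "W \<subseteq> carrier G" "\<one> \<in> W" and det: "\<And>g. g \<in> carrier G \<Longrightarrow> determines A X (W \<inter> past g) (past g)"
    and ne: "X \<noteq> {}" and x: "x \<in> carrier G \<rightarrow>\<^sub>E A" and g: "g \<in> carrier G"
    and v: "valid (non_language W) (before g) x"
  shows "extends (before g) x"
  using wf_prec[of n] g v
proof (induction g)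
  case (less g)
  show ?case
  proof (rule extends_finite[OF _ x])
    fix K assume K: "finite K" "K \<subseteq> before g"
    show "extends K x"
    proof (cases "K = {}")
      case True
      then show ?thesis using ne by (auto simp: extends_def)
    next
      case False
      have "K \<subseteq> carrier G" using K by (auto simp: before_def)
      from before_Max[OF K(1) False this] obtain g' where g': "g' \<in> K" "K \<subseteq> insert g' (before g')" by blast
      have g'b: "g' \<in> before g" "g' \<in> carrier G" "(g', g) \<in> prec n" using g' K by (auto simp: before_def)
      have sub: "insert g' (before g') \<subseteq> before g" using before_trans g'b by auto
      have "extends (before g') x"
        by (rule less.IH[OF g'b(3,2)]) (rule valid_mono[OF less.prems(2)], use sub in auto)
      then obtain y where y: "y \<in> X" "\<And>k. k \<in> before g' \<Longrightarrow> y k = x k" by (auto simp: extends_def)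
      have "before g \<subseteq> carrier G" by (auto simp: before_def)
      from valid_window[OF W(1) x this less.prems(2) g'b(2)]
      obtain z where z: "z \<in> X" "\<And>k. k \<in> W \<Longrightarrow> g' \<otimes> k \<in> before g \<Longrightarrow> z k = x (g' \<otimes> k)" by blast
      let ?y = "shift G (inv g') y"
      have yk: "?y k = x (g' \<otimes> k)" if "k \<in> past g'" for k
      proof -
        have "k \<in> carrier G" using that past_carrier by blast
        then show ?thesis
          using that y(2)[of "g' \<otimes> k"] before_past[OF g'b(2), of k] g'b(2) by (simp add: shift_apply)
      qed
      have "\<forall>k\<in>W \<inter> past g'. z k = ?y k"
        using z(2) yk before_past[OF g'b(2)] sub W(1) by (metis IntE insertI2 subsetD)
      \<comment> \<open>Since W contains the identity, the window also shows the letter at g'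
        itself.\<close>
      moreover have "z \<one> = x g'" using z(2)[OF W(2)] g'b by simp
      ultimately have "\<exists>y'\<in>X. (\<forall>k\<in>past g'. y' k = ?y k) \<and> y' \<one> = x g'"
        using det[OF g'b(2), unfolded determines_def, rule_format, of ?y "x g'"] z(1) X_shift y(1) g'b(2) x
        by (auto simp: PiE_iff)
      then obtain y' where y': "y' \<in> X" "\<And>k. k \<in> past g' \<Longrightarrow> y' k = x (g' \<otimes> k)" "y' \<one> = x g'"
        using yk by auto
      have "shift G g' y' k = x k" if "k \<in> K" for k
      proof (cases "k = g'")
        case True
        then show ?thesis using g'b y'(3) by (simp add: shift_apply)
      next
        case False
        then have k: "k \<in> before g'" "k \<in> carrier G" using that g' by (auto simp: before_def)
        then have "inv g' \<otimes> k \<in> past g'" using past_before g'b by blast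
        then show ?thesis using y'(2) k g'b by (simp add: shift_apply inv_cancel)
      qed
      then show ?thesis using X_shift[OF y'(1) g'b(2)] by (auto simp: extends_def)
    qed
  qed (auto simp: before_def)
qed

text \<open>A finite part of \<open>C\<close> lies in some past inside \<open>C\<close>; a shift by
  g turns that past into \<open>before g\<close>, where the result for predecessor sets
  applies.\<close>

lemma extends_limit:
  assumes W: "W \<subseteq> carrier G" "\<one> \<in> W" and det: "\<And>g. g \<in> carrier G \<Longrightarrow> determines A X (W \<inter> past g) (past g)"
    and ne: "X \<noteq> {}" and x: "x \<in> carrier G \<rightarrow>\<^sub>E A" and C: "C \<subseteq> carrier G"
    and lim: "\<And>K. finite K \<Longrightarrow> K \<subseteq> C \<Longrightarrow> \<exists>g\<in>carrier G. past g \<subseteq> C \<and> K \<subseteq> past g"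
    and v: "valid (non_language W) C x"
  shows "extends C x"
proof (rule extends_finite[OF C x])
  fix K assume K: "finite K" "K \<subseteq> C"
  from lim[OF this] obtain g where g: "g \<in> carrier G" "past g \<subseteq> C" "K \<subseteq> past g" by blast
  have "valid (non_language W) (before g) (shift G g x)"
    unfolding valid_def
  proof (intro ballI notI)
    fix q u assume q: "q \<in> non_language W" and u: "u \<in> carrier G"
        and m: "matches q u (before g) (shift G g x)"
    have "dom q \<subseteq> carrier G" using q W by (auto simp: non_language_def)
    from matches_shift[OF g(1) u this _ m, of C] past_before[OF g(1)] g(2)
    have "matches q (inv g \<otimes> u) C x" by blast
    then show False using v q u g by (simp add: valid_def)
  qed
  then have "extends (before g) (shift G g x)"
    by (intro extends_before[OF W det ne shift_PiE[OF x g(1)] g(1)])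
  then obtain y where y: "y \<in> X" "\<And>k. k \<in> before g \<Longrightarrow> y k = shift G g x k" by (auto simp: extends_def)
  have "shift G (inv g) y k = x k" if "k \<in> K" for k
  proof -
    have k: "k \<in> past g" "k \<in> carrier G" using that g past_carrier by auto
    then have "y (g \<otimes> k) = x k" using y(2)[of "g \<otimes> k"] before_past[OF g(1)] g(1)
        by (simp add: shift_apply inv_cancel)
    then show ?thesis using k g by (simp add: shift_apply)
  qed
  moreover have "shift G (inv g) y \<in> X" using X_shift[OF y(1)] g(1) by simp
  ultimately show "extends K x" unfolding extends_def by blast
qed

lemma fresh_point:
  assumes y: "y \<in> X" "\<And>k. k \<in> C \<Longrightarrow> y k = x k" and Q: "\<And>q. q \<in> Q \<Longrightarrow> \<not> occurs_in G q X \<and> dom q \<subseteq> carrier G"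
  shows "fresh Q C x (y \<one>)"
  unfolding fresh_def
proof (intro ballI notI)
  fix q k assume q: "q \<in> Q" "k \<in> dom q" and m: "matches q (inv k) (insert \<one> C) (x(\<one> := y \<one>))"
  have "matches q (inv k) (insert \<one> C) y"
    using m y(2) unfolding matches_def by (metis fun_upd_apply insertE)
  moreover have "k \<in> carrier G" using q Q by blast
  ultimately show False using not_occurs_matches[of q y "inv k"] Q[OF q(1)] y(1) by simp
qed

lemma fresh_antimono: "fresh Q T x a \<Longrightarrow> S \<subseteq> T \<Longrightarrow> fresh Q S x a"
  unfolding fresh_def using matches_mono by (metis insert_mono)

text \<open>If no finite E worked for a limit C, compactness would give an x that avoids
  \<open>Q\<close> on all of C and admits no letter. But such an x extends from C to a point of
  \<open>X\<close>, whose letter at the identity is fresh.\<close>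

lemma uniform_fresh:
  assumes avo: "\<And>C. inductive_interval G n H h C \<Longrightarrow> avo G A X C" and ne: "X \<noteq> {}"
    and W: "W \<subseteq> carrier G" "\<one> \<in> W" and det: "\<And>g. g \<in> carrier G \<Longrightarrow> determines A X (W \<inter> past g) (past g)"
    and Q: "finite Q" "non_language W \<subseteq> Q"
        "\<And>q. q \<in> Q \<Longrightarrow> \<not> occurs_in G q X \<and> dom q \<subseteq> carrier G \<and> finite (dom q)"
  shows "\<exists>E. finite E \<and> E \<subseteq> carrier G \<and> (\<forall>g\<in>carrier G. admits_fresh Q A E (past g))"
proof (rule past_uniform)
  fix C assume "inductive_interval G n H h C"
    and lim: "\<And>K. finite K \<Longrightarrow> K \<subseteq> C \<Longrightarrow> \<exists>g\<in>carrier G. past g \<subseteq> C \<and> K \<subseteq> past g"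
  have C: "C \<subseteq> carrier G" using avo[OF \<open>inductive_interval G n H h C\<close>] by (auto simp: avo_def)
  have "\<exists>E. finite E \<and> E \<subseteq> carrier G \<and> admits_fresh Q A E C"
  proof (rule ccontr)
    assume no: "\<not> ?thesis"
    have "\<exists>x\<in>carrier G \<rightarrow>\<^sub>E A. valid Q C x \<and> (\<forall>c\<in>{()}. \<not> (\<exists>a\<in>A. fresh Q C x a))"
    \<comment> \<open>Freshness reads, apart from the identity, only the cells
      \<open>inv k \<otimes> k'\<close> with k and k' in the domain of the same pattern.\<close>
    proof (rule X_constraints[where D = "\<lambda>_. \<Union>q\<in>Q. \<Union>k\<in>dom q. (\<lambda>k'. inv k \<otimes> k') ` dom q"])
      fix x y :: "'a \<Rightarrow> 'c" assume *:
          "\<And>k. k \<in> (\<Union>q\<in>Q. \<Union>k\<in>dom q. (\<lambda>k'. inv k \<otimes> k') ` dom q) \<Longrightarrow> k \<in> carrier G \<Longrightarrow> x k = y k"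
        and nf: "\<not> (\<exists>a\<in>A. fresh Q C x a)"
      have "matches q (inv k) (insert \<one> C) (x(\<one> := a)) \<longleftrightarrow> matches q (inv k) (insert \<one> C) (y(\<one> := a))"
        if q: "q \<in> Q" "k \<in> dom q" for q k a
      proof -
        have "(x(\<one> := a)) (inv k \<otimes> k') = (y(\<one> := a)) (inv k \<otimes> k')" if k': "k' \<in> dom q" for k'
        proof -
          have "inv k \<otimes> k' \<in> carrier G" using q k' Q(3)[OF q(1)] by auto
          then have "x (inv k \<otimes> k') = y (inv k \<otimes> k')" using q k' by (intro *) auto
          then show ?thesis by simp
        qed
        then show ?thesis by (simp add: matches_def)
      qed
      then show "\<not> (\<exists>a\<in>A. fresh Q C y a)" using nf by (simp add: fresh_def)
    next
      fix V E assume "finite E" "E \<subseteq> carrier G"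
      with no have "\<not> admits_fresh Q A E C" by blast
      then show "\<exists>x\<in>carrier G \<rightarrow>\<^sub>E A. (\<forall>u\<in>E. \<forall>q\<in>Q. \<not> matches q u C x) \<and> (\<forall>c\<in>V. \<not> (\<exists>a\<in>A. fresh Q C x a))"
        unfolding admits_fresh_def by blast
    qed (use Q C in auto)
    then obtain x where x: "x \<in> carrier G \<rightarrow>\<^sub>E A" "valid Q C x" "\<not> (\<exists>a\<in>A. fresh Q C x a)" by blast
    have "valid (non_language W) C x" using x(2) Q(2) by (auto simp: valid_def)
    from extends_limit[OF W det ne x(1) C lim this]
    obtain y where "y \<in> X" "\<forall>k\<in>C. y k = x k" by (auto simp: extends_def)
    with fresh_point[of y C x Q] Q(3) x(3) X_in_A[of y \<one>] show False by auto
  qed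
  then obtain E where E: "finite E" "E \<subseteq> carrier G" "admits_fresh Q A E C" by blast
  \<comment> \<open>The cells of C that occurrences at positions in E can use. Once a past inside C
    contains them, such an occurrence in C already lies in that past.\<close>
  let ?K = "C \<inter> (\<Union>q\<in>Q. \<Union>u\<in>E. (\<lambda>k. u \<otimes> k) ` dom q)"
  have "admits_fresh Q A E' (past g)" if "past g \<subseteq> C" "?K \<subseteq> past g" "E \<subseteq> E'" for g E'
    unfolding admits_fresh_def
  proof (intro ballI impI)
    fix x assume x: "x \<in> carrier G \<rightarrow>\<^sub>E A" "\<forall>u\<in>E'. \<forall>q\<in>Q. \<not> matches q u (past g) x"
    have "\<not> matches q u C x" if "u \<in> E" "q \<in> Q" for u q
    proof
      assume m: "matches q u C x"
      have "u \<otimes> k \<in> past g" if k: "k \<in> dom q" for k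
        using m \<open>?K \<subseteq> past g\<close> \<open>u \<in> E\<close> \<open>q \<in> Q\<close> k unfolding matches_def by blast
      then have "matches q u (past g) x" using m by (simp add: matches_def)
      then show False using x(2) that \<open>E \<subseteq> E'\<close> by blast
    qed
    then have "\<forall>u\<in>E. \<forall>q\<in>Q. \<not> matches q u C x" by simp
    with E(3)[unfolded admits_fresh_def, THEN bspec, OF x(1)]
    obtain a where "a \<in> A" "fresh Q C x a" by (elim impE bexE) simp_all
    with fresh_antimono[OF _ \<open>past g \<subseteq> C\<close>] show "\<exists>a\<in>A. fresh Q (past g) x a" by (intro bexI[of _ a])
  qed
  moreover have "finite ?K" using Q E by auto
  ultimately show "\<exists>K E. finite K \<and> K \<subseteq> C \<and> finite E \<and> E \<subseteq> carrier G \<and>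
      (\<forall>g\<in>carrier G. \<forall>E'. past g \<subseteq> C \<and> K \<subseteq> past g \<and> E \<subseteq> E' \<longrightarrow> admits_fresh Q A E' (past g))"
    using E by (intro exI[of _ ?K] exI[of _ E]) blast
qed

end

section \<open>Filling the group\<close>

context polycycle
begin

text \<open>Each element depends on finitely many smaller ones, so by well-founded induction the set
  of its iterated dependencies is finite.\<close>

lemma prec_closure:
  assumes D: "finite D" "D \<subseteq> carrier G" and V: "finite V" "V \<subseteq> carrier G"
  shows "\<exists>D'. finite D' \<and> D \<subseteq> D' \<and> D' \<subseteq> carrier G \<and> (\<forall>d\<in>D'. \<forall>v\<in>V. d \<otimes> v \<in> before d \<longrightarrow> d \<otimes> v \<in> D')"
proof -
  let ?closed = "\<lambda>D'. finite D' \<and> D' \<subseteq> carrier G \<and> (\<forall>d\<in>D'. \<forall>v\<in>V. d \<otimes> v \<in> before d \<longrightarrow> d \<otimes> v \<in> D')"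
  have union: "?closed (\<Union>d\<in>E. f d)" if "finite E" "\<And>d. d \<in> E \<Longrightarrow> ?closed (f d)" for E and f :: "'a \<Rightarrow> 'a set"
  proof (intro conjI ballI impI)
    show "finite (\<Union>d\<in>E. f d)" "(\<Union>d\<in>E. f d) \<subseteq> carrier G" using that by auto
    fix d v assume "d \<in> (\<Union>d\<in>E. f d)" "v \<in> V" "d \<otimes> v \<in> before d"
    moreover from this obtain e where "e \<in> E" "d \<in> f e" by blast
    ultimately show "d \<otimes> v \<in> (\<Union>d\<in>E. f d)" using that(2)[of e] by blast
  qed
  have single: "\<exists>D'. d \<in> D' \<and> ?closed D'" if "d \<in> carrier G" for d
    using wf_prec[of n] that
  proof (induction d)
    case (less d)
    let ?E = "(\<lambda>v. d \<otimes> v) ` V \<inter> before d"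
    have "\<exists>D'. e \<in> D' \<and> ?closed D'" if "e \<in> ?E" for e
      using less.IH[of e] that by (auto simp: before_def)
    then obtain f where f: "\<And>e. e \<in> ?E \<Longrightarrow> e \<in> f e \<and> ?closed (f e)" by metis
    have U: "?closed (\<Union>e\<in>?E. f e)" by (rule union) (use V f in auto)
    have sub: "?E \<subseteq> (\<Union>e\<in>?E. f e)" using f by blast
    show ?case
    proof (intro exI[of _ "insert d (\<Union>e\<in>?E. f e)"] conjI ballI impI)
      show "finite (insert d (\<Union>e\<in>?E. f e))" "insert d (\<Union>e\<in>?E. f e) \<subseteq> carrier G"
        using U less.prems by auto
      fix x v assume x: "x \<in> insert d (\<Union>e\<in>?E. f e)" "v \<in> V" "x \<otimes> v \<in> before x"
      show "x \<otimes> v \<in> insert d (\<Union>e\<in>?E. f e)"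
      proof (cases "x = d")
        case True
        then have "x \<otimes> v \<in> ?E" using x(2,3) by simp
        then show ?thesis using sub by (metis insertI2 subsetD)
      next
        case False
        then have "x \<in> (\<Union>e\<in>?E. f e)" using x(1) by simp
        then show ?thesis using U x(2,3) by (metis insertI2)
      qed
    qed simp
  qed
  then obtain f where f: "\<And>d. d \<in> D \<Longrightarrow> d \<in> f d \<and> ?closed (f d)" using subsetD[OF D(2)] by metis
  have "?closed (\<Union>d\<in>D. f d)" by (rule union) (use D f in auto)
  moreover have "D \<subseteq> (\<Union>d\<in>D. f d)" using f by blast
  ultimately show ?thesis by (intro exI[of _ "\<Union>d\<in>D. f d"] conjI) (elim conjE, assumption)+
qed

end

context sft
begin

text \<open>Filling \<open>G\<close> along the well-order \<open>prec n\<close>: every forbidden occurrence is completed at its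
  largest element, so it suffices that no single step completes one.\<close>

lemma fill:
  assumes A: "A \<noteq> {}"
    and Q: "F \<subseteq> Q" "\<And>q. q \<in> Q \<Longrightarrow> dom q \<subseteq> carrier G \<and> finite (dom q) \<and> dom q \<noteq> {}"
    and E: "E \<subseteq> carrier G" and adm: "\<And>g. g \<in> carrier G \<Longrightarrow> admits_fresh Q A E (past g)"
    and p: "ran p \<subseteq> A" "dom p \<subseteq> carrier G"
    and closed: "\<And>d q k k'. d \<in> dom p \<Longrightarrow> q \<in> Q \<Longrightarrow> k \<in> dom q \<Longrightarrow> k' \<in> dom q \<Longrightarrow>
      d \<otimes> (inv k \<otimes> k') \<in> before d \<Longrightarrow> d \<otimes> (inv k \<otimes> k') \<in> dom p"
    and free: "\<And>d q k. d \<in> dom p \<Longrightarrow> q \<in> Q \<Longrightarrow> k \<in> dom q \<Longrightarrow> \<exists>k'\<in>dom q. p (d \<otimes> (inv k \<otimes> k')) \<noteq> q k'"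
  shows "\<exists>x\<in>X. \<forall>d\<in>dom p. p d = Some (x d)"
proof -
  \<comment> \<open>Nothing is required outside the group, so that the recursion can run over the
    whole type.\<close>
  define P where "P f g a \<longleftrightarrow> (g \<in> carrier G \<longrightarrow> a \<in> A \<and> (\<forall>d. p g = Some d \<longrightarrow> a = d) \<and>
    fresh Q (past g) (\<lambda>k. f (g \<otimes> k)) a)" for f :: "'a \<Rightarrow> 'c" and g a
  have fresh_cong: "fresh Q (past g) x a \<longleftrightarrow> fresh Q (past g) y a" if "\<And>k. k \<in> past g \<Longrightarrow> x k = y k" for x y g a
  proof -
    have "(x(\<one> := a)) k = (y(\<one> := a)) k" if "k \<in> insert \<one> (past g)" for k
        using that \<open>\<And>k. k \<in> past g \<Longrightarrow> x k = y k\<close> by auto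
    then have "matches q u (insert \<one> (past g)) (x(\<one> := a)) \<longleftrightarrow> matches q u (insert \<one> (past g)) (y(\<one> := a))"
        for q u
      unfolding matches_def by (metis (no_types, lifting))
    then show ?thesis unfolding fresh_def by simp
  qed
  \<comment> \<open>Every placed pattern is charged to its largest cell g; seen from g, its other
    cells lie in \<open>past g\<close>.\<close>
  have completed: "\<exists>g\<in>carrier G. \<exists>k\<in>dom q. g = u \<otimes> k \<and> (\<forall>k'\<in>dom q. inv k \<otimes> k' \<in> insert \<one> (past g) \<and>
      g \<otimes> (inv k \<otimes> k') = u \<otimes> k')"
    if q: "q \<in> Q" and u: "u \<in> carrier G" for q u
  proof -
    have "finite ((\<lambda>k. u \<otimes> k) ` dom q)" "(\<lambda>k. u \<otimes> k) ` dom q \<noteq> {}" "(\<lambda>k. u \<otimes> k) ` dom q \<subseteq> carrier G"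
        using Q(2)[OF q] u by auto
    from before_Max[OF this] obtain k
        where k: "k \<in> dom q" "(\<lambda>k. u \<otimes> k) ` dom q \<subseteq> insert (u \<otimes> k) (before (u \<otimes> k))" by blast
    have kc: "k \<in> carrier G" using k Q(2)[OF q] by blast
    have "inv k \<otimes> k' \<in> insert \<one> (past (u \<otimes> k)) \<and> u \<otimes> k \<otimes> (inv k \<otimes> k') = u \<otimes> k'" if k': "k' \<in> dom q" for k'
    proof -
      have k'c: "k' \<in> carrier G" using k' Q(2)[OF q] by blast
      have eq: "u \<otimes> k \<otimes> (inv k \<otimes> k') = u \<otimes> k'" using u kc k'c by (simp add: m_assoc inv_cancel)
      have "u \<otimes> k' = u \<otimes> k \<or> u \<otimes> k' \<in> before (u \<otimes> k)" using k(2) k' by blast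
      then show ?thesis
      proof
        assume "u \<otimes> k' = u \<otimes> k"
        then have "k' = k" using u kc k'c by simp
        then show ?thesis using kc eq by simp
      next
        assume "u \<otimes> k' \<in> before (u \<otimes> k)"
        then have "inv k \<otimes> k' \<in> past (u \<otimes> k)" using before_past[of "u \<otimes> k" "inv k \<otimes> k'"] eq u kc k'c by simp
        then show ?thesis using eq by simp
      qed
    qed
    then show ?thesis using k(1) kc u by (intro bexI[of _ "u \<otimes> k"] bexI[of _ k]) auto
  qed
  have "\<exists>f. \<forall>g. P f g (f g)"
  proof (rule dependent_wf_choice[OF wf_prec[of n]])
    fix f f' :: "'a \<Rightarrow> 'c" and g a assume *: "\<And>z. (z, g) \<in> prec n \<Longrightarrow> f z = f' z"
    have "fresh Q (past g) (\<lambda>k. f (g \<otimes> k)) a \<longleftrightarrow> fresh Q (past g) (\<lambda>k. f' (g \<otimes> k)) a"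
      by (rule fresh_cong) (use * in \<open>auto simp: past_def\<close>)
    then show "P f g a = P f' g a" by (simp add: P_def)
  next
    fix g f assume "\<And>y. (y, g) \<in> prec n \<Longrightarrow> P f y (f y)"
    then have IH: "f y \<in> A \<and> (\<forall>d. p y = Some d \<longrightarrow> f y = d) \<and> fresh Q (past y) (\<lambda>k. f (y \<otimes> k)) (f y)"
        if "y \<in> before g" for y
      using that by (auto simp: P_def before_def)
    show "\<exists>a. P f g a"
    proof (cases "g \<in> carrier G")
      case False
      then show ?thesis by (simp add: P_def)
    next
      case g: True
      show ?thesis
      proof (cases "p g")
        case (Some a)
        \<comment> \<open>A prescribed letter is fresh: the other cells of an occurrence completed
          at g precede g, hence lie in \<open>dom p\<close> by closedness, and the occurrence would
          sit inside \<open>p\<close>.\<close>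
        have "fresh Q (past g) (\<lambda>k. f (g \<otimes> k)) a"
          unfolding fresh_def
        proof (intro ballI notI)
          fix q k assume q: "q \<in> Q" and k: "k \<in> dom q"
              and m: "matches q (inv k) (insert \<one> (past g)) ((\<lambda>k. f (g \<otimes> k))(\<one> := a))"
          from free[of g q k] Some q k obtain k' where k': "k' \<in> dom q" "p (g \<otimes> (inv k \<otimes> k')) \<noteq> q k'" by blast
          have c: "inv k \<otimes> k' \<in> carrier G" using k k' Q(2)[OF q] by auto
          from m k'(1) have in_past: "inv k \<otimes> k' \<in> insert \<one> (past g)"
            and val: "Some (((\<lambda>k. f (g \<otimes> k))(\<one> := a)) (inv k \<otimes> k')) = q k'"
                by (simp_all add: matches_def del: fun_upd_apply)
          show False
          proof (cases "inv k \<otimes> k' = \<one>")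
            case True
            then show False using k' val Some g by simp
          next
            case False
            then have b: "g \<otimes> (inv k \<otimes> k') \<in> before g" using in_past before_past[OF g c] by simp
            then have "g \<otimes> (inv k \<otimes> k') \<in> dom p" using closed[of g q k k'] Some q k k' by blast
            then have "p (g \<otimes> (inv k \<otimes> k')) = Some (f (g \<otimes> (inv k \<otimes> k')))" using IH[OF b] by auto
            then show False using k' val False by simp
          qed
        qed
        moreover have "a \<in> A" using p(1) Some by (auto simp: ran_def)
        ultimately show ?thesis using Some by (intro exI[of _ a]) (simp add: P_def)
      next
        case None
        obtain a0 where a0: "a0 \<in> A" using A by blast
        \<comment> \<open>The letters chosen before g, seen from g. The filler a0 only makes x
          total, since the conditions read x within \<open>past g\<close>.\<close>
        define x where "x = (\<lambda>k\<in>carrier G. if k \<in> past g then f (g \<otimes> k) else a0)"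
        have x: "x \<in> carrier G \<rightarrow>\<^sub>E A" using IH before_past[OF g] a0 by (auto simp: x_def)
        \<comment> \<open>The occurrence would have been completed at some earlier cell, against
          freshness of the letter chosen there.\<close>
        have "\<not> matches q u (past g) x" if u: "u \<in> E" and q: "q \<in> Q" for u q
        proof
          assume m: "matches q u (past g) x"
          have uc: "u \<in> carrier G" using u E by blast
          from completed[OF q, of "g \<otimes> u"] g uc obtain k where k: "k \<in> dom q"
            and c: "\<And>k'. k' \<in> dom q \<Longrightarrow> inv k \<otimes> k' \<in> insert \<one> (past (g \<otimes> u \<otimes> k))"
              "\<And>k'. k' \<in> dom q \<Longrightarrow> g \<otimes> u \<otimes> k \<otimes> (inv k \<otimes> k') = g \<otimes> u \<otimes> k'" by auto
          have kc: "k' \<in> carrier G" if "k' \<in> dom q" for k' using that Q(2)[OF q] by blast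
          have val: "u \<otimes> k' \<in> past g" "Some (f (g \<otimes> u \<otimes> k')) = q k'" if k': "k' \<in> dom q" for k'
            using m[unfolded matches_def, rule_format, OF k'] kc[OF k'] uc g by (auto simp: x_def m_assoc)
          have b: "g \<otimes> u \<otimes> k \<in> before g" using val(1)[OF k] before_past[OF g, of "u \<otimes> k"] uc kc[OF k] g
              by (simp add: m_assoc)
          let ?y = "g \<otimes> u \<otimes> k"
          have "matches q (inv k) (insert \<one> (past ?y)) ((\<lambda>k. f (?y \<otimes> k))(\<one> := f ?y))"
            unfolding matches_def
          proof
            fix k' assume k': "k' \<in> dom q"
            have "((\<lambda>k. f (?y \<otimes> k))(\<one> := f ?y)) (inv k \<otimes> k') = f (?y \<otimes> (inv k \<otimes> k'))"
              using g uc kc[OF k] by simp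
            then show "inv k \<otimes> k' \<in> insert \<one> (past ?y) \<and>
                Some (((\<lambda>k. f (?y \<otimes> k))(\<one> := f ?y)) (inv k \<otimes> k')) = q k'"
              using c[OF k'] val(2)[OF k'] by simp
          qed
          then show False using IH[OF b] q k by (simp add: fresh_def)
        qed
        with adm[OF g] x obtain a where a: "a \<in> A" "fresh Q (past g) x a"
          unfolding admits_fresh_def by (elim ballE[of _ _ x] impE bexE) auto
        have "fresh Q (past g) (\<lambda>k. f (g \<otimes> k)) a \<longleftrightarrow> fresh Q (past g) x a"
          by (rule fresh_cong) (use past_carrier in \<open>auto simp: x_def\<close>)
        then show ?thesis using a None by (intro exI[of _ a]) (simp add: P_def)
      qed
    qed
  qed
  then obtain f where f:
      "\<And>g. g \<in> carrier G \<Longrightarrow> f g \<in> A \<and> (\<forall>d. p g = Some d \<longrightarrow> f g = d) \<and> fresh Q (past g) (\<lambda>k. f (g \<otimes> k)) (f g)"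
    by (auto simp: P_def)
  have "\<not> matches q u (carrier G) (restrict f (carrier G))" if q: "q \<in> F" and u: "u \<in> carrier G" for q u
  proof
    assume m: "matches q u (carrier G) (restrict f (carrier G))"
    have qQ: "q \<in> Q" using q Q by blast
    from completed[OF qQ u] obtain k where k: "k \<in> dom q" "u \<otimes> k \<in> carrier G"
        and c: "\<And>k'. k' \<in> dom q \<Longrightarrow> inv k \<otimes> k' \<in> insert \<one> (past (u \<otimes> k))"
          "\<And>k'. k' \<in> dom q \<Longrightarrow> u \<otimes> k \<otimes> (inv k \<otimes> k') = u \<otimes> k'" by auto
    let ?y = "u \<otimes> k"
    have "matches q (inv k) (insert \<one> (past ?y)) ((\<lambda>k. f (?y \<otimes> k))(\<one> := f ?y))"
      unfolding matches_def
    proof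
      fix k' assume k': "k' \<in> dom q"
      have "((\<lambda>k. f (?y \<otimes> k))(\<one> := f ?y)) (inv k \<otimes> k') = f (u \<otimes> k')"
        using k(2) c(2)[OF k'] by auto
      moreover have "Some (f (u \<otimes> k')) = q k'" using m[unfolded matches_def, rule_format, OF k'] by auto
      ultimately show "inv k \<otimes> k' \<in> insert \<one> (past ?y) \<and>
          Some (((\<lambda>k. f (?y \<otimes> k))(\<one> := f ?y)) (inv k \<otimes> k')) = q k'"
        using c(1)[OF k'] by simp
    qed
    then show False using f[OF k(2)] qQ k(1) by (simp add: fresh_def)
  qed
  then have "restrict f (carrier G) \<in> X" using f by (auto simp: X_iff valid_def)
  moreover have "p d = Some (restrict f (carrier G) d)" if "d \<in> dom p" for d
    using that p(2) f[of d] by auto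
  ultimately show ?thesis by blast
qed

end

section \<open>Certificates\<close>

type_synonym code_pattern = "(word \<times> nat) list"

definition assigns :: "nat \<Rightarrow> word list \<Rightarrow> code_pattern list" where
  "assigns N D = foldr (\<lambda>k xs. concat (map (\<lambda>x. map (\<lambda>a. (k, a) # x) [0..<N]) xs)) D [[]]"

lemma set_assigns: "x \<in> set (assigns N D) \<longleftrightarrow> map fst x = D \<and> (\<forall>(d, a)\<in>set x. a < N)"
proof (induction D arbitrary: x)
  case Nil
  then show ?case by (auto simp: assigns_def)
next
  case (Cons k D)
  have "set (assigns N (k # D)) = {(k, a) # x | a x. a < N \<and> x \<in> set (assigns N D)}"
    by (auto simp: assigns_def)
  then show ?case using Cons by (cases x) fastforce+
qed

lemma decidable_comp3:
  assumes "decidable (\<lambda>x. P (fst x) (fst (snd x)) (snd (snd x)))" "computable f" "computable g" "computable k"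
  shows "decidable (\<lambda>x. P (f x) (g x) (k x))"
  using decidable_comp[OF assms(1), of "\<lambda>x. (f x, g x, k x)"] assms(2-) by (simp add: computable_Pair)

type_synonym absence_data = "word list \<times> word list"
type_synonym presence_data = "code_pattern list \<times> (word list \<times> word list \<times> nat) \<times> code_pattern"

context polycycle
begin

definition matches_word :: "code_pattern \<Rightarrow> word \<Rightarrow> code_pattern \<Rightarrow> bool" where
  "matches_word q u x \<longleftrightarrow> (\<forall>(k, a)\<in>set q. \<exists>(d, b)\<in>set x. same_word d (u @ k) \<and> a = b)"

definition functional :: "nat \<Rightarrow> code_pattern \<Rightarrow> bool" where
  "functional N q \<longleftrightarrow> (\<forall>(k, a)\<in>set q. a < N \<and> (\<forall>(k', a')\<in>set q. same_word k k' \<longrightarrow> a = a'))"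

text \<open>What compactness leaves of non-occurrence: a finite window D around the pattern and
  finitely many positions E such that every filling of D that shows P is refuted at a position in E.
  D may name an element twice; such a list only adds assignments to be checked.\<close>

definition absence_cert :: "nat \<Rightarrow> code_pattern list \<Rightarrow> code_pattern \<Rightarrow> absence_data \<Rightarrow> bool" where
  "absence_cert N F P c \<longleftrightarrow> (case c of (D, E) \<Rightarrow>
     (\<forall>(k, a)\<in>set P. \<exists>d\<in>set D. same_word d k) \<and>
     (\<forall>x\<in>set (assigns N D). matches_word P [] x \<longrightarrow> (\<exists>u\<in>set E. \<exists>q\<in>set F. matches_word q u x)))"

text \<open>The inserted 0 keeps the maximum meaningful for n = 0, the trivial group.\<close>

definition max_period :: nat where
  "max_period = Max (insert 0 (factor_order G H h ` {1..n}))"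

text \<open>\<open>Q\<close> forbids so many patterns that no partial configuration on a past gets stuck;
  \<open>K\<close>, \<open>E\<close> and \<open>m\<close> reduce this to finitely many partial configurations.\<close>

definition fill_cert :: "nat \<Rightarrow> code_pattern list \<Rightarrow> word list \<times> word list \<times> nat \<Rightarrow> bool" where
  "fill_cert N Q c \<longleftrightarrow> (case c of (K, E, m) \<Rightarrow> 0 < N \<and> max_period < m \<and>
     (\<forall>w\<in>set K. \<forall>t\<in>set (coord_word n w). Suc (nat t + nat (- t)) < m) \<and>
     (\<forall>q\<in>set Q. q \<noteq> [] \<and> functional N q) \<and>
     (\<forall>q\<in>set Q. \<forall>(k, a)\<in>set q. \<forall>(k', a')\<in>set q. \<exists>d\<in>set K. same_word d (inv_word k @ k')) \<and>
     (\<forall>g\<in>set (cover m n). \<forall>x\<in>set (assigns N (filter (\<lambda>k. prec_word n (g @ k) g) K)).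
       (\<exists>u\<in>set E. \<exists>q\<in>set Q. matches_word q u x) \<or>
       (\<exists>a\<in>set [0..<N]. \<not> (\<exists>q\<in>set Q. \<exists>(k, b)\<in>set q. matches_word q (inv_word k) (([], a) # x)))))"

text \<open>\<open>p\<close> is a finite piece of a configuration that the filling process determines on its own.\<close>

definition start_cert :: "nat \<Rightarrow> code_pattern list \<Rightarrow> code_pattern \<Rightarrow> code_pattern \<Rightarrow> bool" where
  "start_cert N Q P p \<longleftrightarrow> functional N p \<and> matches_word P [] p \<and>
     (\<forall>(d, a)\<in>set p. \<forall>q\<in>set Q. \<forall>(k, b)\<in>set q. \<not> matches_word q (d @ inv_word k) p \<and>
       (\<forall>(k', b')\<in>set q. prec_word n (d @ (inv_word k @ k')) d \<longrightarrow>
         (\<exists>(d', a')\<in>set p. same_word d' (d @ (inv_word k @ k')))))"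

definition presence_cert :: "nat \<Rightarrow> code_pattern list \<Rightarrow> code_pattern \<Rightarrow> presence_data \<Rightarrow> bool" where
  "presence_cert N F P c \<longleftrightarrow> (case c of (Q, c', p) \<Rightarrow> fill_cert N (F @ Q) c' \<and> start_cert N (F @ Q) P p)"

lemma computable_assigns: "computable f \<Longrightarrow> computable (\<lambda>x. assigns N (f x))"
  unfolding assigns_def by (intro computable_intros)

lemma decidable_matches_word:
  "computable f \<Longrightarrow> computable g \<Longrightarrow> computable k \<Longrightarrow> decidable (\<lambda>x. matches_word (f x) (g x) (k x))"
proof (rule decidable_comp3[where P = matches_word])
  show "decidable (\<lambda>x. matches_word (fst x) (fst (snd x)) (snd (snd x)))"
    unfolding matches_word_def by (intro computable_intros decidable_same_word)
qed

lemma decidable_functional: "computable f \<Longrightarrow> decidable (\<lambda>x. functional N (f x))"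
proof (rule decidable_comp[where P = "functional N"])
  show "decidable (functional N)"
    unfolding functional_def by (intro computable_intros decidable_same_word)
qed

lemma decidable_absence_cert:
  "computable f \<Longrightarrow> computable g \<Longrightarrow> computable k \<Longrightarrow> decidable (\<lambda>x. absence_cert N (f x) (g x) (k x))"
proof (rule decidable_comp3[where P = "absence_cert N"])
  show "decidable (\<lambda>x. absence_cert N (fst x) (fst (snd x)) (snd (snd x)))"
    unfolding absence_cert_def
    by (intro computable_intros decidable_same_word decidable_matches_word computable_assigns)
qed

lemma decidable_fill_cert:
  "computable f \<Longrightarrow> computable g \<Longrightarrow> decidable (\<lambda>x. fill_cert N (f x) (g x))"
proof (rule decidable_comp2[where P = "fill_cert N"])
  show "decidable (\<lambda>x. fill_cert N (fst x) (snd x))"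
    unfolding fill_cert_def
    by (intro computable_intros decidable_same_word decidable_matches_word decidable_functional
        computable_assigns
      computable_cover computable_coord_word decidable_prec_word)
qed

lemma decidable_start_cert:
  "computable f \<Longrightarrow> computable g \<Longrightarrow> computable k \<Longrightarrow> decidable (\<lambda>x. start_cert N (f x) (g x) (k x))"
proof (rule decidable_comp3[where P = "start_cert N"])
  show "decidable (\<lambda>x. start_cert N (fst x) (fst (snd x)) (snd (snd x)))"
    unfolding start_cert_def
    by (intro computable_intros decidable_same_word decidable_matches_word decidable_functional
        decidable_prec_word)
qed

lemma decidable_presence_cert:
  "computable f \<Longrightarrow> computable g \<Longrightarrow> computable k \<Longrightarrow> decidable (\<lambda>x. presence_cert N (f x) (g x) (k x))"
proof (rule decidable_comp3[where P = "presence_cert N"])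
  show "decidable (\<lambda>x. presence_cert N (fst x) (fst (snd x)) (snd (snd x)))"
    unfolding presence_cert_def
    by (intro computable_intros decidable_fill_cert decidable_start_cert)
qed

text \<open>With one word per element, letter assignments to the list correspond to partial
  configurations on \<open>S\<close>, as the completeness arguments require.\<close>

lemma eval_set_words:
  assumes "finite S" "S \<subseteq> carrier G"
  shows "\<exists>D. eval_word n ` set D = S \<and> inj_on (eval_word n) (set D) \<and> distinct D"
  using assms
proof (induction S rule: finite_induct)
  case (insert g S)
  then obtain D where D: "eval_word n ` set D = S" "inj_on (eval_word n) (set D)" "distinct D" by auto
  obtain w where w: "eval_word n w = g" using eval_surj[of n g] insert.prems H_n by auto
  with D insert.hyps have "w \<notin> set D" "eval_word n w \<notin> eval_word n ` set D" by auto
  with D w show ?case by (intro exI[of _ "w # D"]) auto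
qed auto

end

section \<open>Word codes of patterns and configurations\<close>

locale sft_code = sft +
  fixes ls :: "'c list"
  assumes distinct_ls: "distinct ls" and set_ls: "set ls = A"
begin

abbreviation ev :: "word \<Rightarrow> 'a" where
  "ev \<equiv> eval_word n"

abbreviation N :: nat where
  "N \<equiv> length ls"

definition denotes :: "code_pattern \<Rightarrow> ('a \<rightharpoonup> 'c) \<Rightarrow> bool" where
  "denotes q P \<longleftrightarrow> (\<forall>(w, a)\<in>set q. a < N) \<and> Map.graph P = (\<lambda>(w, a). (ev w, ls ! a)) ` set q"

lemma denotes_Some: "denotes q P \<Longrightarrow> P k = Some b \<longleftrightarrow> (\<exists>(w, a)\<in>set q. ev w = k \<and> ls ! a = b)"
proof -
  assume d: "denotes q P"
  have "P k = Some b \<longleftrightarrow> (k, b) \<in> Map.graph P" by (simp add: graph_def)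
  then show ?thesis using d by (auto simp: denotes_def)
qed

lemma denotesI:
  assumes "\<And>w a. (w, a) \<in> set q \<Longrightarrow> a < N \<and> P (ev w) = Some (ls ! a)"
    and "\<And>k b. P k = Some b \<Longrightarrow> \<exists>a. \<exists>w. (w, a) \<in> set q \<and> ev w = k \<and> ls ! a = b"
  shows "denotes q P"
  unfolding denotes_def
proof (intro conjI subset_antisym subsetI)
  show "\<forall>(w, a)\<in>set q. a < N" using assms(1) by auto
next
  fix z assume "z \<in> Map.graph P"
  then obtain k b where z: "z = (k, b)" "P k = Some b" by (auto simp: graph_def)
  from assms(2)[OF z(2)] obtain a w where "(w, a) \<in> set q" "ev w = k" "ls ! a = b" by blast
  then show "z \<in> (\<lambda>(w, a). (ev w, ls ! a)) ` set q"
    using z(1) by (intro image_eqI[of _ _ "(w, a)"]) simp_all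
next
  fix z assume "z \<in> (\<lambda>(w, a). (ev w, ls ! a)) ` set q"
  then show "z \<in> Map.graph P" using assms(1) by (auto simp: graph_def)
qed

lemma denotes_in: "denotes q P \<Longrightarrow> (w, a) \<in> set q \<Longrightarrow> a < N \<and> P (ev w) = Some (ls ! a)"
proof -
  assume q: "denotes q P" and wa: "(w, a) \<in> set q"
  have "\<exists>(w', a')\<in>set q. ev w' = ev w \<and> ls ! a' = ls ! a" by (rule bexI[OF _ wa]) simp
  then have "P (ev w) = Some (ls ! a)" by (rule denotes_Some[OF q, THEN iffD2])
  moreover have "a < N" using q wa by (auto simp: denotes_def)
  ultimately show ?thesis by simp
qed

lemma denotes_dom: "denotes q P \<Longrightarrow> dom P = ev ` fst ` set q"
proof (intro subset_antisym subsetI)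
  fix k assume q: "denotes q P" and "k \<in> dom P"
  then obtain b where "P k = Some b" by blast
  then obtain w a where "(w, a) \<in> set q" "ev w = k" using denotes_Some[OF q] by blast
  then show "k \<in> ev ` fst ` set q" by force
next
  fix k assume q: "denotes q P" and "k \<in> ev ` fst ` set q"
  then show "k \<in> dom P" using denotes_in[OF q] by (fastforce intro: domI)
qed

lemma denotes_dom_finite: "denotes q P \<Longrightarrow> finite (dom P) \<and> dom P \<subseteq> carrier G"
  using eval_carrier by (auto simp: denotes_dom)

lemma nth_ls_eq: "a < N \<Longrightarrow> b < N \<Longrightarrow> ls ! a = ls ! b \<longleftrightarrow> a = b"
  using distinct_ls by (simp add: nth_eq_iff_index_eq)

lemma denotes_ran: "denotes q P \<Longrightarrow> ran P \<subseteq> A"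
proof
  fix b assume q: "denotes q P" and "b \<in> ran P"
  then obtain k where "P k = Some b" by (auto simp: ran_def)
  then obtain w a where "(w, a) \<in> set q" "ls ! a = b" using denotes_Some[OF q] by blast
  then show "b \<in> A" using denotes_in[OF q] set_ls nth_mem by blast
qed

lemma same_ev: "same_word v w \<longleftrightarrow> ev v = ev w"
  by (rule same_word_iff)

lemma ev_append: "ev (v @ w) = ev v \<otimes> ev w"
  by (rule eval_append) simp

lemma ev_inv: "ev (inv_word w) = inv (ev w)"
  by (rule eval_inv) simp

lemma ev_carrier [simp]: "ev w \<in> carrier G"
  by (rule eval_carrier) simp

lemma matches_word_iff:
  assumes q: "denotes q P" and x: "denotes x p"
  shows "matches_word q u x \<longleftrightarrow> (\<forall>k\<in>dom P. p (ev u \<otimes> k) = P k)"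
proof -
  have "(\<exists>(d, b)\<in>set x. same_word d (u @ k) \<and> a = b) \<longleftrightarrow> p (ev u \<otimes> ev k) = P (ev k)" if ka: "(k, a) \<in> set q"
      for k a
  proof -
    have P: "a < N" "P (ev k) = Some (ls ! a)" using denotes_in[OF q ka] by auto
    have "p (ev u \<otimes> ev k) = Some (ls ! a) \<longleftrightarrow> (\<exists>(d, b)\<in>set x. ev d = ev u \<otimes> ev k \<and> ls ! b = ls ! a)"
      by (rule denotes_Some[OF x])
    also have "\<dots> \<longleftrightarrow> (\<exists>(d, b)\<in>set x. ev d = ev u \<otimes> ev k \<and> a = b)"
      using denotes_in[OF x] P(1) nth_ls_eq by blast
    finally show ?thesis using P by (simp add: same_ev ev_append)
  qed
  then have "matches_word q u x \<longleftrightarrow> (\<forall>(k, a)\<in>set q. p (ev u \<otimes> ev k) = P (ev k))"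
    unfolding matches_word_def by (intro ball_cong refl) (simp add: case_prod_beta)
  then show ?thesis by (auto simp: denotes_dom[OF q])
qed

lemma denotes_ex:
  assumes "is_pattern G A P"
  shows "\<exists>q. denotes q P"
proof -
  have "finite (dom P)" "dom P \<subseteq> carrier G" using assms by (auto simp: is_pattern_def)
  from eval_set_words[OF this] obtain D where D: "ev ` set D = dom P" by blast
  have "\<exists>a<N. P (ev d) = Some (ls ! a)" if "d \<in> set D" for d
  proof -
    have "ev d \<in> dom P" using that D by blast
    then obtain b where b: "P (ev d) = Some b" by blast
    then have "b \<in> set ls" using assms set_ls by (auto simp: is_pattern_def ran_def)
    with b show ?thesis by (metis in_set_conv_nth)
  qed
  then obtain f where f: "\<And>d. d \<in> set D \<Longrightarrow> f d < N \<and> P (ev d) = Some (ls ! f d)" by metis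
  have "denotes (map (\<lambda>d. (d, f d)) D) P"
  proof (rule denotesI)
    fix k b assume "P k = Some b"
    then obtain d where "d \<in> set D" "ev d = k" using D by (metis domI imageE)
    then show "\<exists>a w. (w, a) \<in> set (map (\<lambda>d. (d, f d)) D) \<and> ev w = k \<and> ls ! a = b"
      using f[of d] \<open>P k = Some b\<close> by auto
  qed (use f in auto)
  then show ?thesis ..
qed

lemma functional_iff: "functional N q \<longleftrightarrow> (\<exists>P. denotes q P)"
proof
  assume f: "functional N q"
  let ?R = "\<lambda>k b. \<exists>(w, a)\<in>set q. ev w = k \<and> ls ! a = b"
  define P where "P k = (if \<exists>b. ?R k b then Some (SOME b. ?R k b) else None)" for k
  have uniq: "b = b'" if "?R k b" "?R k b'" for k b b'
    using f that unfolding functional_def same_ev by fastforce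
  have R: "?R k (SOME b. ?R k b)" if "?R k b" for k b using someI[of "?R k", OF that] .
  have "denotes q P"
  proof (rule denotesI)
    fix w a assume wa: "(w, a) \<in> set q"
    then have 1: "?R (ev w) (ls ! a)" by blast
    then have "P (ev w) = Some (ls ! a)" using uniq[OF R[OF 1] 1] by (auto simp: P_def)
    then show "a < N \<and> P (ev w) = Some (ls ! a)" using f wa by (auto simp: functional_def)
  next
    fix k b assume "P k = Some b"
    then have ex: "\<exists>b. ?R k b" by (cases "\<exists>b. ?R k b") (simp_all add: P_def)
    with \<open>P k = Some b\<close> have "b = (SOME b. ?R k b)" by (simp add: P_def)
    with someI_ex[OF ex] have "?R k b" by simp
    then show "\<exists>a w. (w, a) \<in> set q \<and> ev w = k \<and> ls ! a = b" by auto
  qed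
  then show "\<exists>P. denotes q P" by blast
next
  assume "\<exists>P. denotes q P"
  then obtain P where P: "denotes q P" ..
  show "functional N q"
    unfolding functional_def same_ev
  proof (clarify, intro conjI, goal_cases)
    case (1 w a)
    then show ?case using denotes_in[OF P] by blast
  next
    case (2 w a)
    show ?case
    proof clarify
      fix w' a' assume "(w', a') \<in> set q" "ev w = ev w'"
      then show "a = a'" using denotes_in[OF P 2] denotes_in[OF P, of w' a'] nth_ls_eq by auto
    qed
  qed
qed

definition part :: "'a set \<Rightarrow> ('a \<Rightarrow> 'c) \<Rightarrow> 'a \<rightharpoonup> 'c" where
  "part S y = (\<lambda>g. if g \<in> S then Some (y g) else None)"

lemma matches_part: "(\<forall>k\<in>dom P. part S y (u \<otimes> k) = P k) \<longleftrightarrow> matches P u S y"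
  unfolding matches_def by (intro ball_cong refl) (auto simp: part_def)

text \<open>The assignment can be read off \<open>y\<close> word by word, even if several words name
  the same element. Soundness therefore holds for whatever lists a certificate contains.\<close>

lemma assigns_part:
  assumes "y \<in> carrier G \<rightarrow>\<^sub>E A"
  shows "\<exists>x\<in>set (assigns N D). denotes x (part (ev ` set D) y)"
proof -
  have "\<exists>a<N. ls ! a = y (ev d)" for d
    using assms set_ls by (metis PiE_mem ev_carrier in_set_conv_nth)
  then obtain f where f: "\<And>d. f d < N \<and> ls ! f d = y (ev d)" by metis
  have "map (\<lambda>d. (d, f d)) D \<in> set (assigns N D)" by (auto simp: set_assigns f comp_def)
  moreover have "denotes (map (\<lambda>d. (d, f d)) D) (part (ev ` set D) y)"
  proof (rule denotesI)
    fix k b assume "part (ev ` set D) y k = Some b"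
    then obtain d where "d \<in> set D" "k = ev d" "b = y k" by (auto simp: part_def split: if_splits)
    then show "\<exists>a w. (w, a) \<in> set (map (\<lambda>d. (d, f d)) D) \<and> ev w = k \<and> ls ! a = b"
      using f by (intro exI[of _ "f d"] exI[of _ d]) auto
  qed (auto simp: part_def f)
  ultimately show ?thesis by blast
qed

text \<open>Two words with the same value might receive different letters; injectivity rules this
  out. The completeness proofs choose their lists accordingly.\<close>

lemma part_assigns:
  assumes x: "x \<in> set (assigns N D)" and inj: "inj_on ev (set D)" "distinct D" and A: "A \<noteq> {}"
  shows "\<exists>y\<in>carrier G \<rightarrow>\<^sub>E A. denotes x (part (ev ` set D) y)"
proof -
  have fst: "map fst x = D" and lt: "\<And>d a. (d, a) \<in> set x \<Longrightarrow> a < N" using x by (auto simp: set_assigns)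
  have "functional N x"
    unfolding functional_def same_ev
  proof (clarify, intro conjI, goal_cases)
    case (1 w a)
    then show ?case using lt by blast
  next
    case (2 w a)
    show ?case
    proof clarify
      fix w' a' assume *: "(w', a') \<in> set x" "ev w = ev w'"
      have "w \<in> set D" "w' \<in> set D" using 2 * unfolding fst[symmetric] by force+
      then have "w = w'" using inj(1) * by (auto dest: inj_onD)
      moreover have "distinct (map fst x)" using fst inj(2) by simp
      ultimately show "a = a'" using 2 * by (metis eq_key_imp_eq_value)
    qed
  qed
  then obtain p where p: "denotes x p" using functional_iff by blast
  obtain a0 where a0: "a0 \<in> A" using A by blast
  define y where "y = (\<lambda>g\<in>carrier G. case p g of Some b \<Rightarrow> b | None \<Rightarrow> a0)"
  have "ev ` set D = dom p" unfolding denotes_dom[OF p] fst[symmetric] by simp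
  moreover have "dom p \<subseteq> carrier G" using denotes_dom_finite[OF p] by simp
  ultimately have "part (ev ` set D) y = p"
    unfolding part_def y_def by (auto simp: fun_eq_iff split: option.splits)
  moreover have "y \<in> carrier G \<rightarrow>\<^sub>E A"
    using subsetD[OF denotes_ran[OF p] ranI] a0 by (auto simp: y_def split: option.splits)
  ultimately show ?thesis using p by (intro bexI[of _ y]) simp_all
qed

end

section \<open>Soundness and completeness of the certificates\<close>

context sft_code
begin

definition coded :: "code_pattern list \<Rightarrow> ('a \<rightharpoonup> 'c) set \<Rightarrow> bool" where
  "coded Q S \<longleftrightarrow> (\<forall>q\<in>set Q. \<exists>M\<in>S. denotes q M) \<and> (\<forall>M\<in>S. \<exists>q\<in>set Q. denotes q M)"

lemma codedD:
  assumes "coded Q S"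
  shows "q \<in> set Q \<Longrightarrow> \<exists>M\<in>S. denotes q M" "M \<in> S \<Longrightarrow> \<exists>q\<in>set Q. denotes q M"
  using assms unfolding coded_def by blast+

lemma point_at_one:
  assumes "occurs_in G P X" "dom P \<subseteq> carrier G"
  shows "\<exists>y\<in>X. matches P \<one> (carrier G) y"
proof -
  from assms(1) obtain z g where z: "z \<in> X" "g \<in> carrier G" "\<forall>k\<in>dom P. Some (z (g \<otimes> k)) = P k"
    by (auto simp: occurs_in_def occurs_in_point_def)
  have "matches P \<one> (carrier G) (shift G (inv g) z)"
    unfolding matches_def
  proof
    fix k assume k: "k \<in> dom P"
    then have "k \<in> carrier G" using assms(2) by blast
    then show "\<one> \<otimes> k \<in> carrier G \<and> Some (shift G (inv g) z (\<one> \<otimes> k)) = P k"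
      using z(2,3) k by (simp add: shift_apply)
  qed
  then show ?thesis using X_shift[OF z(1), of "inv g"] z(2) by blast
qed

lemma absence_sound:
  assumes F: "coded Fc F" and P: "denotes Pc P" and cert: "absence_cert N Fc Pc (D, E)"
  shows "\<not> occurs_in G P X"
proof
  assume "occurs_in G P X"
  from point_at_one[OF this] denotes_dom_finite[OF P] obtain y
      where y: "y \<in> X" "matches P \<one> (carrier G) y" by blast
  obtain x where x: "x \<in> set (assigns N D)" "denotes x (part (ev ` set D) y)"
    using assigns_part[OF X_PiE[OF y(1)]] by blast
  have "dom P \<subseteq> ev ` set D"
  proof
    fix k assume "k \<in> dom P"
    then obtain w a where "(w, a) \<in> set Pc" "k = ev w" unfolding denotes_dom[OF P] by force
    moreover have "\<forall>(k, a)\<in>set Pc. \<exists>d\<in>set D. ev d = ev k" using cert by (simp add: absence_cert_def same_ev)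
    ultimately have "\<exists>d\<in>set D. ev d = k" by auto
    then show "k \<in> ev ` set D" by blast
  qed
  then have "matches P \<one> (ev ` set D) y" using y(2) denotes_dom_finite[OF P] by (auto simp: matches_def)
  then have "matches_word Pc [] x" unfolding matches_word_iff[OF P x(2)] by (simp add: matches_part)
  then obtain u q where q: "q \<in> set Fc" "matches_word q u x" using cert x(1) unfolding absence_cert_def
      by blast
  then obtain M where M: "M \<in> F" "denotes q M" using F by (auto simp: coded_def)
  have "matches M (ev u) (ev ` set D) y" using q(2) unfolding matches_word_iff[OF M(2) x(2)] matches_part .
  then have "matches M (ev u) (carrier G) y" by (rule matches_mono) auto
  then show False using y(1) M(1) by (auto simp: X_iff valid_def)
qed

text \<open>By compactness finitely many positions E refute every configuration with P at the
  identity. The window collects the domain of P and all cells that forbidden patterns read at these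
  positions.\<close>

lemma absence_complete:
  assumes F: "coded Fc F" and P: "denotes Pc P" and no: "\<not> occurs_in G P X"
  shows "\<exists>c. absence_cert N Fc Pc c"
proof -
  have "\<exists>E. finite E \<and> E \<subseteq> carrier G \<and>
    (\<forall>x\<in>carrier G \<rightarrow>\<^sub>E A. matches P \<one> (carrier G) x \<longrightarrow> (\<exists>u\<in>E. \<exists>q\<in>F. matches q u (carrier G) x))"
  proof (rule ccontr)
    assume none: "\<not> ?thesis"
    have "\<exists>x\<in>carrier G \<rightarrow>\<^sub>E A. valid F (carrier G) x \<and> (\<forall>c\<in>{()}. matches P \<one> (carrier G) x)"
    proof (rule X_constraints[where D = "\<lambda>_. dom P"])
      fix x y assume "\<And>k. k \<in> dom P \<Longrightarrow> k \<in> carrier G \<Longrightarrow> x k = y k" "matches P \<one> (carrier G) x"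
      then show "matches P \<one> (carrier G) y" using denotes_dom_finite[OF P]
          by (auto simp: matches_def subset_iff)
    next
      fix V E assume "finite E" "E \<subseteq> carrier G"
      with none obtain x
          where "x \<in> carrier G \<rightarrow>\<^sub>E A" "matches P \<one> (carrier G) x" "\<not> (\<exists>u\<in>E. \<exists>q\<in>F. matches q u (carrier G) x)"
        by blast
      then show "\<exists>x\<in>carrier G \<rightarrow>\<^sub>E A. (\<forall>u\<in>E. \<forall>q\<in>F. \<not> matches q u (carrier G) x) \<and>
          (\<forall>c\<in>V. matches P \<one> (carrier G) x)"
        by (intro bexI[of _ x]) auto
    qed (use denotes_dom_finite[OF P] F_pattern in \<open>auto simp: is_pattern_def\<close>)
    then obtain x where x: "x \<in> X" "matches P \<one> (carrier G) x" by (auto simp: X_iff)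
    then show False using no not_occurs_matches by blast
  qed
  then obtain E where E: "finite E" "E \<subseteq> carrier G"
    and occ: "\<And>x. x \<in> carrier G \<rightarrow>\<^sub>E A \<Longrightarrow> matches P \<one> (carrier G) x \<Longrightarrow> \<exists>u\<in>E. \<exists>q\<in>F. matches q u (carrier G) x"
    by (elim exE conjE) (rule that, assumption+, blast)
  obtain Ew where Ew: "ev ` set Ew = E" using eval_set_words[OF E] by blast
  \<comment> \<open>The added identity makes D nonempty, so an assignment to D exists only if there
    is a letter.\<close>
  let ?S = "insert \<one> (dom P \<union> (\<Union>u\<in>E. \<Union>q\<in>set Fc. (\<lambda>k. u \<otimes> ev k) ` fst ` set q))"
  have "finite ?S" "?S \<subseteq> carrier G" using E denotes_dom_finite[OF P] by auto
  then obtain D where D: "ev ` set D = ?S" "inj_on ev (set D)" "distinct D" using eval_set_words by blast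
  have "\<exists>u\<in>set Ew. \<exists>q\<in>set Fc. matches_word q u x" if x: "x \<in> set (assigns N D)"
      and m: "matches_word Pc [] x" for x
  proof -
    have "D \<noteq> []" using D(1) by auto
    then have "N > 0" using x unfolding set_assigns by (cases x) auto
    then have "A \<noteq> {}" using set_ls by auto
    from part_assigns[OF x D(2,3) this] obtain y
        where y: "y \<in> carrier G \<rightarrow>\<^sub>E A" "denotes x (part (ev ` set D) y)" by blast
    have "matches P \<one> (ev ` set D) y" using m unfolding matches_word_iff[OF P y(2)]
        by (simp add: matches_part)
    then have "matches P \<one> (carrier G) y" by (rule matches_mono) auto
    from occ[OF y(1) this] obtain u M where u: "u \<in> E" "M \<in> F" "matches M u (carrier G) y" by blast
    obtain q where q: "q \<in> set Fc" "denotes q M" using F u(2) by (auto simp: coded_def)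
    obtain w where w: "w \<in> set Ew" "ev w = u" using Ew u(1) by blast
    have "u \<otimes> k \<in> ev ` set D" if "k \<in> dom M" for k
    proof -
      have "k \<in> ev ` fst ` set q" using that denotes_dom[OF q(2)] by simp
      then show ?thesis unfolding D(1) using u(1) q(1) by blast
    qed
    then have "matches M (ev w) (ev ` set D) y" using u(3) w(2) by (simp add: matches_def)
    then have "matches_word q w x" unfolding matches_word_iff[OF q(2) y(2)] matches_part .
    then show ?thesis using q(1) w(1) by blast
  qed
  moreover have "\<exists>d\<in>set D. same_word d k" if "(k, a) \<in> set Pc" for k a
  proof -
    have "ev k \<in> dom P" using that denotes_dom[OF P] by force
    then have "ev k \<in> ev ` set D" using D(1) by simp
    then show ?thesis by (auto simp: same_ev)
  qed
  ultimately have "absence_cert N Fc Pc (D, Ew)" by (auto simp: absence_cert_def)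
  then show ?thesis ..
qed

text \<open>The empty word names the identity, so \<open>([], a)\<close> is the new cell; since the
  identity is not in S, prepending it creates no conflict.\<close>

lemma fresh_word_iff:
  assumes x: "denotes x (part S f)" and S: "\<one> \<notin> S" and a: "a < N" and q: "denotes q M"
  shows "matches_word q (inv_word k) (([], a) # x) \<longleftrightarrow> matches M (inv (ev k)) (insert \<one> S) (f(\<one> := ls ! a))"
proof -
  have "denotes (([], a) # x) (part (insert \<one> S) (f(\<one> := ls ! a)))"
  proof (rule denotesI)
    fix w b assume "(w, b) \<in> set (([], a) # x)"
    then show "b < N \<and> part (insert \<one> S) (f(\<one> := ls ! a)) (ev w) = Some (ls ! b)"
      using denotes_in[OF x, of w b] a S by (auto simp: part_def split: if_splits)
  next
    fix g b assume *: "part (insert \<one> S) (f(\<one> := ls ! a)) g = Some b"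
    show "\<exists>c w. (w, c) \<in> set (([], a) # x) \<and> ev w = g \<and> ls ! c = b"
    proof (cases "g = \<one>")
      case True
      then show ?thesis using * by (intro exI[of _ a] exI[of _ "[]"]) (simp add: part_def)
    next
      case False
      then have "part S f g = Some b" using * by (auto simp: part_def split: if_splits)
      then show ?thesis using denotes_Some[OF x, of g b] by auto
    qed
  qed
  from matches_word_iff[OF q this] show ?thesis by (simp add: matches_part ev_inv)
qed

lemma cover_max_period:
  assumes "max_period < m" "1 \<le> j" "j \<le> n"
  shows "period j < int m"
proof -
  have "factor_order G H h j \<le> max_period" unfolding max_period_def using assms by (intro Max_ge) auto
  then show ?thesis using assms by simp
qed

lemma filter_past: "ev ` set (filter (\<lambda>k. prec_word n (g @ k) g) K) = ev ` set K \<inter> past (ev g)"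
  by (auto simp: prec_word_iff ev_append past_def)

text \<open>Some v in the finite cover has the same predecessors within K as \<open>g\<close>. An
  occurrence found on K is an occurrence in \<open>past g\<close>, and the freshness test reads,
  besides the identity, only differences \<open>inv k \<otimes> k'\<close>, all of which K
  names.\<close>

lemma fill_cert_admits:
  assumes Q: "coded Q S" and cert: "fill_cert N Q (K, E, m)" and g: "g \<in> carrier G"
  shows "admits_fresh S A (ev ` set E) (past g)"
  unfolding admits_fresh_def
proof (intro ballI impI)
  have diff: "\<exists>d\<in>set K. same_word d (inv_word k @ k')" if "q \<in> set Q" "(k, a) \<in> set q" "(k', a') \<in> set q"
      for q k a k' a'
  proof -
    have "\<forall>q\<in>set Q. \<forall>(k, a)\<in>set q. \<forall>(k', a')\<in>set q. \<exists>d\<in>set K. same_word d (inv_word k @ k')"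
      using cert unfolding fill_cert_def by blast
    then show ?thesis using that by fast
  qed
  have step: "(\<exists>u\<in>set E. \<exists>q\<in>set Q. matches_word q u x) \<or>
       (\<exists>a\<in>set [0..<N]. \<not> (\<exists>q\<in>set Q. \<exists>(k, b)\<in>set q. matches_word q (inv_word k) (([], a) # x)))"
    if "v \<in> set (cover m n)" "x \<in> set (assigns N (filter (\<lambda>k. prec_word n (v @ k) v) K))" for v x
    using cert that unfolding fill_cert_def by blast
  fix x assume x: "x \<in> carrier G \<rightarrow>\<^sub>E A" and no: "\<forall>u\<in>ev ` set E. \<forall>q\<in>S. \<not> matches q u (past g) x"
  have "\<exists>v\<in>set (cover m n). \<forall>w\<in>set K. ev w \<in> past (ev v) \<longleftrightarrow> ev w \<in> past g"
  proof (rule cover_past[OF g])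
    show "period j < int m" if "1 \<le> j" "j \<le> n" for j
      using cover_max_period[OF _ that] cert by (auto simp: fill_cert_def)
    show "\<bar>t\<bar> + 1 < int m" if "w \<in> set K" "t \<in> set (coord_word n w)" for w t
    proof -
      have "Suc (nat t + nat (- t)) < m" using cert that unfolding fill_cert_def by blast
      then show ?thesis by linarith
    qed
  qed
  then obtain v where v: "v \<in> set (cover m n)" "\<And>w. w \<in> set K \<Longrightarrow> ev w \<in> past (ev v) \<longleftrightarrow> ev w \<in> past g" by blast
  let ?D = "filter (\<lambda>k. prec_word n (v @ k) v) K"
  have D: "ev ` set ?D = ev ` set K \<inter> past g" unfolding filter_past using v(2) by blast
  have one: "\<one> \<notin> ev ` set ?D" using one_notin_past[OF g] D by simp
  obtain xl where xl: "xl \<in> set (assigns N ?D)" "denotes xl (part (ev ` set ?D) x)"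
      using assigns_part[OF x] by blast
  have "\<not> matches_word q u xl" if "u \<in> set E" "q \<in> set Q" for u q
  proof
    assume m: "matches_word q u xl"
    obtain M where M: "M \<in> S" "denotes q M" using codedD(1)[OF Q \<open>q \<in> set Q\<close>] by blast
    have "matches M (ev u) (ev ` set ?D) x" using m unfolding matches_word_iff[OF M(2) xl(2)] matches_part .
    then have "matches M (ev u) (past g) x" by (rule matches_mono) (use D in blast)
    then show False using no M(1) that(1) by blast
  qed
  then obtain a where a: "a < N"
      and fr: "\<And>q k b. q \<in> set Q \<Longrightarrow> (k, b) \<in> set q \<Longrightarrow> \<not> matches_word q (inv_word k) (([], a) # xl)"
    using step[OF v(1) xl(1)] by fastforce
  have "fresh S (past g) x (ls ! a)"
    unfolding fresh_def
  proof (intro ballI notI)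
    fix M k assume M: "M \<in> S" "k \<in> dom M" and m: "matches M (inv k) (insert \<one> (past g)) (x(\<one> := ls ! a))"
    obtain q where q: "q \<in> set Q" "denotes q M" using Q M(1) by (auto simp: coded_def)
    obtain w b where w: "(w, b) \<in> set q" "ev w = k" using M(2) denotes_dom[OF q(2)] by force
    have "inv k \<otimes> k' \<in> insert \<one> (ev ` set ?D)" if k': "k' \<in> dom M" for k'
    proof -
      obtain w' b' where w': "(w', b') \<in> set q" "ev w' = k'" using k' denotes_dom[OF q(2)] by force
      obtain d where "d \<in> set K" "same_word d (inv_word w @ w')" using diff[OF q(1) w(1) w'(1)] by blast
      then have "d \<in> set K" "inv k \<otimes> k' = ev d" using w w' by (simp_all add: same_ev ev_append ev_inv)
      then have "inv k \<otimes> k' \<in> ev ` set K" by simp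
      moreover have "inv k \<otimes> k' \<in> insert \<one> (past g)" using m k' by (simp add: matches_def)
      ultimately show ?thesis using D by auto
    qed
    then have "matches M (inv (ev w)) (insert \<one> (ev ` set ?D)) (x(\<one> := ls ! a))"
      using m w(2) unfolding matches_def by blast
    then show False using fresh_word_iff[OF xl(2) one a q(2)] fr[OF q(1) w(1)] by blast
  qed
  moreover have "ls ! a \<in> A" using a set_ls nth_mem by blast
  ultimately show "\<exists>a\<in>A. fresh S (past g) x a" by blast
qed

text \<open>All hypotheses of \<open>fill\<close> are read off the certificate, so a positive answer
  is correct for every SFT.\<close>

lemma presence_sound:
  assumes F: "coded Fc F" and P: "denotes Pc P" and cert: "presence_cert N Fc Pc c"
  shows "occurs_in G P X"
proof -
  obtain Q K E m p where c: "c = (Q, (K, E, m), p)" by (metis prod.collapse)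
  let ?Q = "Fc @ Q"
  from cert c have cert': "fill_cert N ?Q (K, E, m)" and start: "start_cert N ?Q Pc p"
      by (auto simp: presence_cert_def)
  define S where "S = {M. \<exists>q\<in>set ?Q. denotes q M}"
  have func: "\<exists>M. denotes q M" "q \<noteq> []" if "q \<in> set ?Q" for q
    using cert' that unfolding fill_cert_def functional_iff by blast+
  have S: "coded ?Q S" unfolding coded_def S_def using func(1) by blast
  have FS: "F \<subseteq> S" using F by (auto simp: coded_def S_def)
  have closed: "\<exists>(d', a')\<in>set p. same_word d' (d @ (inv_word k @ k'))"
    if "(d, a) \<in> set p" "q \<in> set ?Q" "(k, b) \<in> set q" "(k', b') \<in> set q"
        "prec_word n (d @ (inv_word k @ k')) d" for d a q k b k' b'
    using start that unfolding start_cert_def by fast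
  have free: "\<not> matches_word q (d @ inv_word k) p"
    if "(d, a) \<in> set p" "q \<in> set ?Q" "(k, b) \<in> set q" for d a q k b
    using start that unfolding start_cert_def by fast
  obtain pm where pm: "denotes p pm" using start by (auto simp: start_cert_def functional_iff)
  have dom: "dom M \<subseteq> carrier G \<and> finite (dom M) \<and> dom M \<noteq> {}" if "M \<in> S" for M
  proof -
    obtain q where q: "q \<in> set ?Q" "denotes q M" using \<open>M \<in> S\<close> by (auto simp: S_def)
    then show ?thesis using denotes_dom_finite[OF q(2)] func(2)[OF q(1)] by (simp add: denotes_dom[OF q(2)])
  qed
  have word: "\<exists>w b. (w, b) \<in> set q \<and> ev w = k" if "denotes q M" "k \<in> dom M" for q M k
    using that denotes_dom[OF that(1)] by force
  have "\<exists>x\<in>X. \<forall>d\<in>dom pm. pm d = Some (x d)"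
  proof (rule fill)
    show "A \<noteq> {}" using cert' set_ls by (auto simp: fill_cert_def)
    show "F \<subseteq> S" by (rule FS)
    show "dom M \<subseteq> carrier G \<and> finite (dom M) \<and> dom M \<noteq> {}" if "M \<in> S" for M by (rule dom[OF that])
    show "ev ` set E \<subseteq> carrier G" by auto
    show "admits_fresh S A (ev ` set E) (past g)" if "g \<in> carrier G" for g
        by (rule fill_cert_admits[OF S cert' that])
    show "ran pm \<subseteq> A" "dom pm \<subseteq> carrier G" using denotes_ran[OF pm] denotes_dom_finite[OF pm] by auto
  next
    fix d M k k' assume *: "d \<in> dom pm" "M \<in> S" "k \<in> dom M" "k' \<in> dom M" "d \<otimes> (inv k \<otimes> k') \<in> before d"
    obtain q where q: "q \<in> set ?Q" "denotes q M" using *(2) by (auto simp: S_def)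
    obtain dw a kw b kw' b'
        where w: "(dw, a) \<in> set p" "ev dw = d" "(kw, b) \<in> set q" "ev kw = k" "(kw', b') \<in> set q" "ev kw' = k'"
      using word[OF pm *(1)] word[OF q(2) *(3)] word[OF q(2) *(4)] by blast
    have "prec_word n (dw @ (inv_word kw @ kw')) dw"
      using *(5) w by (simp add: prec_word_iff ev_append ev_inv before_def)
    then have "\<exists>(d', a')\<in>set p. same_word d' (dw @ (inv_word kw @ kw'))"
      by (rule closed[OF w(1) q(1) w(3) w(5)])
    then show "d \<otimes> (inv k \<otimes> k') \<in> dom pm"
      unfolding denotes_dom[OF pm] using w by (force simp: same_ev ev_append ev_inv)
  next
    fix d M k assume *: "d \<in> dom pm" "M \<in> S" "k \<in> dom M"
    obtain q where q: "q \<in> set ?Q" "denotes q M" using *(2) by (auto simp: S_def)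
    obtain dw a kw b where w: "(dw, a) \<in> set p" "ev dw = d" "(kw, b) \<in> set q" "ev kw = k"
      using word[OF pm *(1)] word[OF q(2) *(3)] by blast
    have "\<not> matches_word q (dw @ inv_word kw) p"
      by (rule free[OF w(1) q(1) w(3)])
    then obtain k' where k': "k' \<in> dom M" "pm (ev (dw @ inv_word kw) \<otimes> k') \<noteq> M k'"
      unfolding matches_word_iff[OF q(2) pm] by blast
    have "k' \<in> carrier G" using k' dom[OF *(2)] by blast
    then have "ev (dw @ inv_word kw) \<otimes> k' = d \<otimes> (inv k \<otimes> k')"
      unfolding w(2,4)[symmetric] by (simp add: ev_append ev_inv m_assoc)
    with k' show "\<exists>k'\<in>dom M. pm (d \<otimes> (inv k \<otimes> k')) \<noteq> M k'" by (intro bexI[of _ k']) simp_all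
  qed
  then obtain x where x: "x \<in> X" "\<And>d. d \<in> dom pm \<Longrightarrow> pm d = Some (x d)" by blast
  have "matches_word Pc [] p" using start by (simp add: start_cert_def)
  then have "\<forall>k\<in>dom P. pm (\<one> \<otimes> k) = P k" unfolding matches_word_iff[OF P pm] by simp
  then have "\<forall>k\<in>dom P. Some (x (\<one> \<otimes> k)) = P k" using x(2) by (metis domIff)
  then show ?thesis using x(1) by (auto simp: occurs_in_def occurs_in_point_def)
qed

lemma coded_append: "coded Q S \<Longrightarrow> coded R T \<Longrightarrow> coded (Q @ R) (S \<union> T)"
  by (fastforce simp: coded_def)

lemma coded_ex:
  assumes "finite S" "\<And>M. M \<in> S \<Longrightarrow> is_pattern G A M"
  shows "\<exists>Q. coded Q S"
  using assms
proof (induction S rule: finite_induct)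
  case empty
  show ?case by (rule exI[of _ "[]"]) (simp add: coded_def)
next
  case (insert M S)
  then obtain Q where Q: "coded Q S" by blast
  obtain q where "denotes q M" using denotes_ex insert.prems by blast
  then have "coded [q] {M}" by (simp add: coded_def)
  from coded_append[OF this Q] show ?case by (intro exI[of _ "[q] @ Q"]) simp
qed

lemma finite_non_language: "finite W \<Longrightarrow> finite (non_language W)"
proof -
  assume W: "finite W"
  have "finite (\<Union>V\<in>Pow W. {q. dom q = V \<and> ran q \<subseteq> A})"
    using W finite_A by (intro finite_UN_I) (auto intro: finite_set_of_finite_maps finite_subset)
  then show ?thesis by (rule rev_finite_subset) (auto simp: non_language_def)
qed

text \<open>K is made to name the cells read by occurrences at positions in E and all differences
  within a pattern. Then a partial configuration on K that shows no occurrence at E comes from one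
  that shows none on the whole past either, and a letter fresh there is fresh on K.\<close>

lemma fill_cert_complete:
  assumes Q: "coded Qc Q" and ne: "X \<noteq> {}" and nonocc: "\<And>q. q \<in> Q \<Longrightarrow> \<not> occurs_in G q X"
    and E: "finite E" "E \<subseteq> carrier G" "\<And>g. g \<in> carrier G \<Longrightarrow> admits_fresh Q A E (past g)"
  shows "\<exists>c. fill_cert N Qc c"
proof -
  obtain y where y: "y \<in> X" using ne by blast
  have A: "A \<noteq> {}" using X_in_A[OF y, of \<one>] by auto
  obtain Ew where Ew: "ev ` set Ew = E" using eval_set_words[OF E(1,2)] by blast
  let ?S = "(\<Union>u\<in>E. \<Union>q\<in>set Qc. (\<lambda>k. u \<otimes> ev k) ` fst ` set q) \<union>
    (\<Union>q\<in>set Qc. \<Union>k\<in>fst ` set q. \<Union>k'\<in>fst ` set q. {inv (ev k) \<otimes> ev k'})"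
  have "finite ?S" "?S \<subseteq> carrier G" using E by auto
  from eval_set_words[OF this] obtain K where K: "ev ` set K = ?S" "inj_on ev (set K)" "distinct K"
    by (elim exE conjE) (rule that)
  let ?T = "\<Union>w\<in>set K. (\<lambda>t. nat t + nat (- t)) ` set (coord_word n w)"
  \<comment> \<open>Two more than the maximum, because absolute value plus one has to stay strictly
    below m.\<close>
  define m where "m = Suc (Suc (Max (insert max_period ?T)))"
  have m: "max_period < m" "\<And>w t. w \<in> set K \<Longrightarrow> t \<in> set (coord_word n w) \<Longrightarrow> Suc (nat t + nat (- t)) < m"
  proof -
    have fin: "finite (insert max_period ?T)" by simp
    have "max_period \<le> Max (insert max_period ?T)" by (rule Max_ge[OF fin]) simp
    then show "max_period < m" unfolding m_def by linarith
    fix w t assume "w \<in> set K" "t \<in> set (coord_word n w)"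
    then have "nat t + nat (- t) \<in> insert max_period ?T" by blast
    from Max_ge[OF fin this] show "Suc (nat t + nat (- t)) < m" unfolding m_def by linarith
  qed
  have nonempty: "q \<noteq> [] \<and> functional N q" if "q \<in> set Qc" for q
  proof -
    obtain M where M: "M \<in> Q" "denotes q M" using codedD(1)[OF Q \<open>q \<in> set Qc\<close>] by blast
    \<comment> \<open>A pattern with empty domain would occur in the point y.\<close>
    have "dom M \<noteq> {}"
    proof
      assume "dom M = {}"
      then have "occurs_in_point G M y" by (auto simp: occurs_in_point_def)
      then show False using nonocc[OF M(1)] y by (auto simp: occurs_in_def)
    qed
    then show ?thesis using M(2) denotes_dom[OF M(2)] functional_iff by auto
  qed
  have ext: "(\<exists>u\<in>set Ew. \<exists>q\<in>set Qc. matches_word q u x) \<or>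
       (\<exists>a\<in>set [0..<N]. \<not> (\<exists>q\<in>set Qc. \<exists>(k, b)\<in>set q. matches_word q (inv_word k) (([], a) # x)))"
    if x: "x \<in> set (assigns N (filter (\<lambda>k. prec_word n (v @ k) v) K))" for v x
  proof (rule disjCI)
    assume notrim: "\<not> (\<exists>a\<in>set [0..<N]. \<not> (\<exists>q\<in>set Qc. \<exists>(k, b)\<in>set q. matches_word q (inv_word k) (([], a) #
        x)))"
    let ?D = "filter (\<lambda>k. prec_word n (v @ k) v) K"
    have D: "ev ` set ?D = ev ` set K \<inter> past (ev v)" by (rule filter_past)
    have one: "\<one> \<notin> ev ` set ?D" using one_notin_past[of "ev v"] D by simp
    have "inj_on ev (set ?D)" "distinct ?D" using K by (auto intro: inj_on_subset)
    from part_assigns[OF x this A] obtain f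
        where f: "f \<in> carrier G \<rightarrow>\<^sub>E A" "denotes x (part (ev ` set ?D) f)" by blast
    have "\<not> (\<forall>u\<in>E. \<forall>q\<in>Q. \<not> matches q u (past (ev v)) f)"
    proof
      assume "\<forall>u\<in>E. \<forall>q\<in>Q. \<not> matches q u (past (ev v)) f"
      then obtain b where b: "b \<in> A" "fresh Q (past (ev v)) f b"
        using E(3)[of "ev v", unfolded admits_fresh_def, THEN bspec, OF _ f(1)] by auto
      then obtain a where a: "a < N" "b = ls ! a" using set_ls by (metis in_set_conv_nth)
      have "\<not> matches_word q (inv_word k) (([], a) # x)" if q: "q \<in> set Qc" and k: "(k, c) \<in> set q" for q k c
      proof
        assume mw: "matches_word q (inv_word k) (([], a) # x)"
        obtain M where M: "M \<in> Q" "denotes q M" using codedD(1)[OF Q q] by blast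
        have "matches M (inv (ev k)) (insert \<one> (ev ` set ?D)) (f(\<one> := b))"
          using mw fresh_word_iff[OF f(2) one a(1) M(2)] a(2) by simp
        then have "matches M (inv (ev k)) (insert \<one> (past (ev v))) (f(\<one> := b))"
          by (rule matches_mono) (use D in blast)
        moreover have "ev k \<in> dom M" using denotes_dom[OF M(2)] k by force
        ultimately show False using b(2) M(1) by (auto simp: fresh_def)
      qed
      then have "\<not> (\<exists>q\<in>set Qc. \<exists>(k, c)\<in>set q. matches_word q (inv_word k) (([], a) # x))" by blast
      moreover have "a \<in> set [0..<N]" using a(1) by simp
      ultimately show False using notrim by blast
    qed
    then obtain u M where u: "u \<in> E" "M \<in> Q" "matches M u (past (ev v)) f" by blast
    obtain q where q: "q \<in> set Qc" "denotes q M" using codedD(2)[OF Q u(2)] by blast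
    obtain w where w: "w \<in> set Ew" "ev w = u" using Ew u(1) by blast
    have "u \<otimes> k \<in> ev ` set ?D" if "k \<in> dom M" for k
    proof -
      have "k \<in> ev ` fst ` set q" using that denotes_dom[OF q(2)] by simp
      then have "u \<otimes> k \<in> ev ` set K" unfolding K(1) using u(1) q(1) by blast
      moreover have "u \<otimes> k \<in> past (ev v)" using u(3) that by (simp add: matches_def)
      ultimately show ?thesis using D by blast
    qed
    then have "matches M (ev w) (ev ` set ?D) f" using u(3) w(2) by (simp add: matches_def)
    then have "matches_word q w x" unfolding matches_word_iff[OF q(2) f(2)] matches_part .
    then show "\<exists>u\<in>set Ew. \<exists>q\<in>set Qc. matches_word q u x" using q(1) w(1) by blast
  qed
  have diff: "\<exists>d\<in>set K. same_word d (inv_word k @ k')" if "q \<in> set Qc" "(k, a) \<in> set q" "(k', a') \<in> set q"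
      for q k a k' a'
  proof -
    have "k \<in> fst ` set q" "k' \<in> fst ` set q" using that by force+
    then have "inv (ev k) \<otimes> ev k' \<in> ?S" using that(1) by blast
    then have "inv (ev k) \<otimes> ev k' \<in> ev ` set K" unfolding K(1) .
    then obtain d where "d \<in> set K" "ev d = inv (ev k) \<otimes> ev k'" by (metis imageE)
    then show ?thesis by (intro bexI[of _ d]) (simp_all add: same_ev ev_append ev_inv)
  qed
  have "N > 0" using A set_ls by auto
  then have "fill_cert N Qc (K, Ew, m)"
    unfolding fill_cert_def using m nonempty ext diff by blast
  then show ?thesis ..
qed

text \<open>The piece is a point y of \<open>X\<close> that shows P at the identity, cut down to the
  closure of the domain of P under dependencies. It contains no pattern of \<open>Q\<close> at any
  position, because y contains none.\<close>

lemma start_cert_complete: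
  assumes Q: "coded Qc Q" and P: "denotes Pc P" and occ: "occurs_in G P X"
      and nonocc: "\<And>q. q \<in> Q \<Longrightarrow> \<not> occurs_in G q X"
  shows "\<exists>p. start_cert N Qc Pc p"
proof -
  obtain y where y: "y \<in> X" "matches P \<one> (carrier G) y"
      using point_at_one[OF occ] denotes_dom_finite[OF P] by blast
  let ?V = "\<Union>q\<in>set Qc. \<Union>k\<in>fst ` set q. \<Union>k'\<in>fst ` set q. {inv (ev k) \<otimes> ev k'}"
  have "finite ?V" "?V \<subseteq> carrier G" by auto
  from prec_closure[OF conjunct1 conjunct2 this, OF denotes_dom_finite[OF P] denotes_dom_finite[OF P]]
  obtain D' where D': "finite D'" "dom P \<subseteq> D'" "D' \<subseteq> carrier G"
    "\<forall>d\<in>D'. \<forall>v\<in>?V. d \<otimes> v \<in> before d \<longrightarrow> d \<otimes> v \<in> D'"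
    by (elim exE conjE) (rule that)
  obtain D where D: "ev ` set D = D'" using eval_set_words[OF D'(1,3)] by blast
  obtain p where "denotes p (part (ev ` set D) y)" using assigns_part[OF X_PiE[OF y(1)]] by blast
  then have p: "denotes p (part D' y)" using D by simp
  have domp: "ev ` fst ` set p = D'" unfolding denotes_dom[OF p, symmetric]
      by (auto simp: part_def split: if_splits)
  have "matches P \<one> D' y"
    unfolding matches_def
  proof
    fix k assume k: "k \<in> dom P"
    then have "k \<in> D'" "k \<in> carrier G" using D'(2,3) by blast+
    then show "\<one> \<otimes> k \<in> D' \<and> Some (y (\<one> \<otimes> k)) = P k"
      using y(2)[unfolded matches_def, rule_format, OF k] by simp
  qed
  then have start: "matches_word Pc [] p" unfolding matches_word_iff[OF P p] by (simp add: matches_part)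
  have free: "\<not> matches_word q u p" if "q \<in> set Qc" for q u
  proof
    assume m: "matches_word q u p"
    obtain M where M: "M \<in> Q" "denotes q M" using codedD(1)[OF Q \<open>q \<in> set Qc\<close>] by blast
    have "matches M (ev u) D' y" using m unfolding matches_word_iff[OF M(2) p] matches_part .
    then show False using not_occurs_matches[OF nonocc[OF M(1)] y(1)] by simp
  qed
  have closed: "\<exists>(d', a')\<in>set p. same_word d' (d @ (inv_word k @ k'))"
    if "(d, a) \<in> set p" "q \<in> set Qc" "(k, b) \<in> set q" "(k', b') \<in> set q"
        "prec_word n (d @ (inv_word k @ k')) d" for d a q k b k' b'
  proof -
    have v: "inv (ev k) \<otimes> ev k' \<in> ?V"
    proof -
      have "k \<in> fst ` set q" "k' \<in> fst ` set q" using that by force+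
      then show ?thesis using that(2) by blast
    qed
    have "d \<in> fst ` set p" using that(1) by force
    then have "ev d \<in> D'" using domp by blast
    moreover have "ev d \<otimes> (inv (ev k) \<otimes> ev k') \<in> before (ev d)"
      using that(5) by (simp add: prec_word_iff ev_append ev_inv before_def)
    ultimately have "ev d \<otimes> (inv (ev k) \<otimes> ev k') \<in> ev ` fst ` set p" using D'(4) v unfolding domp by blast
    then obtain d' a' where "(d', a') \<in> set p" "ev d' = ev d \<otimes> (inv (ev k) \<otimes> ev k')" by force
    then show ?thesis by (intro bexI[of _ "(d', a')"]) (simp_all add: same_ev ev_append ev_inv)
  qed
  have "functional N p" using p functional_iff by blast
  then have "start_cert N Qc Pc p"
    unfolding start_cert_def using start free closed by blast
  then show ?thesis ..
qed

lemma presence_complete: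
  assumes avo: "II_avoshift G n H h A X" and fin: "finite F" and F: "coded Fc F" and P: "denotes Pc P"
      and occ: "occurs_in G P X"
  shows "\<exists>c. presence_cert N Fc Pc c"
proof -
  have av: "avo G A X C" if "inductive_interval G n H h C" for C using avo that
      by (auto simp: II_avoshift_def)
  have ne: "X \<noteq> {}" using occ by (auto simp: occurs_in_def)
  from uniform_determines[OF av] obtain W0 where W0: "finite W0" "W0 \<subseteq> carrier G"
    "\<And>g. g \<in> carrier G \<Longrightarrow> determines A X (W0 \<inter> past g) (past g)" by blast
  \<comment> \<open>The identity joins the window so that it shows the letter under consideration,
    as \<open>extends_before\<close> requires.\<close>
  define W where "W = insert \<one> W0"
  have W: "finite W" "W \<subseteq> carrier G" "\<one> \<in> W" using W0 by (auto simp: W_def)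
  have det: "determines A X (W \<inter> past g) (past g)" if "g \<in> carrier G" for g
    by (rule determines_mono[OF W0(3)[OF that]]) (auto simp: W_def)
  have pat: "is_pattern G A q" if "q \<in> non_language W" for q
    using that W by (auto simp: non_language_def is_pattern_def intro: finite_subset)
  obtain Qc where Qc: "coded Qc (non_language W)" using coded_ex[OF finite_non_language[OF W(1)] pat] by blast
  let ?Q = "F \<union> non_language W"
  have Q: "coded (Fc @ Qc) ?Q" by (rule coded_append[OF F Qc])
  have nonocc: "\<not> occurs_in G q X" if "q \<in> ?Q" for q
    using that by (auto simp: non_language_def X_def SFT_def occurs_in_def)
  have "\<exists>E. finite E \<and> E \<subseteq> carrier G \<and> (\<forall>g\<in>carrier G. admits_fresh ?Q A E (past g))"
  proof (rule uniform_fresh[OF av ne W(2,3) det])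
    show "finite ?Q" using fin finite_non_language[OF W(1)] by simp
    show "non_language W \<subseteq> ?Q" by simp
    show "\<not> occurs_in G q X \<and> dom q \<subseteq> carrier G \<and> finite (dom q)" if "q \<in> ?Q" for q
      using that nonocc[OF that] pat F_pattern by (auto simp: is_pattern_def)
  qed
  then obtain E where E: "finite E" "E \<subseteq> carrier G" "\<And>g. g \<in> carrier G \<Longrightarrow> admits_fresh ?Q A E (past g)"
      by blast
  obtain c where "fill_cert N (Fc @ Qc) c" using fill_cert_complete[OF Q ne nonocc E] by blast
  moreover obtain p where "start_cert N (Fc @ Qc) Pc p" using start_cert_complete[OF Q P occ nonocc] by blast
  ultimately have "presence_cert N Fc Pc (Qc, c, p)" by (simp add: presence_cert_def)
  then show ?thesis ..
qed

text \<open>The prescribed coding of inputs coincides with the one of class \<open>enc\<close>, so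
  the search can take its arguments as they come.\<close>

lemma enc_entry: "(enc :: word \<times> nat \<Rightarrow> nat) = encode_entry"
proof
  fix e :: "word \<times> nat"
  show "enc e = encode_entry e"
    by (cases e) (simp add: enc_pair enc_list_def enc_int_def encode_entry_def)
qed

lemma codes_pattern_denotes:
  assumes "codes_pattern G n h ls c P"
  shows "\<exists>p. c = enc p \<and> denotes p P"
proof -
  from assms obtain p where c: "c = list_encode (map encode_entry p)"
    and p: "\<forall>(w, a)\<in>set p. is_word n w \<and> a < N"
    and graph: "Map.graph P = (\<lambda>(w, a). (word_val G h w, ls ! a)) ` set p"
    unfolding codes_pattern_def by (elim exE conjE) (rule that)
  have "Map.graph P = (\<lambda>(w, a). (ev w, ls ! a)) ` set p"
    unfolding graph by (rule image_cong) (use p in \<open>auto simp: eval_word_val\<close>)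
  then have "denotes p P" using p by (auto simp: denotes_def)
  moreover have "c = enc p" by (simp add: c enc_list_def enc_entry)
  ultimately show ?thesis by blast
qed

lemma codes_pattern_set_coded:
  assumes "codes_pattern_set G n h ls c S"
  shows "\<exists>Q. c = enc Q \<and> coded Q S \<and> finite S \<and> (\<forall>P\<in>S. is_pattern G A P)"
proof -
  from assms obtain cs Ps where c: "c = list_encode cs" and cP: "list_all2 (codes_pattern G n h ls) cs Ps"
      and S: "S = set Ps"
    unfolding codes_pattern_set_def by (elim exE conjE) (rule that)
  from cP have "\<exists>Q. cs = map enc Q \<and> coded Q (set Ps) \<and> (\<forall>P\<in>set Ps. is_pattern G A P)"
  proof (induction rule: list_all2_induct)
    case Nil
    show ?case by (intro exI[of _ "[]"]) (simp add: coded_def)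
  next
    case (Cons c cs P Ps)
    then obtain Q where Q: "cs = map enc Q" "coded Q (set Ps)" "\<forall>P\<in>set Ps. is_pattern G A P" by blast
    from codes_pattern_denotes[OF Cons(1)] obtain p where p: "c = enc p" "denotes p P" by blast
    have "is_pattern G A P" using Cons(1) by (simp add: codes_pattern_def set_ls)
    moreover have "coded ([p] @ Q) ({P} \<union> set Ps)"
      by (rule coded_append[OF _ Q(2)]) (simp add: coded_def p)
    ultimately show ?case using Q p by (intro exI[of _ "p # Q"]) simp
  qed
  then show ?thesis unfolding S c enc_list_def comp_def by blast
qed

lemma absence_cert_iff_ex:
  assumes "coded Fc F" "denotes Pc P"
  shows "(\<exists>c. absence_cert N Fc Pc c) \<longleftrightarrow> \<not> occurs_in G P X"
  using absence_sound[OF assms] absence_complete[OF assms] by (metis surj_pair)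

end

section \<open>The two algorithms\<close>

context polycycle
begin

lemma sft_code_intro:
  assumes "finite A" "distinct ls" "set ls = A" "\<And>P. P \<in> F \<Longrightarrow> is_pattern G A P"
  shows "sft_code G n H h A F ls"
  using assms by unfold_locales

lemma language_safely_computable:
  assumes "finite A" "distinct ls" "set ls = A"
  shows "\<exists>f. \<forall>c d F P. codes_pattern_set G n h ls c F \<and> codes_pattern G n h ls d P \<longrightarrow>
    safely_answers f [c, d] (occurs_in G P (SFT G A F)) (II_avoshift G n H h A (SFT G A F))"
proof -
  let ?N = "length ls"
  \<comment> \<open>One search variable carries data of both kinds; each test looks at its own
    component.\<close>
  let ?Y = "\<lambda>a b (c :: presence_data \<times> absence_data). presence_cert ?N a b (fst c)"
  let ?Z = "\<lambda>a b (c :: presence_data \<times> absence_data). absence_cert ?N a b (snd c)"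
  \<comment> \<open>\<open>coded\<close> and \<open>denotes\<close> speak of words and letters only;
    this interpretation provides them before the forbidden patterns are fixed.\<close>
  interpret D: sft_code G n H h A "{}" ls by (rule sft_code_intro[OF assms]) simp
  have "decidable (\<lambda>x. ?Y (fst (fst x)) (snd (fst x)) (snd x))"
    by (intro decidable_presence_cert computable_intros)
  moreover have "decidable (\<lambda>x. ?Z (fst (fst x)) (snd (fst x)) (snd x))"
    by (intro decidable_absence_cert computable_intros)
  ultimately have "\<exists>f. \<forall>a b Q S. (\<forall>c. ?Y a b c \<longrightarrow> Q) \<and> (\<forall>c. ?Z a b c \<longrightarrow> \<not> Q) \<and>
    (S \<longrightarrow> (\<exists>c. ?Y a b c \<or> ?Z a b c)) \<longrightarrow> safely_answers f [enc a, enc b] Q S"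
    by (rule safe_search[where Y = ?Y and N = ?Z])
  then obtain f where f: "\<forall>a b Q S. (\<forall>c. ?Y a b c \<longrightarrow> Q) \<and> (\<forall>c. ?Z a b c \<longrightarrow> \<not> Q) \<and>
    (S \<longrightarrow> (\<exists>c. ?Y a b c \<or> ?Z a b c)) \<longrightarrow> safely_answers f [enc a, enc b] Q S" ..
  show ?thesis
  proof (intro exI[of _ f] allI impI, elim conjE)
    fix c d F P assume "codes_pattern_set G n h ls c F" and "codes_pattern G n h ls d P"
    then obtain Fc Pc where Fc: "c = enc Fc" "D.coded Fc F" "finite F" "\<forall>P\<in>F. is_pattern G A P"
      and Pc: "d = enc Pc" "D.denotes Pc P"
      using D.codes_pattern_set_coded D.codes_pattern_denotes by metis
    interpret S: sft_code G n H h A F ls by (rule sft_code_intro[OF assms]) (use Fc in blast)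
    note ab = S.absence_cert_iff_ex[OF Fc(2) Pc(2)]
    show "safely_answers f [c, d] (occurs_in G P (SFT G A F)) (II_avoshift G n H h A (SFT G A F))"
      unfolding Fc(1) Pc(1) S.X_def[symmetric]
    proof (rule f[rule_format], intro conjI impI)
      show "\<forall>c. ?Y Fc Pc c \<longrightarrow> occurs_in G P S.X"
        using S.presence_sound[OF Fc(2) Pc(2)] by blast
      show "\<forall>c. ?Z Fc Pc c \<longrightarrow> \<not> occurs_in G P S.X"
        using ab by blast
      assume "II_avoshift G n H h A S.X"
      from S.presence_complete[OF this Fc(3,2) Pc(2)] ab
      show "\<exists>c. ?Y Fc Pc c \<or> ?Z Fc Pc c"
        by (metis fst_conv snd_conv)
    qed
  qed
qed

text \<open>X lies in Y exactly if no pattern forbidden in Y occurs in X. So yes is witnessed by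
  refutations of all these patterns, and no by a presence certificate for one of them.\<close>

lemma inclusion_safely_decidable:
  assumes "finite A" "distinct ls" "set ls = A"
  shows "\<exists>f. \<forall>c d E F. codes_pattern_set G n h ls c E \<and> codes_pattern_set G n h ls d F \<longrightarrow>
    safely_answers f [c, d] (SFT G A E \<subseteq> SFT G A F) (II_avoshift G n H h A (SFT G A E))"
proof -
  let ?N = "length ls"
  let ?Y = "\<lambda>a b (c :: absence_data list \<times> presence_data). \<forall>P\<in>set b. \<exists>z\<in>set (fst c). absence_cert ?N a P z"
  let ?Z = "\<lambda>a b (c :: absence_data list \<times> presence_data). \<exists>P\<in>set b. presence_cert ?N a P (snd c)"
  interpret D: sft_code G n H h A "{}" ls by (rule sft_code_intro[OF assms]) simp
  have "decidable (\<lambda>x. ?Y (fst (fst x)) (snd (fst x)) (snd x))"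
    by (intro decidable_absence_cert computable_intros)
  moreover have "decidable (\<lambda>x. ?Z (fst (fst x)) (snd (fst x)) (snd x))"
    by (intro decidable_presence_cert computable_intros)
  ultimately have "\<exists>f. \<forall>a b Q S. (\<forall>c. ?Y a b c \<longrightarrow> Q) \<and> (\<forall>c. ?Z a b c \<longrightarrow> \<not> Q) \<and>
    (S \<longrightarrow> (\<exists>c. ?Y a b c \<or> ?Z a b c)) \<longrightarrow> safely_answers f [enc a, enc b] Q S"
    by (rule safe_search[where Y = ?Y and N = ?Z])
  then obtain f where f: "\<forall>a b Q S. (\<forall>c. ?Y a b c \<longrightarrow> Q) \<and> (\<forall>c. ?Z a b c \<longrightarrow> \<not> Q) \<and>
    (S \<longrightarrow> (\<exists>c. ?Y a b c \<or> ?Z a b c)) \<longrightarrow> safely_answers f [enc a, enc b] Q S" ..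
  show ?thesis
  proof (intro exI[of _ f] allI impI, elim conjE)
    fix c d E F assume "codes_pattern_set G n h ls c E" and "codes_pattern_set G n h ls d F"
    then obtain Ec Fc where Ec: "c = enc Ec" "D.coded Ec E" "finite E" "\<forall>P\<in>E. is_pattern G A P"
      and Fc: "d = enc Fc" "D.coded Fc F"
      using D.codes_pattern_set_coded by metis
    interpret S: sft_code G n H h A E ls by (rule sft_code_intro[OF assms]) (use Ec in blast)
    have incl: "S.X \<subseteq> SFT G A F \<longleftrightarrow> (\<forall>P\<in>F. \<not> occurs_in G P S.X)"
      unfolding S.X_def by (auto simp: SFT_def occurs_in_def)
    show "safely_answers f [c, d] (SFT G A E \<subseteq> SFT G A F) (II_avoshift G n H h A (SFT G A E))"
      unfolding Ec(1) Fc(1) S.X_def[symmetric]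
    proof (rule f[rule_format], intro conjI impI)
      show "\<forall>c. ?Y Ec Fc c \<longrightarrow> S.X \<subseteq> SFT G A F"
      proof (intro allI impI)
        fix c assume Y: "?Y Ec Fc c"
        have "\<not> occurs_in G P S.X" if "P \<in> F" for P
        proof -
          obtain p where p: "p \<in> set Fc" "D.denotes p P" using D.codedD(2)[OF Fc(2) \<open>P \<in> F\<close>] by blast
          then show ?thesis using Y S.absence_cert_iff_ex[OF Ec(2) p(2)] by blast
        qed
        then show "S.X \<subseteq> SFT G A F" unfolding incl by blast
      qed
      show "\<forall>c. ?Z Ec Fc c \<longrightarrow> \<not> S.X \<subseteq> SFT G A F"
      proof (intro allI impI)
        fix c assume "?Z Ec Fc c"
        then obtain p where p: "p \<in> set Fc" "presence_cert ?N Ec p (snd c)" by blast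
        obtain P where P: "P \<in> F" "D.denotes p P" using D.codedD(1)[OF Fc(2) p(1)] by blast
        then show "\<not> S.X \<subseteq> SFT G A F" unfolding incl using S.presence_sound[OF Ec(2) P(2) p(2)] by blast
      qed
      assume avo: "II_avoshift G n H h A S.X"
      show "\<exists>c. ?Y Ec Fc c \<or> ?Z Ec Fc c"
      proof (cases "\<forall>p\<in>set Fc. \<exists>z. absence_cert ?N Ec p z")
        case True
        then obtain z where "\<And>p. p \<in> set Fc \<Longrightarrow> absence_cert ?N Ec p (z p)" by metis
        then have "?Y Ec Fc (map z Fc, undefined)" by auto
        then show ?thesis by blast
      next
        case False
        then obtain p where p: "p \<in> set Fc" "\<not> (\<exists>z. absence_cert ?N Ec p z)" by blast
        obtain P where P: "P \<in> F" "D.denotes p P" using D.codedD(1)[OF Fc(2) p(1)] by blast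
        have "occurs_in G P S.X" using p(2) S.absence_cert_iff_ex[OF Ec(2) P(2)] by blast
        from S.presence_complete[OF avo Ec(3,2) P(2) this] obtain c where "presence_cert ?N Ec p c" by blast
        then have "?Z Ec Fc (undefined, c)" using p(1) by auto
        then show ?thesis by blast
      qed
    qed
  qed
qed

end

theorem theorem8p9:
  fixes G :: "('g, 'm) monoid_scheme" and n :: nat
    and H :: "nat \<Rightarrow> 'g set" and h :: "nat \<Rightarrow> 'g"
    and A :: "'b set" and ls :: "'b list"
  assumes "polycycle G n H h"
    and "finite A" and "distinct ls" and "set ls = A"
  shows "(\<exists>f. \<forall>c d F P.
            codes_pattern_set G n h ls c F \<and> codes_pattern G n h ls d P \<longrightarrow>
            safely_answers f [c, d] (occurs_in G P (SFT G A F))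
              (II_avoshift G n H h A (SFT G A F)))
       \<and> (\<exists>f. \<forall>c d E F.
            codes_pattern_set G n h ls c E \<and> codes_pattern_set G n h ls d F \<longrightarrow>
            safely_answers f [c, d] (SFT G A E \<subseteq> SFT G A F)
              (II_avoshift G n H h A (SFT G A E)))"
  using polycycle.language_safely_computable[OF assms] polycycle.inclusion_safely_decidable[OF assms]
  by (rule conjI)

end
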